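(* Let $R$ be an EPRF-TRS over a ranked alphabet $\Sigma$. Then it is decidable whether $R$ is locally confluent.
   Context: A ranked alphabet $\Sigma$ is a finite set of symbols with ranks; $X=\{x_1,x_2,\dots\}$ is a countable set of variables, $T_\Sigma(X)$ the terms over $\Sigma$ and $X$, $T_\Sigma$ the ground terms. A TRS $R$ over $\Sigma$ is a finite set of rules $l\to r$, $l,r\in T_\Sigma(X)$, with every variable of $r$ occurring in $l$; $\Rightarrow_R$ is the rewrite relation on $T_\Sigma(X)$, $\Rightarrow^*_R$ its reflexive transitive closure; $sign(R)$ is the set of symbols occurring in the rules. $R$ is locally confluent if whenever $t\Rightarrow_R t_1$ and $t\Rightarrow_R t_2$ there is $t'$ with $t_1\Rightarrow^*_R t'$ and $t_2\Rightarrow^*_R t'$. For $L\subseteq T_\Sigma$, $R^*_\Sigma(L)=\{p\mid q\Rightarrow^*_R p,\ q\in L\}$. A bottom-up tree automaton (bta) over $\Sigma$ is a finite automaton with states (treated as constants), final states, rules $\delta(a_1,\dots,a_n)\to a$ and $a\to a'$; it recognizes the ground terms rewriting to a final state. $R$ is an EPRF-TRS if for any given ranked alphabet $\Sigma\supseteq sign(R)$ and finite $L\subseteq T_\Sigma$ one can effectively construct a bta $\mathcal{C}$ over $\Sigma$ with $L(\mathcal{C})=R^*_\Sigma(L)$. *)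

theory Defs
  imports Main "HOL-Library.Nat_Bijection"
begin

section \<open>Ranked alphabets and terms\<close>

text \<open>A ranked symbol is a pair (name, rank), so every symbol has a unique rank and a ranked
  alphabet is just a finite set of symbols. Names are natural numbers, which
  makes every finite object below encodable as a natural number.\<close>

type_synonym symb = "nat \<times> nat"

abbreviation rank :: "symb \<Rightarrow> nat" where
  "rank \<equiv> snd"

datatype trm = Var nat | Fun symb "trm list"

primrec vars :: "trm \<Rightarrow> nat set" where
  "vars (Var x) = {x}"
| "vars (Fun f ts) = \<Union> (set (map vars ts))"

primrec funs :: "trm \<Rightarrow> symb set" where
  "funs (Var x) = {}"
| "funs (Fun f ts) = insert f (\<Union> (set (map funs ts)))"

primrec subst :: "(nat \<Rightarrow> trm) \<Rightarrow> trm \<Rightarrow> trm" where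
  "subst \<sigma> (Var x) = \<sigma> x"
| "subst \<sigma> (Fun f ts) = Fun f (map (subst \<sigma>) ts)"

inductive_set terms :: "symb set \<Rightarrow> trm set" for \<Sigma> :: "symb set" where
  Var: "Var x \<in> terms \<Sigma>"
| Fun: "f \<in> \<Sigma> \<Longrightarrow> length ts = rank f \<Longrightarrow> (\<And>t. t \<in> set ts \<Longrightarrow> t \<in> terms \<Sigma>)
    \<Longrightarrow> Fun f ts \<in> terms \<Sigma>"

definition gterms :: "symb set \<Rightarrow> trm set" where
  "gterms \<Sigma> = {t \<in> terms \<Sigma>. vars t = {}}"


section \<open>Term rewrite systems\<close>

type_synonym rule = "trm \<times> trm"

definition trs :: "symb set \<Rightarrow> rule set \<Rightarrow> bool" where
  "trs \<Sigma> R \<longleftrightarrow> finite R \<and>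
     (\<forall>(l, r) \<in> R. l \<in> terms \<Sigma> \<and> r \<in> terms \<Sigma> \<and> vars r \<subseteq> vars l)"

definition sign :: "rule set \<Rightarrow> symb set" where
  "sign R = (\<Union>(l, r) \<in> R. funs l \<union> funs r)"

inductive_set rstep :: "rule set \<Rightarrow> (trm \<times> trm) set" for R :: "rule set" where
  root: "(l, r) \<in> R \<Longrightarrow> (subst \<sigma> l, subst \<sigma> r) \<in> rstep R"
| arg: "(s, t) \<in> rstep R \<Longrightarrow> (Fun f (us @ s # vs), Fun f (us @ t # vs)) \<in> rstep R"

definition rewrite :: "symb set \<Rightarrow> rule set \<Rightarrow> (trm \<times> trm) set" where
  "rewrite \<Sigma> R = rstep R \<inter> (terms \<Sigma> \<times> terms \<Sigma>)"

definition locally_confluent :: "symb set \<Rightarrow> rule set \<Rightarrow> bool" where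
  "locally_confluent \<Sigma> R \<longleftrightarrow>
     (\<forall>t \<in> terms \<Sigma>. \<forall>t1 t2. (t, t1) \<in> rewrite \<Sigma> R \<and> (t, t2) \<in> rewrite \<Sigma> R \<longrightarrow>
        (\<exists>t'. (t1, t') \<in> (rewrite \<Sigma> R)\<^sup>* \<and> (t2, t') \<in> (rewrite \<Sigma> R)\<^sup>*))"

definition descendants :: "symb set \<Rightarrow> rule set \<Rightarrow> trm set \<Rightarrow> trm set" where
  "descendants \<Sigma> R L = {p. \<exists>q \<in> L. (q, p) \<in> (rewrite \<Sigma> R)\<^sup>*}"


section \<open>Bottom-up tree automata\<close>

text \<open>An automaton is a triple of states, final states and rules. States are constants
  outside the input alphabet, and the rules form a ground rewrite system over the
  alphabet extended by the states.\<close>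

type_synonym bta = "symb set \<times> symb set \<times> rule set"

abbreviation const :: "symb \<Rightarrow> trm" where
  "const a \<equiv> Fun a []"

fun is_bta :: "symb set \<Rightarrow> bta \<Rightarrow> bool" where
  "is_bta \<Sigma> (A, Af, \<Delta>) \<longleftrightarrow>
     finite A \<and> (\<forall>a \<in> A. rank a = 0) \<and> A \<inter> \<Sigma> = {} \<and> Af \<subseteq> A \<and> finite \<Delta> \<and>
     (\<forall>\<rho> \<in> \<Delta>.
        (\<exists>f as a. f \<in> \<Sigma> \<and> length as = rank f \<and> set as \<subseteq> A \<and> a \<in> A \<and>
                  \<rho> = (Fun f (map const as), const a)) \<or>
        (\<exists>a \<in> A. \<exists>a' \<in> A. \<rho> = (const a, const a')))"

fun lang :: "symb set \<Rightarrow> bta \<Rightarrow> trm set" where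
  "lang \<Sigma> (A, Af, \<Delta>) =
     {t \<in> gterms \<Sigma>. \<exists>a \<in> Af. (t, const a) \<in> (rewrite (\<Sigma> \<union> A) \<Delta>)\<^sup>*}"


section \<open>Partial recursive functions\<close>

text \<open>Kleene's partial recursive functions: zero, successor, projections, composition,
  primitive recursion (on the first argument) and unbounded minimization (of the first
  argument). The value None means that the computation diverges, or that
  the number of arguments is inadequate.\<close>

datatype recf = Z | S | Proj nat | Comp recf "recf list" | Prec recf recf | Mn recf

fun rec_eval :: "recf \<Rightarrow> nat list \<Rightarrow> nat option" where
  "rec_eval Z xs = Some 0"
| "rec_eval S xs = (case xs of [x] \<Rightarrow> Some (Suc x) | _ \<Rightarrow> None)"
| "rec_eval (Proj i) xs = (if i < length xs then Some (xs ! i) else None)"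
| "rec_eval (Comp f gs) xs =
     (if \<exists>g \<in> set gs. rec_eval g xs = None then None
      else rec_eval f (map (\<lambda>g. the (rec_eval g xs)) gs))"
| "rec_eval (Prec f g) xs =
     (case xs of [] \<Rightarrow> None
      | n # ys \<Rightarrow> rec_nat (rec_eval f ys)
          (\<lambda>m v. case v of None \<Rightarrow> None | Some y \<Rightarrow> rec_eval g (m # y # ys)) n)"
| "rec_eval (Mn f) xs =
     (let P = (\<lambda>n. rec_eval f (n # xs) = Some 0 \<and>
                   (\<forall>i < n. \<exists>y. rec_eval f (i # xs) = Some (Suc y)))
      in if \<exists>n. P n then Some (THE n. P n) else None)"


section \<open>Encoding of finite objects as natural numbers\<close>

definition code_alphabet :: "symb set \<Rightarrow> nat" where
  "code_alphabet \<Sigma> = set_encode (prod_encode ` \<Sigma>)"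

primrec code_trm :: "trm \<Rightarrow> nat" where
  "code_trm (Var x) = sum_encode (Inl x)"
| "code_trm (Fun f ts) =
     sum_encode (Inr (prod_encode (prod_encode f, list_encode (map code_trm ts))))"

definition code_trms :: "trm set \<Rightarrow> nat" where
  "code_trms L = set_encode (code_trm ` L)"

definition code_trs :: "rule set \<Rightarrow> nat" where
  "code_trs R = set_encode ((\<lambda>(l, r). prod_encode (code_trm l, code_trm r)) ` R)"

fun code_bta :: "bta \<Rightarrow> nat" where
  "code_bta (A, Af, \<Delta>) =
     prod_encode (code_alphabet A, prod_encode (code_alphabet Af, code_trs \<Delta>))"

lemma code_trm_inject: "code_trm s = code_trm t \<longleftrightarrow> s = t"
proof
  show "code_trm s = code_trm t \<Longrightarrow> s = t"
  proof (induction s arbitrary: t)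
    case (Var x)
    then show ?case by (cases t) (auto dest: injD[OF inj_sum_encode])
  next
    case (Fun f ss)
    then obtain ts where t: "t = Fun f ts" and m: "map code_trm ss = map code_trm ts"
      by (cases t) (auto simp: list_encode_eq dest!: injD[OF inj_sum_encode])
    have "ss = ts"
      using m Fun.IH by (metis inj_on_def list.inj_map_strong)
    then show ?case using t by simp
  qed
qed simp


section \<open>Effective preservation of recognizability for finite tree languages\<close>

text \<open>The construction c may depend on the rewrite system, but it is uniform in
  the alphabet and in the finite language, which are its only inputs.\<close>

definition eprf :: "rule set \<Rightarrow> bool" where
  "eprf R \<longleftrightarrow>
     (\<exists>c. \<forall>\<Sigma> L. finite \<Sigma> \<and> sign R \<subseteq> \<Sigma> \<and> finite L \<and> L \<subseteq> gterms \<Sigma> \<longrightarrow>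
        (\<exists>C. rec_eval c [code_alphabet \<Sigma>, code_trms L] = Some (code_bta C) \<and>
             is_bta \<Sigma> C \<and> lang \<Sigma> C = descendants \<Sigma> R L))"

end

theory Submission
  imports Defs
begin

text \<open>The decision procedure is uniform in the rewrite system: it searches, in parallel, for a
  certificate of local confluence and for a certificate of its failure. The EPRF property
  only guarantees that one of them exists, and the construction it provides is never run.

  By the critical pair lemma, local confluence amounts to the joinability of finitely many critical
  pairs, and joinability is enumerable. Conversely, let \<open>t1\<close> and \<open>t2\<close> form a peak that is not joinable.
  After freezing variables to fresh constants, their sets of descendants are recognizable, disjoint
  and closed under rewriting. The automata yield a congruence of finite index saturating both sets,
  hence a finite algebra whose values for \<open>t1\<close> and \<open>t2\<close> lie in disjoint sets that
  are closed under the image of one rewrite step. Such an algebra is a finite object which can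
  be checked mechanically, and its existence refutes joinability for any rewrite system.\<close>


section \<open>Computable functions and recursively enumerable predicates\<close>

text \<open>The order of quantifiers shapes the proof: \<open>d\<close> is fixed before
  \<open>R\<close>, whereas \<open>eprf R\<close> yields its construction for each \<open>R\<close>
  separately, so no program for it can be handed to \<open>d\<close>. Both searches must therefore
  be sound for every rewrite system, and EPRF may contribute nothing but the existence of a negative
  certificate. That certificate has to be finite although sets of descendants may be infinite. It
  contains a relation \<open>Q\<close> on the values of the algebra that covers every rewrite step
  between evaluable terms; a set of values closed under \<open>Q\<close> then encloses the values of
  all descendants, and two disjoint enclosures exclude a common reduct. Enclosures can be checked,
  exact sets of descendants cannot. The constants for frozen variables serve only to obtain
  automata: in the certificate a valuation \<open>\<alpha>\<close> takes their place. Enumerability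
  is obtained from closure properties of \<open>re\<close>, with operations such as append,
  substitution and evaluation treated as relations whose results are guessed. Only a few functions
  need an actual program.\<close>

definition rc :: "nat \<Rightarrow> (nat list \<Rightarrow> nat) \<Rightarrow> bool" where
  "rc k f \<longleftrightarrow> (\<exists>c. \<forall>xs. length xs = k \<longrightarrow> rec_eval c xs = Some (f xs))"

lemma rc_cong: "rc k f \<Longrightarrow> (\<And>xs. length xs = k \<Longrightarrow> f xs = g xs) \<Longrightarrow> rc k g"
  unfolding rc_def by metis

lemma rc_comp:
  assumes "rc (length gs) f" and "\<And>g. g \<in> set gs \<Longrightarrow> rc k g"
  shows "rc k (\<lambda>xs. f (map (\<lambda>g. g xs) gs))"
proof -
  obtain c where c: "\<And>ys. length ys = length gs \<Longrightarrow> rec_eval c ys = Some (f ys)"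
    using assms(1) unfolding rc_def by blast
  have "\<forall>g\<in>set gs. \<exists>d. \<forall>xs. length xs = k \<longrightarrow> rec_eval d xs = Some (g xs)"
    using assms(2) unfolding rc_def by blast
  then obtain d where d: "\<And>g xs. g \<in> set gs \<Longrightarrow> length xs = k \<Longrightarrow> rec_eval (d g) xs = Some (g xs)"
    by metis
  have "rec_eval (Comp c (map d gs)) xs = Some (f (map (\<lambda>g. g xs) gs))" if "length xs = k" for xs
  proof -
    have m: "map (\<lambda>g. the (rec_eval g xs)) (map d gs) = map (\<lambda>g. g xs) gs"
      using d that by simp
    have "\<not> (\<exists>g\<in>set (map d gs). rec_eval g xs = None)"
      using d that by auto
    then show ?thesis
      by (simp add: m c del: map_map)
  qed
  then show ?thesis
    unfolding rc_def by blast
qed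

lemma rc_nth: "i < k \<Longrightarrow> rc k (\<lambda>xs. xs ! i)"
  unfolding rc_def by (rule exI[of _ "Proj i"]) auto

lemma rc_compose1:
  assumes "rc 1 (\<lambda>ys. F (ys ! 0))" "rc k g"
  shows "rc k (\<lambda>xs. F (g xs))"
  using rc_comp[of "[g]" "\<lambda>ys. F (ys ! 0)" k] assms by simp

lemma rc_Suc: "rc k g \<Longrightarrow> rc k (\<lambda>xs. Suc (g xs))"
proof (rule rc_compose1[of Suc])
  have "rec_eval S xs = Some (Suc (xs ! 0))" if "length xs = 1" for xs
    using that by (cases xs) auto
  then show "rc 1 (\<lambda>ys. Suc (ys ! 0))"
    unfolding rc_def by blast
qed

lemma rc_const: "rc k (\<lambda>xs. n)"
proof (induction n)
  case 0
  show ?case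
    unfolding rc_def by (rule exI[of _ Z]) simp
qed (rule rc_Suc)

text \<open>Composition with the projections from index 2 on. In the step of a primitive recursion
  the counter and the previous value precede the parameters; this makes a function of the parameters
  alone available there.\<close>

lemma rc_drop: "rc k g \<Longrightarrow> rc (Suc (Suc k)) (\<lambda>ys. g (drop 2 ys))"
proof -
  assume g: "rc k g"
  let ?gs = "map (\<lambda>i (ys::nat list). ys ! i) [2..<Suc (Suc k)]"
  have "rc (Suc (Suc k)) (\<lambda>ys. g (map (\<lambda>h. h ys) ?gs))"
    by (rule rc_comp) (auto simp: g intro: rc_nth simp del: upt_Suc)
  then show ?thesis
    by (rule rc_cong) (auto intro!: arg_cong[of _ _ g] nth_equalityI simp del: upt_Suc)
qed

text \<open>\<open>Prec\<close> recurses on the first entry of its argument list. Composing it with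
  \<open>n\<close> followed by all \<open>k\<close> projections allows a computed recursion bound
  while the whole list \<open>xs\<close> remains as parameters.\<close>

lemma rc_rec:
  assumes n: "rc k n" and f: "rc k f"
    and G: "rc (Suc (Suc k)) (\<lambda>ys. G (ys ! 0) (ys ! 1) (drop 2 ys))"
  shows "rc k (\<lambda>xs. rec_nat (f xs) (\<lambda>m v. G m v xs) (n xs))"
proof -
  obtain c where c: "\<And>xs. length xs = k \<Longrightarrow> rec_eval c xs = Some (f xs)"
    using f unfolding rc_def by blast
  obtain d where d: "\<And>ys. length ys = Suc (Suc k) \<Longrightarrow>
      rec_eval d ys = Some (G (ys ! 0) (ys ! 1) (drop 2 ys))"
    using G unfolding rc_def by blast
  have it: "rec_nat (rec_eval c xs)
      (\<lambda>m v. case v of None \<Rightarrow> None | Some y \<Rightarrow> rec_eval d (m # y # xs)) i =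
      Some (rec_nat (f xs) (\<lambda>m v. G m v xs) i)" if "length xs = k" for xs i
    using that by (induction i) (auto simp: c d)
  have "rec_eval (Prec c d) ys = Some (rec_nat (f (tl ys)) (\<lambda>m v. G m v (tl ys)) (hd ys))"
    if "length ys = Suc k" for ys
    using that by (cases ys) (auto simp: it)
  then have r: "rc (Suc k) (\<lambda>ys. rec_nat (f (tl ys)) (\<lambda>m v. G m v (tl ys)) (hd ys))"
    unfolding rc_def by blast
  let ?gs = "n # map (\<lambda>i (ys::nat list). ys ! i) [0..<k]"
  have "rc k (\<lambda>xs. rec_nat (f (tl (map (\<lambda>h. h xs) ?gs)))
      (\<lambda>m v. G m v (tl (map (\<lambda>h. h xs) ?gs))) (hd (map (\<lambda>h. h xs) ?gs)))"
    by (rule rc_comp[of ?gs "\<lambda>ys. rec_nat (f (tl ys)) (\<lambda>m v. G m v (tl ys)) (hd ys)"])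
      (use r n in \<open>auto intro: rc_nth\<close>)
  then show ?thesis
  proof (rule rc_cong)
    fix xs :: "nat list"
    assume "length xs = k"
    then have "map (\<lambda>h. h xs) (map (\<lambda>i (ys::nat list). ys ! i) [0..<k]) = xs"
      by (auto intro: nth_equalityI)
    then show "rec_nat (f (tl (map (\<lambda>h. h xs) ?gs)))
      (\<lambda>m v. G m v (tl (map (\<lambda>h. h xs) ?gs))) (hd (map (\<lambda>h. h xs) ?gs)) =
      rec_nat (f xs) (\<lambda>m v. G m v xs) (n xs)"
      by (simp del: map_map)
  qed
qed

section \<open>Arithmetic and conditionals by primitive recursion\<close>

lemma rc_add: "rc k a \<Longrightarrow> rc k b \<Longrightarrow> rc k (\<lambda>xs. a xs + b xs)"
proof -
  assume ab: "rc k a" "rc k b"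
  have e: "rec_nat n (\<lambda>m v. Suc v) m = m + n" for m n :: nat
    by (induction m) auto
  have "rc k (\<lambda>xs. rec_nat (b xs) (\<lambda>m v. Suc v) (a xs))"
    by (rule rc_rec[of k a b "\<lambda>m v xs. Suc v"]) (auto intro: ab rc_Suc rc_nth)
  then show ?thesis
    by (simp add: e)
qed

lemma rc_diff: "rc k a \<Longrightarrow> rc k b \<Longrightarrow> rc k (\<lambda>xs. a xs - b xs)"
proof -
  assume ab: "rc k a" "rc k b"
  have pe: "rec_nat 0 (\<lambda>m v. m) m = m - 1" for m :: nat
    by (cases m) auto
  have "rc j (\<lambda>xs. rec_nat 0 (\<lambda>m v. m) (a xs))" if "rc j a" for j and a
    by (rule rc_rec[of j a "\<lambda>xs. 0" "\<lambda>m v xs. m"]) (auto intro: that rc_const rc_nth)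
  then have p: "rc j (\<lambda>xs. a xs - 1)" if "rc j a" for j and a
    using that by (simp add: pe)
  have e: "rec_nat m (\<lambda>i v. v - 1) n = m - n" for m n :: nat
    by (induction n) auto
  have "rc k (\<lambda>xs. rec_nat (a xs) (\<lambda>m v. v - 1) (b xs))"
    by (rule rc_rec[of k b a "\<lambda>m v xs. v - 1"]) (intro ab p rc_nth; simp)+
  then show ?thesis
    by (simp only: e)
qed

lemma rc_if:
  assumes "rc k a" "rc k b" "rc k c"
  shows "rc k (\<lambda>xs. if a xs = 0 then b xs else c xs)"
proof -
  have "rc k (\<lambda>xs. rec_nat (b xs) (\<lambda>m v. c xs) (a xs))"
    by (rule rc_rec[of k a b "\<lambda>m v xs. c xs"]) (use assms rc_drop in auto)
  then show ?thesis
  proof (rule rc_cong)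
    show "rec_nat (b xs) (\<lambda>m v. c xs) (a xs) = (if a xs = 0 then b xs else c xs)" for xs
      by (cases "a xs") auto
  qed
qed

section \<open>Computability of the pairing function and its inverses\<close>

lemma rc_triangle: "rc k a \<Longrightarrow> rc k (\<lambda>xs. triangle (a xs))"
proof -
  assume a: "rc k a"
  have e: "rec_nat 0 (\<lambda>m v. v + Suc m) n = triangle n" for n
    by (induction n) auto
  have "rc k (\<lambda>xs. rec_nat 0 (\<lambda>m v. v + Suc m) (a xs))"
    by (rule rc_rec[of k a "\<lambda>xs. 0" "\<lambda>m v xs. v + Suc m"])
      (intro a rc_const rc_add rc_Suc rc_nth; simp)+
  then show ?thesis
    by (simp only: e)
qed

lemma rc_prod_encode: "rc k a \<Longrightarrow> rc k b \<Longrightarrow> rc k (\<lambda>xs. prod_encode (a xs, b xs))"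
  by (simp add: prod_encode_def rc_add rc_triangle)

lemma triangle_mono: "m \<le> n \<Longrightarrow> triangle m \<le> triangle n"
  by (rule lift_Suc_mono_le[of triangle]) auto

text \<open>The largest \<open>v\<close> with \<open>triangle v \<le> n\<close>. Since
  \<open>prod_encode (a, b) = triangle (a + b) + a\<close>, it recovers \<open>a + b\<close> from a
  code. The comparison is written with truncated subtraction so that \<open>rc_if\<close> covers
  it.\<close>

definition triangle_root :: "nat \<Rightarrow> nat" where
  "triangle_root n = rec_nat 0 (\<lambda>m v. if triangle (Suc v) - Suc m = 0 then Suc v else v) n"

lemma triangle_root:
  "triangle (triangle_root n) \<le> n \<and> n < triangle (Suc (triangle_root n))"
  by (induction n) (auto simp: triangle_root_def)

lemma triangle_root_prod_encode: "triangle_root (prod_encode (a, b)) = a + b"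
proof -
  let ?n = "prod_encode (a, b)"
  have "triangle (a + b) \<le> ?n" "?n < triangle (Suc (a + b))"
    by (auto simp: prod_encode_def)
  then show ?thesis
    using triangle_root[of ?n] triangle_mono[of "Suc (a + b)" "triangle_root ?n"]
      triangle_mono[of "Suc (triangle_root ?n)" "a + b"] by linarith
qed

lemma prod_decode_via_root:
  "fst (prod_decode n) = n - triangle (triangle_root n)"
  "snd (prod_decode n) = triangle_root n - (n - triangle (triangle_root n))"
proof -
  obtain a b where n: "n = prod_encode (a, b)"
    by (metis prod_decode_inverse surj_pair)
  have "n - triangle (triangle_root n) = a"
    unfolding n triangle_root_prod_encode by (simp add: prod_encode_def)
  then show "fst (prod_decode n) = n - triangle (triangle_root n)"
    "snd (prod_decode n) = triangle_root n - (n - triangle (triangle_root n))"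
    by (simp_all add: n triangle_root_prod_encode)
qed

lemma rc_triangle_root: "rc k a \<Longrightarrow> rc k (\<lambda>xs. triangle_root (a xs))"
  unfolding triangle_root_def
  by (rule rc_rec[of k a "\<lambda>xs. 0"
        "\<lambda>m v xs. if triangle (Suc v) - Suc m = 0 then Suc v else v"])
    (assumption | rule rc_const rc_if rc_diff rc_triangle rc_Suc rc_nth | simp)+

lemma rc_fst_prod_decode: "rc k a \<Longrightarrow> rc k (\<lambda>xs. fst (prod_decode (a xs)))"
  unfolding prod_decode_via_root by (intro rc_diff rc_triangle rc_triangle_root)

lemma rc_snd_prod_decode: "rc k a \<Longrightarrow> rc k (\<lambda>xs. snd (prod_decode (a xs)))"
  unfolding prod_decode_via_root by (intro rc_diff rc_triangle rc_triangle_root)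


subsection \<open>Encodable types\<close>

text \<open>A bijection rather than an injection: every number is the code of some value, so an
  unbounded search over numbers is a search over the type and never meets an invalid code.\<close>

class enc =
  fixes code :: "'a \<Rightarrow> nat"
  assumes bij_code: "bij code"

definition decode :: "nat \<Rightarrow> 'a::enc" where
  "decode = inv code"

lemma decode_code [simp]: "decode (code x) = x"
  unfolding decode_def by (simp add: bij_code bij_is_inj)

lemma code_decode [simp]: "code (decode n :: 'a::enc) = n"
  unfolding decode_def by (meson bij_code bij_inv_eq_iff)

lemma code_eq_iff [simp]: "code x = code y \<longleftrightarrow> x = y"
  using bij_code by (auto dest: bij_is_inj injD)

instantiation nat :: enc
begin
definition code_nat :: "nat \<Rightarrow> nat" where [simp]: "code_nat n = n"
instance by standard (auto simp: bij_def inj_def)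
end

lemma decode_nat [simp]: "decode n = (n::nat)"
  by (metis code_nat_def decode_code)

instantiation prod :: (enc, enc) enc
begin
definition code_prod :: "'a \<times> 'b \<Rightarrow> nat" where
  "code_prod p = prod_encode (code (fst p), code (snd p))"
instance
proof
  show "bij (code :: 'a \<times> 'b \<Rightarrow> nat)"
  proof (rule bijI')
    show "(code x = code y) = (x = y)" for x y :: "'a \<times> 'b"
      by (auto simp: code_prod_def prod_eq_iff)
    show "\<exists>x. n = code (x :: 'a \<times> 'b)" for n
      by (rule exI[of _ "(decode (fst (prod_decode n)), decode (snd (prod_decode n)))"])
        (simp add: code_prod_def)
  qed
qed
end

instantiation list :: (enc) enc
begin
definition code_list :: "'a list \<Rightarrow> nat" where
  "code_list xs = list_encode (map code xs)"
instance
proof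
  show "bij (code :: 'a list \<Rightarrow> nat)"
  proof (rule bijI')
    show "(code x = code y) = (x = y)" for x y :: "'a list"
      by (auto simp: code_list_def list_encode_eq inj_map_eq_map inj_on_def)
    show "\<exists>x. n = code (x :: 'a list)" for n
      by (rule exI[of _ "map decode (list_decode n)"])
        (simp add: code_list_def comp_def)
  qed
qed
end

lemma in_set_less_list_encode: "x \<in> set xs \<Longrightarrow> x < list_encode xs"
proof (induction xs)
  case (Cons y ys)
  then show ?case
    using le_prod_encode_1[of y "list_encode ys"] le_prod_encode_2[of "list_encode ys" y]
    by (auto simp: less_Suc_eq_le)
qed simp

text \<open>Complete induction works because the arguments of a function term have smaller codes
  than the term. Surjectivity relies on \<open>trm\<close> not tying ranks to numbers of arguments;
  ill-ranked terms are coded too.\<close>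

lemma ex_code_trm: "\<exists>t. n = code_trm t"
proof (induction n rule: less_induct)
  case (less n)
  show ?case
  proof (cases "sum_decode n")
    case (Inl x)
    then have "n = code_trm (Var x)"
      using sum_decode_inverse[of n] by simp
    then show ?thesis ..
  next
    case (Inr p)
    then have n: "n = sum_encode (Inr p)"
      using sum_decode_inverse[of n] by simp
    obtain a b where p: "p = prod_encode (a, b)"
      using prod_decode_inverse[of p] by (cases "prod_decode p") auto
    have "b < n"
      using le_prod_encode_2[of b a] by (simp add: n p sum_encode_def)
    have "\<exists>t. y = code_trm t" if "y \<in> set (list_decode b)" for y
    proof (rule less.IH)
      show "y < n"
        using in_set_less_list_encode[OF that] \<open>b < n\<close> by simp
    qed
    then have "\<forall>y\<in>set (list_decode b). \<exists>t. y = code_trm t"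
      by blast
    then obtain g where g: "\<forall>y\<in>set (list_decode b). y = code_trm (g y)"
      by (rule bchoice[elim_format]) blast
    have "map code_trm (map g (list_decode b)) = list_decode b"
      using g by (simp add: map_idI)
    then have "n = code_trm (Fun (prod_decode a) (map g (list_decode b)))"
      by (simp add: n p del: map_map)
    then show ?thesis ..
  qed
qed

instantiation trm :: enc
begin
definition "code = code_trm"
instance
  by standard (auto simp: code_trm_def code_trm_inject intro: bijI' ex_code_trm)
end


subsection \<open>Computable functions and decidable predicates\<close>

definition cf :: "('a::enc \<Rightarrow> 'b::enc) \<Rightarrow> bool" where
  "cf f \<longleftrightarrow> rc 1 (\<lambda>xs. code (f (decode (xs ! 0))))"

text \<open>Truth is represented by 0 because \<open>Mn\<close> searches for a zero.\<close>

definition dec :: "('a::enc \<Rightarrow> bool) \<Rightarrow> bool" where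
  "dec P \<longleftrightarrow> rc 1 (\<lambda>xs. if P (decode (xs ! 0)) then 0 else 1)"

named_theorems re_intros

lemma cf_compose: "cf f \<Longrightarrow> cf g \<Longrightarrow> cf (\<lambda>x. f (g x))"
  unfolding cf_def using rc_compose1[of "\<lambda>n. code (f (decode n))" 1 "\<lambda>xs. code (g (decode (xs ! 0)))"]
  by simp

lemma dec_compose: "dec P \<Longrightarrow> cf g \<Longrightarrow> dec (\<lambda>x. P (g x))"
  unfolding cf_def dec_def
  using rc_compose1[of "\<lambda>n. if P (decode n) then 0 else 1" 1 "\<lambda>xs. code (g (decode (xs ! 0)))"]
  by simp

lemma cf_id [re_intros]: "cf (\<lambda>x. x)"
  unfolding cf_def by (simp add: rc_nth)

lemma cf_const [re_intros]: "cf (\<lambda>x. c)"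
  unfolding cf_def by (rule rc_const)

lemma cf_code [re_intros]: "cf f \<Longrightarrow> cf (\<lambda>x. code (f x))"
  unfolding cf_def by simp

lemma cf_decode: "cf f \<Longrightarrow> cf (\<lambda>x. decode (f x))"
  unfolding cf_def by simp

lemma cf_pair [re_intros]: "cf f \<Longrightarrow> cf g \<Longrightarrow> cf (\<lambda>x. (f x, g x))"
  unfolding cf_def by (simp add: code_prod_def rc_prod_encode)

lemma cf_fst [re_intros]: "cf f \<Longrightarrow> cf (\<lambda>x. fst (f x))"
proof (rule cf_compose[of fst])
  have "rc 1 (\<lambda>xs. fst (prod_decode (xs ! 0)))"
    by (intro rc_fst_prod_decode rc_nth) simp
  then have "rc 1 (\<lambda>xs. fst (prod_decode (code (decode (xs ! 0) :: 'b \<times> 'c))))"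
    by simp
  then show "cf (fst :: 'b \<times> 'c \<Rightarrow> 'b)"
    unfolding cf_def code_prod_def by simp
qed

lemma cf_snd [re_intros]: "cf f \<Longrightarrow> cf (\<lambda>x. snd (f x))"
proof (rule cf_compose[of snd])
  have "rc 1 (\<lambda>xs. snd (prod_decode (xs ! 0)))"
    by (intro rc_snd_prod_decode rc_nth) simp
  then have "rc 1 (\<lambda>xs. snd (prod_decode (code (decode (xs ! 0) :: 'b \<times> 'c))))"
    by simp
  then show "cf (snd :: 'b \<times> 'c \<Rightarrow> 'c)"
    unfolding cf_def code_prod_def by simp
qed

lemma cf_prod_decode: "cf prod_decode"
proof -
  have "code (prod_decode n) = n" for n
    by (simp add: code_prod_def)
  then show ?thesis
    unfolding cf_def by (simp add: rc_nth)
qed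

lemma cf_Suc [re_intros]: "cf f \<Longrightarrow> cf (\<lambda>x. Suc (f x))"
  unfolding cf_def by (simp add: rc_Suc)

lemma cf_add [re_intros]: "cf f \<Longrightarrow> cf g \<Longrightarrow> cf (\<lambda>x. f x + g x :: nat)"
  unfolding cf_def by (simp add: rc_add)

lemma cf_Cons [re_intros]: "cf f \<Longrightarrow> cf g \<Longrightarrow> cf (\<lambda>x. f x # g x)"
  unfolding cf_def by (simp add: code_list_def rc_Suc rc_prod_encode)

lemma cf_Var [re_intros]: "cf f \<Longrightarrow> cf (\<lambda>x. Var (f x))"
  unfolding cf_def by (simp add: code_trm_def sum_encode_def rc_add mult_2)

lemma code_trm_Fun: "code (Fun f ts) = (let p = prod_encode (code f, code ts) in Suc (p + p))"
  by (cases f) (simp add: code_trm_def sum_encode_def code_prod_def code_list_def Let_def fun_eq_iff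
      cong: map_cong)

lemma cf_Fun [re_intros]: "cf f \<Longrightarrow> cf ts \<Longrightarrow> cf (\<lambda>x. Fun (f x) (ts x))"
  unfolding cf_def code_trm_Fun Let_def by (intro rc_Suc rc_add rc_prod_encode)

text \<open>On codes, \<open>tl\<close> is the predecessor followed by the second projection; this
  stays correct for the empty list because \<open>prod_decode 0 = (0, 0)\<close>. Iterating it gives
  \<open>drop\<close>, through which list entries are accessed below.\<close>

lemma code_drop:
  "code (drop i xs) = rec_nat (code xs) (\<lambda>m v. snd (prod_decode (v - 1))) i"
proof -
  have tl: "code (tl ys) = snd (prod_decode (code ys - 1))" for ys :: "'a list"
  proof (cases ys)
    case Nil
    have "prod_decode 0 = (0, 0)"
      using prod_encode_inverse[of "(0, 0)"] by (simp add: prod_encode_def)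
    then show ?thesis
      by (simp add: Nil code_list_def)
  qed (simp add: code_list_def)
  show ?thesis
  proof (induction i)
    case (Suc i)
    have "code (drop (Suc i) xs) = code (tl (drop i xs))"
      by (simp add: drop_Suc tl_drop)
    then show ?case
      by (simp only: tl Suc.IH nat.rec)
  qed simp
qed

lemma cf_drop [re_intros]: "cf f \<Longrightarrow> cf g \<Longrightarrow> cf (\<lambda>x. drop (f x) (g x))"
  unfolding cf_def code_drop code_nat_def
  by (rule rc_rec[of 1 _ _ "\<lambda>m v xs. snd (prod_decode (v - 1))"])
    (simp | intro rc_snd_prod_decode rc_diff rc_nth rc_const)+

lemma dec_not: "dec P \<Longrightarrow> dec (\<lambda>x. \<not> P x)"
  unfolding dec_def
  by (drule rc_if[OF _ rc_const[of 1 1] rc_const[of 1 0]]) (auto elim: rc_cong)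

lemma dec_conj: "dec P \<Longrightarrow> dec Q \<Longrightarrow> dec (\<lambda>x. P x \<and> Q x)"
  unfolding dec_def
  by (drule rc_add, assumption) (drule rc_if[OF _ rc_const[of 1 0] rc_const[of 1 1]], auto elim: rc_cong)

lemma dec_disj: "dec P \<Longrightarrow> dec Q \<Longrightarrow> dec (\<lambda>x. P x \<or> Q x)"
  using dec_not[OF dec_conj[OF dec_not dec_not]] by simp

lemma dec_eq:
  assumes "cf f" "cf g"
  shows "dec (\<lambda>x. f x = g x)"
proof -
  let ?f = "\<lambda>xs. code (f (decode (xs ! 0)))" and ?g = "\<lambda>xs. code (g (decode (xs ! 0)))"
  have "rc 1 (\<lambda>xs. if (?f xs - ?g xs) + (?g xs - ?f xs) = 0 then 0 else 1)"
    using assms unfolding cf_def by (intro rc_if rc_add rc_diff rc_const)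
  then show ?thesis
    unfolding dec_def by (rule rc_cong) (auto dest!: antisym)
qed

text \<open>The recursion carries a flag that is 0 until a counterexample appears and never returns
  to 0.\<close>

lemma dec_ball:
  fixes P :: "'a::enc \<Rightarrow> nat \<Rightarrow> bool"
  assumes P: "dec (\<lambda>p. P (fst p) (snd p))" and n: "cf n"
  shows "dec (\<lambda>x. \<forall>i<n x. P x i)"
proof -
  let ?q = "\<lambda>m v x. if v = 0 then (if P (decode x) m then 0 else 1) else (v::nat)"
  let ?Q = "\<lambda>c. if P (fst (decode c :: 'a \<times> nat)) (snd (decode c :: 'a \<times> nat)) then 0 else 1 :: nat"
  have "rc 1 (\<lambda>ys. ?Q (ys ! 0))"
    using P unfolding dec_def by simp
  then have "rc 3 (\<lambda>ys. ?Q (prod_encode (ys ! 2, ys ! 0)))"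
    by (rule rc_compose1) (intro rc_prod_encode rc_nth; simp)
  moreover have "(decode (prod_encode (b, a)) :: 'a \<times> nat) = (decode b, a)" for a b
    by (metis code_decode code_nat_def code_prod_def decode_code fst_conv snd_conv)
  ultimately have "rc 3 (\<lambda>ys. if P (decode (ys ! 2)) (ys ! 0) then 0 else 1)"
    by simp
  then have q: "rc 3 (\<lambda>ys. if P (decode (drop 2 ys ! 0)) (ys ! 0) then 0 else 1)"
    by (rule rc_cong) simp
  have "rc 1 (\<lambda>xs. rec_nat 0 (\<lambda>m v. ?q m v (xs ! 0)) (n (decode (xs ! 0))))"
    by (rule rc_rec[of 1 _ _ "\<lambda>m v xs. ?q m v (xs ! 0)"])
      (use n q in \<open>auto simp: cf_def numeral_3_eq_3 numeral_2_eq_2 intro!: rc_if rc_nth rc_const\<close>)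
  moreover have "rec_nat 0 (\<lambda>m v. ?q m v x) k = 0 \<longleftrightarrow> (\<forall>i<k. P (decode x) i)" for k x
    by (induction k) (auto simp: less_Suc_eq)
  ultimately show ?thesis
    unfolding dec_def by (drule_tac rc_if[OF _ rc_const[of 1 0] rc_const[of 1 1]]) simp
qed

subsection \<open>Recursively enumerable predicates\<close>

text \<open>Projection of a decidable relation along a numerical witness. No closure under negation
  can be expected, which dictates the form of many definitions below.\<close>

definition re :: "('a::enc \<Rightarrow> bool) \<Rightarrow> bool" where
  "re P \<longleftrightarrow> (\<exists>D :: nat \<times> 'a \<Rightarrow> bool. dec D \<and> (\<forall>x. P x \<longleftrightarrow> (\<exists>y. D (y, x))))"

lemma reI:
  fixes D :: "nat \<times> 'a::enc \<Rightarrow> bool"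
  shows "dec D \<Longrightarrow> (\<And>x. P x \<longleftrightarrow> (\<exists>y. D (y, x))) \<Longrightarrow> re P"
  unfolding re_def by blast

lemma reE:
  fixes P :: "'a::enc \<Rightarrow> bool"
  assumes "re P"
  obtains D :: "nat \<times> 'a \<Rightarrow> bool" where "dec D" "\<And>x. P x \<longleftrightarrow> (\<exists>y. D (y, x))"
  using assms unfolding re_def by blast

lemma re_dec: "dec P \<Longrightarrow> re P"
  by (rule reI[of "\<lambda>p. P (snd p)"]) (auto intro!: dec_compose[of P] re_intros)

lemma re_compose:
  assumes "re P" "cf g"
  shows "re (\<lambda>x. P (g x))"
proof -
  obtain D :: "nat \<times> _ \<Rightarrow> bool" where D: "dec D" "\<And>x. P x \<longleftrightarrow> (\<exists>y. D (y, x))"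
    using assms(1) by (elim reE) (rule that)
  show ?thesis
    by (rule reI[of "\<lambda>p. D (fst p, g (snd p))"])
      (auto simp: D(2) intro!: dec_compose[OF D(1)] re_intros cf_compose[OF assms(2)])
qed

lemma re_eq [re_intros]: "cf f \<Longrightarrow> cf g \<Longrightarrow> re (\<lambda>x. f x = g x)"
  by (intro re_dec dec_eq)

lemma re_neq [re_intros]: "cf f \<Longrightarrow> cf g \<Longrightarrow> re (\<lambda>x. f x \<noteq> g x)"
  by (intro re_dec dec_eq dec_not)

lemma re_conj [re_intros]:
  assumes "re P" "re Q"
  shows "re (\<lambda>x. P x \<and> Q x)"
proof -
  obtain D :: "nat \<times> _ \<Rightarrow> bool" where D: "dec D" "\<And>x. P x \<longleftrightarrow> (\<exists>y. D (y, x))"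
    using assms(1) by (elim reE) (rule that)
  obtain E :: "nat \<times> _ \<Rightarrow> bool" where E: "dec E" "\<And>x. Q x \<longleftrightarrow> (\<exists>y. E (y, x))"
    using assms(2) by (elim reE) (rule that)
  show ?thesis
  proof (rule reI[of "\<lambda>p. D (fst (prod_decode (fst p)), snd p) \<and> E (snd (prod_decode (fst p)), snd p)"])
    show "dec (\<lambda>p. D (fst (prod_decode (fst p)), snd p) \<and> E (snd (prod_decode (fst p)), snd p))"
      by (intro dec_conj dec_compose[OF D(1)] dec_compose[OF E(1)] cf_compose[OF cf_prod_decode] re_intros)
    show "(P x \<and> Q x) \<longleftrightarrow> (\<exists>y. D (fst (prod_decode (fst (y, x))), snd (y, x)) \<and>
        E (snd (prod_decode (fst (y, x))), snd (y, x)))" for x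
    proof -
      have "\<exists>y. D (fst (prod_decode y), x) \<and> E (snd (prod_decode y), x)" if "D (a, x)" "E (b, x)" for a b
        using that by (intro exI[of _ "prod_encode (a, b)"]) simp
      then show ?thesis
        by (auto simp: D(2) E(2))
    qed
  qed
qed

lemma re_disj [re_intros]:
  assumes "re P" "re Q"
  shows "re (\<lambda>x. P x \<or> Q x)"
proof -
  obtain D :: "nat \<times> _ \<Rightarrow> bool" where D: "dec D" "\<And>x. P x \<longleftrightarrow> (\<exists>y. D (y, x))"
    using assms(1) by (elim reE) (rule that)
  obtain E :: "nat \<times> _ \<Rightarrow> bool" where E: "dec E" "\<And>x. Q x \<longleftrightarrow> (\<exists>y. E (y, x))"
    using assms(2) by (elim reE) (rule that)
  show ?thesis
    by (rule reI[OF dec_disj[OF D(1) E(1)]]) (auto simp: D(2) E(2))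
qed

text \<open>One number holds both the inner witness and, through \<open>decode\<close>, the
  quantified value, which may be of any encodable type.\<close>

lemma re_ex [re_intros]:
  assumes "re (\<lambda>p. P (fst p) (snd p))"
  shows "re (\<lambda>x. \<exists>y. P x y)"
proof -
  obtain D :: "nat \<times> _ \<Rightarrow> bool" where D: "dec D" "\<And>p. P (fst p) (snd p) \<longleftrightarrow> (\<exists>y. D (y, p))"
    using assms by (elim reE) (rule that)
  let ?D = "\<lambda>p. D (fst (prod_decode (fst p)), snd p, decode (snd (prod_decode (fst p))))"
  show ?thesis
  proof (rule reI[of ?D])
    show "dec ?D"
      by (intro dec_compose[OF D(1)] cf_compose[OF cf_prod_decode] cf_decode re_intros)
    show "(\<exists>y. P x y) \<longleftrightarrow> (\<exists>n. ?D (n, x))" for x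
    proof -
      have "\<exists>n. ?D (n, x)" if "D (m, x, y)" for m y
        using that by (intro exI[of _ "prod_encode (m, code y)"]) simp
      then show ?thesis
        using D(2)[of "(x, _)"] by auto
    qed
  qed
qed

text \<open>The finitely many witnesses are not coded as a sequence. The new witness is a common
  strict upper bound for them, and the search for each of them below this bound is
  decidable.\<close>

lemma re_ball [re_intros]:
  fixes P :: "'a::enc \<Rightarrow> nat \<Rightarrow> bool"
  assumes P: "re (\<lambda>p. P (fst p) (snd p))" and n: "cf n"
  shows "re (\<lambda>x. \<forall>i<n x. P x i)"
proof -
  obtain D :: "nat \<times> _ \<Rightarrow> bool" where D: "dec D" "\<And>p. P (fst p) (snd p) \<longleftrightarrow> (\<exists>y. D (y, p))"
    using P by (elim reE) (rule that)
  let ?E = "\<lambda>p i. \<not> (\<forall>y<fst p. \<not> D (y, snd p, i))"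
  show ?thesis
  proof (rule reI[of "\<lambda>p. \<forall>i<n (snd p). ?E p i"])
    show "dec (\<lambda>p. \<forall>i<n (snd p). ?E p i)"
      by (intro dec_ball dec_not dec_compose[OF D(1)] cf_compose[OF n] re_intros)
    show "(\<forall>i<n x. P x i) \<longleftrightarrow> (\<exists>b. \<forall>i<n (snd (b, x)). ?E (b, x) i)" for x
    proof
      assume "\<forall>i<n x. P x i"
      then have "\<forall>i<n x. \<exists>y. D (y, x, i)"
        using D(2)[of "(x, _)"] by auto
      then obtain y where y: "\<And>i. i < n x \<Longrightarrow> D (y i, x, i)"
        by metis
      have "y i < Suc (Max (y ` {..<n x}))" if "i < n x" for i
        using that by (simp add: less_Suc_eq_le)
      then show "\<exists>b. \<forall>i<n (snd (b, x)). ?E (b, x) i"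
        using y by (intro exI[of _ "Suc (Max (y ` {..<n x}))"]) auto
    qed (use D(2)[of "(x, _)"] in auto)
  qed
qed

section \<open>Membership and quantification over lists\<close>

lemma drop_eq_Cons_iff: "drop i xs = y # ys \<longleftrightarrow> i < length xs \<and> xs ! i = y \<and> drop (Suc i) xs = ys"
  by (metis Cons_nth_drop_Suc drop_all leI list.distinct(1) list.inject)

lemma re_in_set [re_intros]: "cf f \<Longrightarrow> cf g \<Longrightarrow> re (\<lambda>x. f x \<in> set (g x))"
proof -
  have e: "y \<in> set xs \<longleftrightarrow> (\<exists>i ys. drop i xs = y # ys)" for y and xs :: "'b list"
    by (auto simp: drop_eq_Cons_iff in_set_conv_nth)
  assume "cf f" "cf g"
  then show ?thesis
    unfolding e by (intro cf_compose[OF \<open>cf f\<close>] cf_compose[OF \<open>cf g\<close>] re_intros)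
qed

lemma length_le_list_encode: "length xs \<le> list_encode xs"
proof (induction xs)
  case (Cons y ys)
  then show ?case
    using le_prod_encode_2[of "list_encode ys" y] by simp
qed simp

text \<open>The code of a list serves as a computable bound on its positions, in place of a program
  for \<open>length\<close>.\<close>

lemma length_le_code: "length xs \<le> code xs"
  using length_le_list_encode[of "map code xs"] by (simp add: code_list_def)

lemma re_compose2: "re (\<lambda>p. P (fst p) (snd p)) \<Longrightarrow> cf f \<Longrightarrow> cf g \<Longrightarrow> re (\<lambda>x. P (f x) (g x))"
  using re_compose[of "\<lambda>p. P (fst p) (snd p)" "\<lambda>x. (f x, g x)"] by (simp add: cf_pair)

lemma re_Ball [re_intros]:
  assumes "re (\<lambda>p. P (fst p) (snd p))" "cf g"
  shows "re (\<lambda>x. \<forall>y\<in>set (g x). P x y)"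
proof -
  have "(\<forall>i<code xs. drop i xs = [] \<or> (\<exists>y ys. drop i xs = y # ys \<and> P x y)) \<longleftrightarrow>
      (\<forall>i<length xs. P x (xs ! i))" for x xs
    using length_le_code[of xs] by (simp add: drop_eq_Cons_iff) (meson le_less_trans not_less less_le_trans)
  then have e: "(\<forall>y\<in>set xs. P x y) \<longleftrightarrow>
      (\<forall>i<code xs. drop i xs = [] \<or> (\<exists>y ys. drop i xs = y # ys \<and> P x y))" for x xs
    by (simp add: all_set_conv_all_nth)
  show ?thesis
    unfolding e by (intro re_compose2[OF assms(1)] cf_compose[OF assms(2)] re_intros)
qed

text \<open>If the lengths differ, then at the end of the shorter list exactly one of the two
  suffixes is empty; that position lies below \<open>code xs + code ys\<close> and refutes both
  disjuncts.\<close>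

lemma re_list_all2 [re_intros]:
  assumes P: "re (\<lambda>p. P (fst (fst p)) (snd (fst p)) (snd p))" and "cf f" "cf g"
  shows "re (\<lambda>x. list_all2 (P x) (f x) (g x))"
proof -
  have "(\<forall>i<code xs + code ys. drop i xs = [] \<and> drop i ys = [] \<or>
      (\<exists>a as b bs. drop i xs = a # as \<and> drop i ys = b # bs \<and> P x a b)) \<longleftrightarrow> list_all2 (P x) xs ys"
    (is "?L = _") for x xs ys
  proof
    have le: "length xs \<le> code xs" "length ys \<le> code ys"
      by (rule length_le_code)+
    assume ?L
    then have L: "drop i xs = [] \<and> drop i ys = [] \<or> i < length xs \<and> i < length ys \<and> P x (xs ! i) (ys ! i)"
      if "i < code xs + code ys" for i
      using that unfolding drop_eq_Cons_iff by blast
    have "i < length xs \<longleftrightarrow> i < length ys" for i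
      using L[of i] le by (cases "i < code xs + code ys") auto
    then have "length xs = length ys"
      by (metis linorder_less_linear less_irrefl)
    moreover have "P x (xs ! i) (ys ! i)" if "i < length xs" for i
      using L[of i] le that by auto
    ultimately show "list_all2 (P x) xs ys"
      by (simp add: list_all2_conv_all_nth)
  next
    assume "list_all2 (P x) xs ys"
    then have "drop i xs = [] \<and> drop i ys = [] \<or>
      (\<exists>a as b bs. drop i xs = a # as \<and> drop i ys = b # bs \<and> P x a b)" for i
      unfolding drop_eq_Cons_iff list_all2_conv_all_nth by (cases "i < length xs") auto
    then show ?L
      by blast
  qed
  note e = this[symmetric]
  show ?thesis
    unfolding e
    by (intro re_compose[OF P, of "\<lambda>p. ((f1 p, f2 p), f3 p)" for f1 f2 f3, simplified fst_conv snd_conv]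
        cf_compose[OF assms(2)] cf_compose[OF assms(3)] re_intros)
qed


subsection \<open>Inductive definitions\<close>

text \<open>Inference systems with finitely many premises: \<open>K x ys\<close> permits concluding
  \<open>x\<close> from \<open>ys\<close>. Inductive and recursive predicates are shown enumerable
  by choosing a suitable \<open>K\<close>.\<close>

inductive derivable :: "('a \<Rightarrow> 'a list \<Rightarrow> bool) \<Rightarrow> 'a \<Rightarrow> bool" for K where
  "K x ys \<Longrightarrow> \<forall>y\<in>set ys. derivable K y \<Longrightarrow> derivable K x"

lemma derivable_axiom: "K x [] \<Longrightarrow> derivable K x"
  by (rule derivable.intros) auto

lemma derivable_step: "K x [y] \<Longrightarrow> derivable K y \<Longrightarrow> derivable K x"
  by (rule derivable.intros) auto

text \<open>A formal proof with its last conclusion in front: each entry follows from entries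
  further back. Being a finite list, it can be guessed as a witness.\<close>

primrec derivation :: "('a \<Rightarrow> 'a list \<Rightarrow> bool) \<Rightarrow> 'a list \<Rightarrow> bool" where
  "derivation K [] \<longleftrightarrow> True"
| "derivation K (x # L) \<longleftrightarrow> derivation K L \<and> (\<exists>ys. K x ys \<and> set ys \<subseteq> set L)"

lemma derivation_append: "derivation K L \<Longrightarrow> derivation K M \<Longrightarrow> derivation K (L @ M)"
  by (induction L) auto

lemma derivation_lists:
  "\<forall>y\<in>set ys. \<exists>L. derivation K L \<and> y \<in> set L \<Longrightarrow> \<exists>L. derivation K L \<and> set ys \<subseteq> set L"
proof (induction ys)
  case Nil
  show ?case
    by (rule exI[of _ "[]"]) simp
next
  case (Cons y ys)
  then obtain L M where "derivation K L" "y \<in> set L" "derivation K M" "set ys \<subseteq> set M"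
    by auto
  then show ?case
    using derivation_append[of K L M] by (intro exI[of _ "L @ M"]) auto
qed

lemma derivable_iff: "derivable K x \<longleftrightarrow> (\<exists>L. derivation K L \<and> x \<in> set L)"
proof
  show "derivable K x \<Longrightarrow> \<exists>L. derivation K L \<and> x \<in> set L"
  proof (induction rule: derivable.induct)
    case (1 x ys)
    then obtain L where "derivation K L" "set ys \<subseteq> set L"
      using derivation_lists[of ys K] by blast
    then show ?case
      using 1(1) by (intro exI[of _ "x # L"]) auto
  qed
  have "derivation K L \<Longrightarrow> \<forall>x\<in>set L. derivable K x" for L
  proof (induction L)
    case (Cons x L)
    then obtain ys where ys: "K x ys" "set ys \<subseteq> set L" and L: "\<forall>y\<in>set L. derivable K y"
      by auto
    have "derivable K x"
      by (rule derivable.intros[of K, OF ys(1)]) (use ys(2) L in blast)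
    then show ?case
      using L by simp
  qed simp
  then show "\<exists>L. derivation K L \<and> x \<in> set L \<Longrightarrow> derivable K x"
    by blast
qed

lemma derivation_iff:
  "derivation K L \<longleftrightarrow> (\<forall>i<length L. \<exists>ys. K (L ! i) ys \<and> set ys \<subseteq> set (drop (Suc i) L))"
proof (induction L)
  case (Cons x L)
  then show ?case
    by (auto simp: less_Suc_eq_0_disj)
qed simp

lemma re_derivable:
  assumes "re (\<lambda>p. K (fst p) (snd p))"
  shows "re (derivable K)"
proof -
  have "derivation K L \<longleftrightarrow> (\<forall>i<code L. drop i L = [] \<or>
      (\<exists>x M ys. drop i L = x # M \<and> K x ys \<and> (\<forall>y\<in>set ys. y \<in> set M)))" (is "_ = ?R") for L
  proof
    have "drop i L = [] \<or> (\<exists>x M ys. drop i L = x # M \<and> K x ys \<and> (\<forall>y\<in>set ys. y \<in> set M))"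
      if D: "derivation K L" for i
    proof (cases "i < length L")
      case True
      then obtain ys where "K (L ! i) ys" "set ys \<subseteq> set (drop (Suc i) L)"
        using D unfolding derivation_iff by blast
      then show ?thesis
        using Cons_nth_drop_Suc[OF True] by (metis subset_eq)
    qed simp
    then show "derivation K L \<Longrightarrow> ?R"
      by (intro allI impI)
    assume R: ?R
    show "derivation K L"
      unfolding derivation_iff
    proof (intro allI impI)
      fix i
      assume i: "i < length L"
      then have "i < code L"
        using length_le_code[of L] by simp
      then obtain x M ys where "drop i L = x # M" "K x ys" "\<forall>y\<in>set ys. y \<in> set M"
        using R i by (metis drop_eq_Nil not_less)
      then show "\<exists>ys. K (L ! i) ys \<and> set ys \<subseteq> set (drop (Suc i) L)"
        unfolding drop_eq_Cons_iff by blast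
    qed
  qed
  then have e: "derivable K = (\<lambda>x. \<exists>L. (\<forall>i<code L. drop i L = [] \<or>
      (\<exists>x M ys. drop i L = x # M \<and> K x ys \<and> (\<forall>y\<in>set ys. y \<in> set M))) \<and> x \<in> set L)"
    by (intro ext) (simp only: derivable_iff)
  show ?thesis
    unfolding e by (intro re_compose2[OF assms] re_intros)
qed

lemma re_inductive:
  assumes "re (\<lambda>p. K (fst p) (snd p))"
    and "\<And>x ys. K x ys \<Longrightarrow> \<forall>y\<in>set ys. P y \<Longrightarrow> P x"
    and "\<And>x. P x \<Longrightarrow> derivable K x"
  shows "re P"
proof -
  have "derivable K x \<Longrightarrow> P x" for x
  proof (induction rule: derivable.induct)
    case (1 x ys)
    show ?case
      by (rule assms(2)[OF 1(1)]) (use 1(2) in blast)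
  qed
  then have "P = derivable K"
    using assms(3) by (intro ext iffI)
  then show ?thesis
    using re_derivable[OF assms(1)] by simp
qed

text \<open>For predicates that unfold along a measure. The measure only guarantees that backward
  application of \<open>K\<close> ends; it takes no part in the enumeration and so may be any
  function.\<close>

lemma re_recursive:
  fixes m :: "'a::enc \<Rightarrow> nat"
  assumes "re (\<lambda>p. K (fst p) (snd p))"
    and "\<And>x ys. K x ys \<Longrightarrow> \<forall>y\<in>set ys. P y \<Longrightarrow> P x"
    and "\<And>x. P x \<Longrightarrow> \<exists>ys. K x ys \<and> (\<forall>y\<in>set ys. P y \<and> m y < m x)"
  shows "re P"
proof (rule re_inductive[OF assms(1,2)])
  show "P x \<Longrightarrow> derivable K x" for x
  proof (induction x rule: measure_induct_rule[of m])
    case (less x)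
    obtain ys where ys: "K x ys" "\<forall>y\<in>set ys. P y \<and> m y < m x"
      using assms(3)[OF less.prems] by blast
    show ?case
      by (rule derivable.intros[of K, OF ys(1)]) (use ys(2) less.IH in auto)
  qed
qed

lemma re_rtrancl:
  assumes "re (\<lambda>p. (fst (snd p), snd (snd p)) \<in> r (fst p))" "cf f" "cf g" "cf h"
  shows "re (\<lambda>x. (g x, h x) \<in> (r (f x))\<^sup>*)"
proof -
  have "re (\<lambda>p. (fst (snd p), snd (snd p)) \<in> (r (fst p))\<^sup>*)"
  proof (rule re_inductive[where K = "\<lambda>p ys. fst (snd p) = snd (snd p) \<or>
        (\<exists>b. (fst (snd p), b) \<in> r (fst p) \<and> ys = [(fst p, b, snd (snd p))])"])
    show "re (\<lambda>q. fst (snd (fst q)) = snd (snd (fst q)) \<or>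
        (\<exists>b. (fst (snd (fst q)), b) \<in> r (fst (fst q)) \<and> snd q = [(fst (fst q), b, snd (snd (fst q)))]))"
      by (intro re_compose[OF assms(1), of "\<lambda>p. (f1 p, f2 p, f3 p)" for f1 f2 f3, simplified fst_conv snd_conv] re_intros)
    have "(a, c) \<in> (r z)\<^sup>* \<Longrightarrow> derivable (\<lambda>p ys. fst (snd p) = snd (snd p) \<or>
        (\<exists>b. (fst (snd p), b) \<in> r (fst p) \<and> ys = [(fst p, b, snd (snd p))])) (z, a, c)" for z a c
    proof (induction rule: converse_rtrancl_induct)
      case base
      show ?case
        by (rule derivable.intros[of _ _ "[]"]) auto
    next
      case (step a b)
      then show ?case
        by (intro derivable.intros[of _ _ "[(z, b, c)]"]) auto
    qed
    then show "(fst (snd p), snd (snd p)) \<in> (r (fst p))\<^sup>* \<Longrightarrow>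
        derivable (\<lambda>p ys. fst (snd p) = snd (snd p) \<or>
          (\<exists>b. (fst (snd p), b) \<in> r (fst p) \<and> ys = [(fst p, b, snd (snd p))])) p" for p
      by (cases p) simp
  qed (auto intro: converse_rtrancl_into_rtrancl)
  then show ?thesis
    using re_compose[of "\<lambda>p. (fst (snd p), snd (snd p)) \<in> (r (fst p))\<^sup>*" "\<lambda>x. (f x, g x, h x)"]
    by (simp add: cf_pair assms(2-))
qed


subsection \<open>Decision by searching for two kinds of certificates\<close>

text \<open>Stage \<open>y\<close> tests \<open>y\<close> as a witness for \<open>P\<close> and for
  \<open>N\<close> at once. Minimization finds the first successful stage, and testing
  \<open>D\<close> there tells which side succeeded. That exactly one of \<open>P\<close> and
  \<open>N\<close> holds ensures both termination and a correct answer.\<close>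

lemma decider_of_re:
  fixes P N :: "nat \<times> nat \<Rightarrow> bool"
  assumes "re P" "re N"
  shows "\<exists>d. \<forall>m n. P (m, n) \<noteq> N (m, n) \<longrightarrow> rec_eval d [m, n] = Some (if P (m, n) then 1 else 0)"
proof -
  obtain D :: "nat \<times> _ \<Rightarrow> bool" where D: "dec D" "\<And>x. P x \<longleftrightarrow> (\<exists>y. D (y, x))"
    using assms(1) by (elim reE) (rule that)
  obtain E :: "nat \<times> _ \<Rightarrow> bool" where E: "dec E" "\<And>x. N x \<longleftrightarrow> (\<exists>y. E (y, x))"
    using assms(2) by (elim reE) (rule that)
  have *: "rc 3 (\<lambda>xs. if F (xs ! 0, xs ! 1, xs ! 2) then 0 else 1)"
    if "dec F" for F :: "nat \<times> nat \<times> nat \<Rightarrow> bool"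
  proof -
    let ?F = "\<lambda>c. if F (decode c) then 0 else 1 :: nat"
    have "rc 1 (\<lambda>ys. ?F (ys ! 0))"
      using that unfolding dec_def .
    then have "rc 3 (\<lambda>xs. ?F (prod_encode (xs ! 0, prod_encode (xs ! 1, xs ! 2))))"
      by (rule rc_compose1) (intro rc_prod_encode rc_nth; simp)
    moreover have "(decode (prod_encode (a, prod_encode (b, c))) :: nat \<times> nat \<times> nat) = (a, b, c)" for a b c
      using decode_code[of "(a, b, c)"] by (simp add: code_prod_def del: decode_code)
    ultimately show ?thesis
      by simp
  qed
  obtain s where s: "\<And>xs. length xs = 3 \<Longrightarrow> rec_eval s xs =
      Some (if D (xs ! 0, xs ! 1, xs ! 2) \<or> E (xs ! 0, xs ! 1, xs ! 2) then 0 else 1)"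
    using *[OF dec_disj[OF D(1) E(1)]] unfolding rc_def by blast
  obtain v where v: "\<And>xs. length xs = 3 \<Longrightarrow> rec_eval v xs =
      Some (if \<not> D (xs ! 0, xs ! 1, xs ! 2) then 0 else 1)"
    using *[OF dec_not[OF D(1)]] unfolding rc_def by blast
  \<comment> \<open>The stage found by \<open>Mn s\<close> is passed on with both inputs. As truth
    is 0, testing the negation of \<open>D\<close> outputs 1 exactly when \<open>D\<close>
    holds.\<close>
  have "rec_eval (Comp v [Mn s, Proj 0, Proj 1]) [m, n] = Some (if P (m, n) then 1 else 0)"
    if PN: "P (m, n) \<noteq> N (m, n)" for m n
  proof -
    let ?Q = "\<lambda>y. D (y, m, n) \<or> E (y, m, n)"
    define k where "k = (LEAST y. ?Q y)"
    have ex: "\<exists>y. ?Q y"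
      using PN D(2) E(2) by blast
    have k: "?Q k" "\<And>i. i < k \<Longrightarrow> \<not> ?Q i"
      unfolding k_def using LeastI_ex[OF ex] not_less_Least by blast+
    have "D (k, m, n) \<longleftrightarrow> P (m, n)"
      using k(1) PN D(2) E(2) by blast
    moreover have "rec_eval (Mn s) [m, n] = Some k"
    proof -
      define T where "T y \<longleftrightarrow> rec_eval s (y # [m, n]) = Some 0 \<and>
        (\<forall>i<y. \<exists>z. rec_eval s (i # [m, n]) = Some (Suc z))" for y
      have T: "T y \<longleftrightarrow> ?Q y \<and> (\<forall>i<y. \<not> ?Q i)" for y
        unfolding T_def by (simp add: s) blast
      have "T y \<longleftrightarrow> y = k" for y
        unfolding T using k by (metis linorder_neqE_nat)
      then show ?thesis
        by (simp add: Let_def flip: T_def)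
    qed
    ultimately show ?thesis
      by (simp add: v del: rec_eval.simps(6))
  qed
  then show ?thesis
    by blast
qed


section \<open>Term rewriting\<close>

lemma subst_subst: "subst \<tau> (subst \<sigma> t) = subst (\<lambda>x. subst \<tau> (\<sigma> x)) t"
  by (induction t) auto

lemma subst_cong: "(\<And>x. x \<in> vars t \<Longrightarrow> \<sigma> x = \<tau> x) \<Longrightarrow> subst \<sigma> t = subst \<tau> t"
  by (induction t) auto

lemma subst_Var [simp]: "subst Var t = t"
  by (induction t) (auto simp: map_idI)

lemma vars_subst: "vars (subst \<sigma> t) = (\<Union>x\<in>vars t. vars (\<sigma> x))"
  by (induction t) auto

lemma finite_vars [simp]: "finite (vars t)"
  by (induction t) auto

lemma Fun_in_terms_iff [simp]:
  "Fun f ts \<in> terms \<Sigma> \<longleftrightarrow> f \<in> \<Sigma> \<and> length ts = rank f \<and> set ts \<subseteq> terms \<Sigma>"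
  by (subst terms.simps) auto

lemma Var_in_terms [simp]: "Var x \<in> terms \<Sigma>"
  by (rule terms.Var)

lemma subst_in_terms_iff:
  "subst \<sigma> t \<in> terms \<Sigma> \<longleftrightarrow> t \<in> terms \<Sigma> \<and> (\<forall>x\<in>vars t. \<sigma> x \<in> terms \<Sigma>)"
  by (induction t) auto

lemma rstep_in_terms:
  assumes "trs \<Sigma> R" "(s, t) \<in> rstep R" "s \<in> terms \<Sigma>"
  shows "t \<in> terms \<Sigma>"
  using assms(2,3)
proof (induction rule: rstep.induct)
  case (root l r \<sigma>)
  then show ?case
    using assms(1) by (fastforce simp: trs_def subst_in_terms_iff)
qed auto

text \<open>Rewriting never leads out of \<open>terms \<Sigma>\<close>, so from here on
  \<open>rstep\<close> replaces \<open>rewrite\<close> and the alphabet only restricts where a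
  reduction starts.\<close>

lemma rewrite_rtrancl_iff:
  assumes "trs \<Sigma> R" "s \<in> terms \<Sigma>"
  shows "(s, t) \<in> (rewrite \<Sigma> R)\<^sup>* \<longleftrightarrow> (s, t) \<in> (rstep R)\<^sup>*"
proof
  show "(s, t) \<in> (rewrite \<Sigma> R)\<^sup>* \<Longrightarrow> (s, t) \<in> (rstep R)\<^sup>*"
    by (rule rtrancl_mono[THEN subsetD]) (auto simp: rewrite_def)
  assume "(s, t) \<in> (rstep R)\<^sup>*"
  then have "(s, t) \<in> (rewrite \<Sigma> R)\<^sup>* \<and> t \<in> terms \<Sigma>"
  proof (induction rule: rtrancl_induct)
    case base
    then show ?case
      using assms(2) by simp
  next
    case (step t u)
    then have "u \<in> terms \<Sigma>"
      using rstep_in_terms[OF assms(1)] by blast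
    then have "(t, u) \<in> rewrite \<Sigma> R"
      using step by (simp add: rewrite_def)
    then show ?case
      using step \<open>u \<in> terms \<Sigma>\<close> by (meson rtrancl_into_rtrancl)
  qed
  then show "(s, t) \<in> (rewrite \<Sigma> R)\<^sup>*" ..
qed

definition joinable :: "rule set \<Rightarrow> trm \<Rightarrow> trm \<Rightarrow> bool" where
  "joinable R s t \<longleftrightarrow> (\<exists>u. (s, u) \<in> (rstep R)\<^sup>* \<and> (t, u) \<in> (rstep R)\<^sup>*)"

lemma joinable_sym: "joinable R s t \<Longrightarrow> joinable R t s"
  unfolding joinable_def by blast

lemma locally_confluent_iff_joinable:
  assumes "trs \<Sigma> R"
  shows "locally_confluent \<Sigma> R \<longleftrightarrow>
    (\<forall>t\<in>terms \<Sigma>. \<forall>t1 t2. (t, t1) \<in> rstep R \<and> (t, t2) \<in> rstep R \<longrightarrow> joinable R t1 t2)"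
proof -
  have "(t, t1) \<in> rewrite \<Sigma> R \<longleftrightarrow> (t, t1) \<in> rstep R" if "t \<in> terms \<Sigma>" for t t1
    using that rstep_in_terms[OF assms] by (auto simp: rewrite_def)
  moreover have "(\<exists>t'. (t1, t') \<in> (rewrite \<Sigma> R)\<^sup>* \<and> (t2, t') \<in> (rewrite \<Sigma> R)\<^sup>*) \<longleftrightarrow> joinable R t1 t2"
    if "t \<in> terms \<Sigma>" "(t, t1) \<in> rstep R" "(t, t2) \<in> rstep R" for t t1 t2
    using that rstep_in_terms[OF assms] by (simp add: joinable_def rewrite_rtrancl_iff[OF assms])
  ultimately show ?thesis
    unfolding locally_confluent_def by (intro ball_cong refl all_cong1) auto
qed

lemma rstep_subst: "(s, t) \<in> rstep R \<Longrightarrow> (subst \<theta> s, subst \<theta> t) \<in> rstep R"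
proof (induction rule: rstep.induct)
  case (root l r \<sigma>)
  then show ?case
    by (simp add: subst_subst rstep.root)
qed (auto intro: rstep.arg)

lemma rsteps_subst: "(s, t) \<in> (rstep R)\<^sup>* \<Longrightarrow> (subst \<theta> s, subst \<theta> t) \<in> (rstep R)\<^sup>*"
  by (induction rule: rtrancl_induct) (auto intro: rtrancl_into_rtrancl rstep_subst)

lemma rsteps_arg:
  "(s, t) \<in> (rstep R)\<^sup>* \<Longrightarrow> (Fun f (us @ s # vs), Fun f (us @ t # vs)) \<in> (rstep R)\<^sup>*"
  by (induction rule: rtrancl_induct) (auto intro: rtrancl_into_rtrancl rstep.arg)

lemma rsteps_args:
  assumes "list_all2 (\<lambda>s t. (s, t) \<in> (rstep R)\<^sup>*) ss ts"
  shows "(Fun f (us @ ss), Fun f (us @ ts)) \<in> (rstep R)\<^sup>*"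
  using assms
proof (induction arbitrary: us rule: list_all2_induct)
  case (Cons s ss t ts)
  then show ?case
    using rsteps_arg[of s t R f us ss] Cons.IH[of "us @ [t]"] by auto
qed simp

lemma joinable_subst: "joinable R s t \<Longrightarrow> joinable R (subst \<theta> s) (subst \<theta> t)"
  unfolding joinable_def by (blast intro: rsteps_subst)

lemma joinable_arg: "joinable R s t \<Longrightarrow> joinable R (Fun f (us @ s # vs)) (Fun f (us @ t # vs))"
  unfolding joinable_def by (blast intro: rsteps_arg)

text \<open>The variable \<open>x\<close> may occur any number of times in \<open>t\<close>, and
  each occurrence contributes one step; hence the reflexive transitive closure.\<close>

lemma rsteps_subst_update:
  assumes "(\<sigma> x, v) \<in> rstep R"
  shows "(subst \<sigma> t, subst (\<sigma>(x := v)) t) \<in> (rstep R)\<^sup>*"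
proof (induction t)
  case (Var y)
  then show ?case
    using assms by auto
next
  case (Fun f ts)
  then have "list_all2 (\<lambda>s t. (s, t) \<in> (rstep R)\<^sup>*) (map (subst \<sigma>) ts) (map (subst (\<sigma>(x := v))) ts)"
    by (simp add: list_all2_conv_all_nth del: fun_upd_apply)
  from rsteps_args[OF this, of f "[]"] show ?case
    by (simp del: fun_upd_apply)
qed


subsection \<open>Contexts\<close>

text \<open>The innermost frame comes first.\<close>

type_synonym ctxt = "(symb \<times> trm list \<times> trm list) list"

fun plug :: "ctxt \<Rightarrow> trm \<Rightarrow> trm" where
  "plug [] t = t"
| "plug ((f, us, vs) # C) t = plug C (Fun f (us @ t # vs))"

definition subst_ctxt :: "(nat \<Rightarrow> trm) \<Rightarrow> ctxt \<Rightarrow> ctxt" where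
  "subst_ctxt \<sigma> = map (\<lambda>(f, us, vs). (f, map (subst \<sigma>) us, map (subst \<sigma>) vs))"

lemma plug_append [simp]: "plug (C @ D) t = plug D (plug C t)"
  by (induction C t rule: plug.induct) auto

lemma subst_plug [simp]: "subst \<sigma> (plug C t) = plug (subst_ctxt \<sigma> C) (subst \<sigma> t)"
  by (induction C t rule: plug.induct) (auto simp: subst_ctxt_def)

lemma rstep_plug: "(s, t) \<in> rstep R \<Longrightarrow> (plug C s, plug C t) \<in> rstep R"
  by (induction C s arbitrary: t rule: plug.induct) (simp_all add: rstep.arg)

lemma plug_in_termsD: "plug C t \<in> terms \<Sigma> \<Longrightarrow> t \<in> terms \<Sigma>"
  by (induction C t rule: plug.induct) auto


subsection \<open>Joinability of all instances of a pair under unification constraints\<close>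

text \<open>The rules are the steps of the unification algorithm, with the bindings applied to the
  pair \<open>(a, b)\<close> on the way, so that no most general unifier has to be mentioned.
  The rule elim does not need the occurs check: a unifier of
  \<open>Var x\<close> and \<open>t\<close> absorbs the substitution \<open>Var(x := t)\<close> in any case.\<close>

inductive covered :: "rule set \<Rightarrow> (trm \<times> trm) list \<Rightarrow> trm \<Rightarrow> trm \<Rightarrow> bool" for R where
  solved: "joinable R a b \<Longrightarrow> covered R [] a b"
| trivial: "covered R E a b \<Longrightarrow> covered R ((t, t) # E) a b"
| clash: "f \<noteq> g \<or> length ss \<noteq> length ts \<Longrightarrow> covered R ((Fun f ss, Fun g ts) # E) a b"
| decompose: "length ss = length ts \<Longrightarrow> covered R (zip ss ts @ E) a b \<Longrightarrow>
    covered R ((Fun f ss, Fun f ts) # E) a b"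
| elim: "covered R (map (map_prod (subst (Var(x := t))) (subst (Var(x := t)))) E)
      (subst (Var(x := t)) a) (subst (Var(x := t)) b) \<Longrightarrow>
    covered R ((Var x, t) # E) a b"
| occurs: "x \<in> vars t \<Longrightarrow> t \<noteq> Var x \<Longrightarrow> covered R ((Var x, t) # E) a b"
| swap: "covered R ((t, s) # E) a b \<Longrightarrow> covered R ((s, t) # E) a b"

section \<open>Soundness and completeness of the unification rules\<close>

definition unifies :: "(nat \<Rightarrow> trm) \<Rightarrow> (trm \<times> trm) list \<Rightarrow> bool" where
  "unifies \<theta> E \<longleftrightarrow> (\<forall>(s, t)\<in>set E. subst \<theta> s = subst \<theta> t)"

lemma unifies_simps [simp]:
  "unifies \<theta> []"
  "unifies \<theta> ((s, t) # E) \<longleftrightarrow> subst \<theta> s = subst \<theta> t \<and> unifies \<theta> E"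
  "unifies \<theta> (E @ E') \<longleftrightarrow> unifies \<theta> E \<and> unifies \<theta> E'"
  by (auto simp: unifies_def)

lemma unifies_zip:
  "length ss = length ts \<Longrightarrow> unifies \<theta> (zip ss ts) \<longleftrightarrow> map (subst \<theta>) ss = map (subst \<theta>) ts"
  by (induction ss ts rule: list_induct2) auto

lemma unifies_map:
  "unifies \<theta> (map (map_prod (subst \<sigma>) (subst \<sigma>)) E) \<longleftrightarrow> unifies (\<lambda>x. subst \<theta> (\<sigma> x)) E"
  by (simp add: unifies_def subst_subst case_prod_beta)

primrec weight :: "trm \<Rightarrow> nat" where
  "weight (Var x) = 1"
| "weight (Fun f ts) = Suc (sum_list (map weight ts))"

lemma weight_pos: "0 < weight t"
  by (cases t) auto

lemma weight_subst_le: "x \<in> vars t \<Longrightarrow> weight (\<theta> x) \<le> weight (subst \<theta> t)"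
proof (induction t)
  case (Fun f ts)
  then obtain t where t: "t \<in> set ts" "weight (\<theta> x) \<le> weight (subst \<theta> t)"
    by auto
  then have "weight (subst \<theta> t) \<le> sum_list (map weight (map (subst \<theta>) ts))"
    by (intro member_le_sum_list) auto
  then show ?case
    using t(2) by simp
qed simp

text \<open>Justifies the occurs check: a unifier of \<open>Var x\<close> and \<open>t\<close> would
  make the two weights equal.\<close>

lemma weight_subst_less:
  assumes "x \<in> vars t" "t \<noteq> Var x"
  shows "weight (\<theta> x) < weight (subst \<theta> t)"
proof (cases t)
  case (Fun f ts)
  then obtain u where u: "u \<in> set ts" "x \<in> vars u"
    using assms by auto
  then have "weight (subst \<theta> u) \<le> sum_list (map weight (map (subst \<theta>) ts))"
    by (intro member_le_sum_list) auto
  then show ?thesis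
    using weight_subst_le[OF u(2), of \<theta>] Fun by simp
qed (use assms in auto)

lemma subst_absorb:
  assumes "\<theta> x = subst \<theta> t"
  shows "(\<lambda>y. subst \<theta> ((Var(x := t)) y)) = \<theta>"
  using assms by auto

text \<open>Soundness. A unifier for the conclusion of a rule also unifies its premise and, by
  absorption, yields the same instances of \<open>a\<close> and \<open>b\<close>; in the cases
  \<open>clash\<close> and \<open>occurs\<close> there is no unifier.\<close>

lemma covered_joinable:
  assumes "covered R E a b" "unifies \<theta> E"
  shows "joinable R (subst \<theta> a) (subst \<theta> b)"
  using assms
proof (induction rule: covered.induct)
  case (elim x t E a b)
  then have "(\<lambda>y. subst \<theta> ((Var(x := t)) y)) = \<theta>"
    by (intro subst_absorb) simp
  then show ?case
    using elim by (simp add: unifies_map subst_subst del: fun_upd_apply)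
next
  case (occurs x t E a b)
  then show ?case
    using weight_subst_less[of x t \<theta>] by auto
next
  case (clash f g ss ts E a b)
  then show ?case
    by (auto dest: map_eq_imp_length_eq)
qed (auto simp: joinable_subst unifies_zip)

definition eqs_vars :: "(trm \<times> trm) list \<Rightarrow> nat set" where
  "eqs_vars E = (\<Union>(s, t)\<in>set E. vars s \<union> vars t)"

definition eqs_weight :: "(trm \<times> trm) list \<Rightarrow> nat" where
  "eqs_weight E = sum_list (map (\<lambda>(s, t). weight s + weight t) E)"

lemma finite_eqs_vars: "finite (eqs_vars E)"
  by (auto simp: eqs_vars_def)

lemma eqs_zip:
  assumes "length ss = length ts"
  shows "eqs_vars (zip ss ts @ E) = eqs_vars ((Fun f ss, Fun f ts) # E)"
    and "eqs_weight (zip ss ts @ E) < eqs_weight ((Fun f ss, Fun f ts) # E)"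
  using assms by (induction ss ts rule: list_induct2) (auto simp: eqs_vars_def eqs_weight_def)

lemma eqs_vars_elim:
  assumes "x \<notin> vars t"
  shows "eqs_vars (map (map_prod (subst (Var(x := t))) (subst (Var(x := t)))) E) \<subset>
    eqs_vars ((Var x, t) # E)"
proof -
  have "vars (subst (Var(x := t)) s) \<subseteq> vars s \<union> vars t - {x}" for s
    using assms by (auto simp: vars_subst split: if_splits)
  then have "eqs_vars (map (map_prod (subst (Var(x := t))) (subst (Var(x := t)))) E) \<subseteq>
      eqs_vars ((Var x, t) # E) - {x}"
    unfolding eqs_vars_def by (fastforce simp: map_prod_def)
  moreover have "x \<in> eqs_vars ((Var x, t) # E)"
    by (simp add: eqs_vars_def)
  ultimately show ?thesis
    by blast
qed

text \<open>Completeness, by termination of unification: the number of variables drops in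
  \<open>elim\<close>, the total weight in \<open>trivial\<close> and \<open>decompose\<close>. Only
  substitutions into \<open>terms \<Sigma>\<close> are assumed to give joinable instances, as local
  confluence says nothing about others; equations over \<open>\<Sigma>\<close> keep the composed
  unifiers of this kind.\<close>

lemma joinable_covered:
  assumes "\<And>\<theta>. unifies \<theta> E \<Longrightarrow> (\<And>x. \<theta> x \<in> terms \<Sigma>) \<Longrightarrow> joinable R (subst \<theta> a) (subst \<theta> b)"
    and "\<forall>(s, t)\<in>set E. s \<in> terms \<Sigma> \<and> t \<in> terms \<Sigma>"
  shows "covered R E a b"
  using assms
proof (induction E arbitrary: a b
    rule: wf_induct_rule[OF wf_measures[of "[\<lambda>E. card (eqs_vars E), eqs_weight]"]])
  case (1 E)
  have less: "(E', E) \<in> measures [\<lambda>E. card (eqs_vars E), eqs_weight]"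
    if "eqs_vars E' \<subseteq> eqs_vars E" "eqs_weight E' < eqs_weight E" for E'
    using that card_mono[OF finite_eqs_vars that(1)] by auto
  have var: "covered R ((Var x, t) # E') a b"
    if E: "E = (Var x, t) # E' \<or> E = (t, Var x) # E'" and "t \<noteq> Var x" for x t E'
  proof (cases "x \<in> vars t")
    case True
    then show ?thesis
      using that covered.occurs by blast
  next
    case False
    let ?\<sigma> = "Var(x := t)"
    have t: "t \<in> terms \<Sigma>"
      using E 1(3) by auto
    have "subst ?\<sigma> t = subst Var t"
      using False by (intro subst_cong) auto
    then have "subst ?\<sigma> t = t"
      by simp
    show ?thesis
    proof (rule covered.elim, rule 1(1))
      have "eqs_vars E = eqs_vars ((Var x, t) # E')"
        using E by (auto simp: eqs_vars_def)
      then have "eqs_vars (map (map_prod (subst ?\<sigma>) (subst ?\<sigma>)) E') \<subset> eqs_vars E"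
        using eqs_vars_elim[OF False, of E'] by simp
      then show "(map (map_prod (subst ?\<sigma>) (subst ?\<sigma>)) E', E) \<in>
          measures [\<lambda>E. card (eqs_vars E), eqs_weight]"
        using psubset_card_mono[OF finite_eqs_vars] by simp
      fix \<theta>
      assume u: "unifies \<theta> (map (map_prod (subst ?\<sigma>) (subst ?\<sigma>)) E')" and \<theta>: "\<And>y. \<theta> y \<in> terms \<Sigma>"
      \<comment> \<open>Composing a unifier of the remaining equations with the binding gives a
        unifier of all of \<open>E\<close>: since \<open>x\<close> does not occur in
        \<open>t\<close>, both sides of the eliminated equation become
        \<open>subst \<theta> t\<close>.\<close>
      let ?\<rho> = "\<lambda>y. subst \<theta> (?\<sigma> y)"
      have "subst ?\<rho> t = subst \<theta> t"
        using \<open>subst ?\<sigma> t = t\<close> subst_subst[of \<theta> ?\<sigma> t] by simp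
      then have "unifies ?\<rho> E"
        using E u by (auto simp: unifies_map)
      moreover have "?\<rho> y \<in> terms \<Sigma>" for y
        using t \<theta> by (auto simp: subst_in_terms_iff)
      ultimately show "joinable R (subst \<theta> (subst ?\<sigma> a)) (subst \<theta> (subst ?\<sigma> b))"
        unfolding subst_subst by (rule 1(2))
    next
      show "\<forall>(s, u)\<in>set (map (map_prod (subst ?\<sigma>) (subst ?\<sigma>)) E'). s \<in> terms \<Sigma> \<and> u \<in> terms \<Sigma>"
        using E 1(3) t by (fastforce simp: subst_in_terms_iff)
    qed
  qed
  show ?case
  proof (cases E)
    case Nil
    then show ?thesis
      using 1(2)[of Var] by (auto intro: covered.solved)
  next
    case (Cons e E')
    obtain s t where e: "e = (s, t)"
      by (cases e)
    note E = Cons[unfolded e]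
    show ?thesis
    proof (cases "s = t")
      case True
      have "eqs_vars E' \<subseteq> eqs_vars E" "eqs_weight E' < eqs_weight E"
        using weight_pos[of s] by (auto simp: E eqs_vars_def eqs_weight_def)
      then have "covered R E' a b"
        using 1 by (intro 1(1) less) (auto simp: E True)
      then show ?thesis
        by (simp add: E True covered.trivial)
    next
      case False
      show ?thesis
      proof (cases s)
        case (Var x)
        then show ?thesis
          using var[of x t E'] False E by auto
      next
        case s: (Fun f ss)
        show ?thesis
        proof (cases t)
          case (Var x)
          then show ?thesis
            using var[of x s E'] s E by (auto intro: covered.swap)
        next
          case t: (Fun g ts)
          show ?thesis
          proof (cases "f = g \<and> length ss = length ts")
            case False
            then show ?thesis
              using covered.clash by (auto simp: E s t)
          next
            case True
            have "covered R (zip ss ts @ E') a b"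
            proof (intro 1(1) less)
              show "eqs_vars (zip ss ts @ E') \<subseteq> eqs_vars E" "eqs_weight (zip ss ts @ E') < eqs_weight E"
                using eqs_zip[of ss ts E' f] True by (auto simp: E s t)
              show "\<forall>(s, t)\<in>set (zip ss ts @ E'). s \<in> terms \<Sigma> \<and> t \<in> terms \<Sigma>"
                using 1(3) by (auto simp: E s t dest: set_zip_leftD set_zip_rightD)
            qed (use 1(2) True in \<open>auto simp: E s t unifies_zip\<close>)
            then show ?thesis
              using True covered.decompose by (auto simp: E s t)
          qed
        qed
      qed
    qed
  qed
qed


subsection \<open>Critical overlaps\<close>

text \<open>\<open>D\<close> leads to a non-variable position inside \<open>t\<close>, and
  \<open>C\<close> is the context already passed on the way to \<open>t\<close>. Carrying
  \<open>C\<close> along lets the condition unfold recursively over the arguments of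
  \<open>t\<close>.\<close>

definition overlaps_covered :: "rule set \<Rightarrow> trm \<Rightarrow> trm \<Rightarrow> trm \<Rightarrow> ctxt \<Rightarrow> trm \<Rightarrow> bool" where
  "overlaps_covered R r l' r' C t \<longleftrightarrow>
    (\<forall>D f ts. t = plug D (Fun f ts) \<longrightarrow> covered R [(Fun f ts, l')] r (plug C (plug D r')))"

text \<open>A step from an instance of \<open>l\<close> acts at a non-variable position of
  \<open>l\<close> or inside some \<open>\<sigma> x\<close>. In the second case \<open>t\<close> may
  fail to be an instance of \<open>l\<close>, as other occurrences of \<open>x\<close> are
  unchanged, but repeating the step there leads to one.\<close>

lemma rstep_of_instance:
  assumes "(s, t) \<in> rstep R" "s = subst \<sigma> l"
  shows "(\<exists>D f ts l' r' \<tau>. l = plug D (Fun f ts) \<and> (l', r') \<in> R \<and>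
      subst \<sigma> (Fun f ts) = subst \<tau> l' \<and> t = plug (subst_ctxt \<sigma> D) (subst \<tau> r')) \<or>
    (\<exists>x\<in>vars l. \<exists>v. (\<sigma> x, v) \<in> rstep R \<and> (t, subst (\<sigma>(x := v)) l) \<in> (rstep R)\<^sup>*)"
    (is "?overlap t l \<or> ?below t l")
  using assms
proof (induction arbitrary: l rule: rstep.induct)
  case (root l' r' \<tau>)
  show ?case
  proof (cases l)
    case (Var x)
    then have "?below (subst \<tau> r') l"
      using root rstep.root[of l' r' R \<tau>] by auto
    then show ?thesis ..
  next
    case (Fun f ts)
    have "l = plug [] (Fun f ts)" "subst \<tau> r' = plug (subst_ctxt \<sigma> []) (subst \<tau> r')"
      by (simp_all add: Fun subst_ctxt_def)
    then show ?thesis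
      using root Fun by metis
  qed
next
  case (arg s t f us vs)
  show ?case
  proof (cases l)
    case (Var x)
    then have "?below (Fun f (us @ t # vs)) l"
      using arg rstep.arg[of s t R f us vs] by auto
    then show ?thesis ..
  next
    case (Fun g ts)
    then obtain us' l0 vs' where l: "l = Fun f (us' @ l0 # vs')"
      and m: "us = map (subst \<sigma>) us'" "s = subst \<sigma> l0" "vs = map (subst \<sigma>) vs'"
      using arg(3) by (auto simp: append_eq_map_conv Cons_eq_map_conv)
    from arg.IH[OF m(2)] show ?thesis
    proof
      assume "?overlap t l0"
      then obtain D h ts l' r' \<tau> where D: "l0 = plug D (Fun h ts)" "(l', r') \<in> R"
        "subst \<sigma> (Fun h ts) = subst \<tau> l'" "t = plug (subst_ctxt \<sigma> D) (subst \<tau> r')"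
        by blast
      have "l = plug (D @ [(f, us', vs')]) (Fun h ts)"
        "Fun f (us @ t # vs) = plug (subst_ctxt \<sigma> (D @ [(f, us', vs')])) (subst \<tau> r')"
        using D(1,4) by (simp_all add: l m subst_ctxt_def)
      then show ?thesis
        using D(2,3) by blast
    next
      assume "?below t l0"
      then obtain x v where x: "x \<in> vars l0" and v: "(\<sigma> x, v) \<in> rstep R"
        and t: "(t, subst (\<sigma>(x := v)) l0) \<in> (rstep R)\<^sup>*"
        by blast
      have upd: "list_all2 (\<lambda>s t. (s, t) \<in> (rstep R)\<^sup>*) (map (subst \<sigma>) ws) (map (subst (\<sigma>(x := v))) ws)"
        for ws
        using rsteps_subst_update[of \<sigma> x v R, OF v]
        by (simp add: list_all2_conv_all_nth del: fun_upd_apply)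
      have "list_all2 (\<lambda>s t. (s, t) \<in> (rstep R)\<^sup>*) (us @ t # vs)
          (map (subst (\<sigma>(x := v))) (us' @ l0 # vs'))"
        using upd t by (simp add: m list_all2_appendI del: fun_upd_apply)
      from rsteps_args[OF this, of f "[]"]
      have "(Fun f (us @ t # vs), subst (\<sigma>(x := v)) l) \<in> (rstep R)\<^sup>*"
        by (simp add: l del: fun_upd_apply)
      moreover have "x \<in> vars l"
        using x by (simp add: l)
      ultimately show ?thesis
        using v by blast
    qed
  qed
qed

text \<open>Even and odd variables keep the two rules of an overlap apart, computably and without a
  choice of fresh names.\<close>

abbreviation even_vars :: "trm \<Rightarrow> trm" where
  "even_vars \<equiv> subst (\<lambda>x. Var (x + x))"

abbreviation odd_vars :: "trm \<Rightarrow> trm" where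
  "odd_vars \<equiv> subst (\<lambda>x. Var (Suc (x + x)))"

text \<open>Root overlaps of a rule with itself are included; they are peaks like any other, so the
  equivalence with local confluence is unaffected.\<close>

definition critical_overlaps_covered :: "rule set \<Rightarrow> bool" where
  "critical_overlaps_covered R \<longleftrightarrow> (\<forall>(l, r)\<in>R. \<forall>(l', r')\<in>R.
    overlaps_covered R (even_vars r) (odd_vars l') (odd_vars r') [] (even_vars l))"

lemma root_peak_joinable:
  assumes cov: "critical_overlaps_covered R" and R: "trs \<Sigma> R"
    and lr: "(l, r) \<in> R" and t: "(subst \<sigma> l, t) \<in> rstep R"
  shows "joinable R (subst \<sigma> r) t"
  using rstep_of_instance[OF t refl]
proof
  assume "\<exists>D f ts l' r' \<tau>. l = plug D (Fun f ts) \<and> (l', r') \<in> R \<and>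
      subst \<sigma> (Fun f ts) = subst \<tau> l' \<and> t = plug (subst_ctxt \<sigma> D) (subst \<tau> r')"
  then obtain D f ts l' r' \<tau> where l: "l = plug D (Fun f ts)" and lr': "(l', r') \<in> R"
    and u: "subst \<sigma> (Fun f ts) = subst \<tau> l'" and t: "t = plug (subst_ctxt \<sigma> D) (subst \<tau> r')"
    by blast
  \<comment> \<open>Undoes the renaming: \<open>\<sigma>\<close> is read off the even variables and
    \<open>\<tau>\<close> off the odd ones, so that \<open>\<theta>\<close> unifies the
    overlap.\<close>
  define \<theta> where "\<theta> x = (if even x then \<sigma> (x div 2) else \<tau> (x div 2))" for x
  have \<theta>: "subst \<theta> (even_vars s) = subst \<sigma> s" "subst \<theta> (odd_vars s) = subst \<tau> s" for s
    by (simp_all add: subst_subst \<theta>_def flip: mult_2)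
  have "subst_ctxt \<theta> (subst_ctxt (\<lambda>x. Var (x + x)) D) = subst_ctxt \<sigma> D"
    using \<theta>(1) by (auto simp: subst_ctxt_def)
  then have t: "t = subst \<theta> (plug (subst_ctxt (\<lambda>x. Var (x + x)) D) (odd_vars r'))"
    by (simp add: t \<theta>)
  have "even_vars l = plug (subst_ctxt (\<lambda>x. Var (x + x)) D) (Fun f (map even_vars ts))"
    by (simp add: l)
  with cov lr lr' have "covered R [(Fun f (map even_vars ts), odd_vars l')] (even_vars r)
      (plug [] (plug (subst_ctxt (\<lambda>x. Var (x + x)) D) (odd_vars r')))"
    unfolding critical_overlaps_covered_def overlaps_covered_def by blast
  moreover have "unifies \<theta> [(Fun f (map even_vars ts), odd_vars l')]"
    using u \<theta>(1)[of "Fun f ts"] \<theta>(2)[of l'] by simp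
  ultimately have "joinable R (subst \<theta> (even_vars r)) t"
    unfolding t plug.simps by (rule covered_joinable)
  then show ?thesis
    by (simp add: \<theta>)
next
  assume "\<exists>x\<in>vars l. \<exists>v. (\<sigma> x, v) \<in> rstep R \<and> (t, subst (\<sigma>(x := v)) l) \<in> (rstep R)\<^sup>*"
  then obtain x v where v: "(\<sigma> x, v) \<in> rstep R" and t: "(t, subst (\<sigma>(x := v)) l) \<in> (rstep R)\<^sup>*"
    by blast
  \<comment> \<open>Once all copies of \<open>\<sigma> x\<close> are rewritten, the rule applies at
    the root; \<open>subst \<sigma> r\<close> reaches the same term by rewriting its own
    copies.\<close>
  have "(t, subst (\<sigma>(x := v)) r) \<in> (rstep R)\<^sup>*"
    using t rstep.root[OF lr] by (rule rtrancl_into_rtrancl)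
  then show ?thesis
    using rsteps_subst_update[of \<sigma> x v R, OF v] unfolding joinable_def by blast
qed

lemma append_Cons_eq_append_Cons:
  assumes "us @ s # vs = us' @ s' # vs'"
  shows "us = us' \<and> s = s' \<and> vs = vs' \<or>
    (\<exists>ws. us' = us @ s # ws \<and> vs = ws @ s' # vs') \<or>
    (\<exists>ws. us = us' @ s' # ws \<and> vs' = ws @ s # vs)"
  using assms by (auto simp: append_eq_append_conv2 Cons_eq_append_conv append_eq_Cons_conv)

lemma rstep_Fun_cases:
  assumes "(Fun f ss, t) \<in> rstep R"
  obtains (root) l r \<sigma> where "(l, r) \<in> R" "Fun f ss = subst \<sigma> l" "t = subst \<sigma> r"
  | (arg) us s s' vs where "ss = us @ s # vs" "t = Fun f (us @ s' # vs)" "(s, s') \<in> rstep R"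
  using assms by (cases rule: rstep.cases) auto

text \<open>A root step falls under the critical overlaps. Two steps below the root lie in the same
  argument, where the induction hypothesis applies, or in different arguments, where they
  commute.\<close>

lemma peak_joinable:
  assumes cov: "critical_overlaps_covered R" and R: "trs \<Sigma> R"
    and "(t, t1) \<in> rstep R" "(t, t2) \<in> rstep R"
  shows "joinable R t1 t2"
  using assms(3,4)
proof (induction arbitrary: t2 rule: rstep.induct)
  case (root l r \<sigma>)
  then show ?case
    using root_peak_joinable[OF cov R] by blast
next
  case (arg s t f us vs)
  note st = arg.hyps
  from arg.prems show ?case
  proof (cases rule: rstep_Fun_cases)
    case (root l r \<sigma>)
    then have "(subst \<sigma> l, Fun f (us @ t # vs)) \<in> rstep R"
      using rstep.arg[OF st, of f us vs] by simp
    then show ?thesis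
      using root_peak_joinable[OF cov R root(1)] root(3) by (auto intro: joinable_sym)
  next
    case 2: (arg us' s' t' vs')
    note t2 = 2(2) and st' = 2(3)
    from append_Cons_eq_append_Cons[OF 2(1)] show ?thesis
    proof (elim disjE exE conjE)
      assume "us = us'" "s = s'" "vs = vs'"
      then show ?thesis
        using arg.IH[of t'] st' t2 joinable_arg by auto
    next
      fix ws
      assume w: "us' = us @ s # ws" "vs = ws @ s' # vs'"
      have "(Fun f (us @ t # vs), Fun f (us @ t # ws @ t' # vs')) \<in> rstep R"
        using rstep.arg[OF st', of f "us @ t # ws" vs'] w by simp
      moreover have "(t2, Fun f (us @ t # ws @ t' # vs')) \<in> rstep R"
        using rstep.arg[OF st, of f us "ws @ t' # vs'"] w t2 by simp
      ultimately show ?thesis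
        unfolding joinable_def by blast
    next
      fix ws
      assume w: "us = us' @ s' # ws" "vs' = ws @ s # vs"
      have "(Fun f (us @ t # vs), Fun f (us' @ t' # ws @ t # vs)) \<in> rstep R"
        using rstep.arg[OF st', of f us' "ws @ t # vs"] w by simp
      moreover have "(t2, Fun f (us' @ t' # ws @ t # vs)) \<in> rstep R"
        using rstep.arg[OF st, of f "us' @ t' # ws" vs] w t2 by simp
      ultimately show ?thesis
        unfolding joinable_def by blast
    qed
  qed
qed

theorem locally_confluent_iff_critical_overlaps_covered:
  assumes R: "trs \<Sigma> R"
  shows "locally_confluent \<Sigma> R \<longleftrightarrow> critical_overlaps_covered R"
proof
  show "critical_overlaps_covered R \<Longrightarrow> locally_confluent \<Sigma> R"
    unfolding locally_confluent_iff_joinable[OF R] using peak_joinable[OF _ R] by blast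
  assume "locally_confluent \<Sigma> R"
  then have lc: "joinable R t1 t2" if "t \<in> terms \<Sigma>" "(t, t1) \<in> rstep R" "(t, t2) \<in> rstep R" for t t1 t2
    using that unfolding locally_confluent_iff_joinable[OF R] by blast
  have "covered R [(Fun f ts, odd_vars l')] (even_vars r) (plug D (odd_vars r'))"
    if lr: "(l, r) \<in> R" and lr': "(l', r') \<in> R" and l: "even_vars l = plug D (Fun f ts)"
    for l r l' r' D f ts
  proof (rule joinable_covered[where \<Sigma> = \<Sigma>])
    have tm: "even_vars l \<in> terms \<Sigma>" "odd_vars l' \<in> terms \<Sigma>"
      using R lr lr' by (auto simp: trs_def subst_in_terms_iff)
    then show "\<forall>(s, t)\<in>set [(Fun f ts, odd_vars l')]. s \<in> terms \<Sigma> \<and> t \<in> terms \<Sigma>"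
      using plug_in_termsD[of D "Fun f ts"] by (simp only: l) auto
    fix \<theta>
    assume u: "unifies \<theta> [(Fun f ts, odd_vars l')]" and \<theta>: "\<And>x. \<theta> x \<in> terms \<Sigma>"
    show "joinable R (subst \<theta> (even_vars r)) (subst \<theta> (plug D (odd_vars r')))"
    proof (rule lc)
      show "subst \<theta> (even_vars l) \<in> terms \<Sigma>"
        using tm \<theta> by (simp add: subst_in_terms_iff[of \<theta>])
      show "(subst \<theta> (even_vars l), subst \<theta> (even_vars r)) \<in> rstep R"
        using lr by (simp add: subst_subst rstep.root)
      have "(subst \<theta> (odd_vars l'), subst \<theta> (odd_vars r')) \<in> rstep R"
        using lr' by (simp add: subst_subst rstep.root)
      \<comment> \<open>The unifier turns the subterm at the overlap into an instance of
        \<open>odd_vars l'\<close>, so both rules apply to the same term.\<close>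
      moreover have "subst \<theta> (even_vars l) = plug (subst_ctxt \<theta> D) (subst \<theta> (odd_vars l'))"
        using u by (simp add: l del: subst.simps)
      ultimately show "(subst \<theta> (even_vars l), subst \<theta> (plug D (odd_vars r'))) \<in> rstep R"
        by (simp add: rstep_plug)
    qed
  qed
  then show "critical_overlaps_covered R"
    unfolding critical_overlaps_covered_def overlaps_covered_def by auto
qed


section \<open>Separation of terms by finite partial algebras\<close>

type_synonym table = "((symb \<times> nat list) \<times> nat) list"

text \<open>\<open>T\<close> is the graph of finitely many partial operations on numbers and
  \<open>\<alpha>\<close> values the variables below its length. All other variables, and
  applications missing from \<open>T\<close>, have no value.\<close>

inductive evaluates :: "table \<Rightarrow> nat list \<Rightarrow> trm \<Rightarrow> nat \<Rightarrow> bool" for T \<alpha> where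
  Var: "i < length \<alpha> \<Longrightarrow> evaluates T \<alpha> (Var i) (\<alpha> ! i)"
| Fun: "list_all2 (evaluates T \<alpha>) ts as \<Longrightarrow> ((f, as), a) \<in> set T \<Longrightarrow> evaluates T \<alpha> (Fun f ts) a"

text \<open>Here, in \<open>compatible\<close> and in \<open>closed_under\<close>, an implication
  from an equation is written as a disjunction with an inequality, for which \<open>re\<close> has
  rules.\<close>

definition functional :: "table \<Rightarrow> bool" where
  "functional T \<longleftrightarrow> (\<forall>p\<in>set T. \<forall>q\<in>set T. fst p \<noteq> fst q \<or> snd p = snd q)"

lemma evaluates_Var_iff: "evaluates T \<alpha> (Var i) a \<longleftrightarrow> i < length \<alpha> \<and> a = \<alpha> ! i"
  by (auto elim: evaluates.cases intro: evaluates.Var)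

lemma evaluates_Fun_iff:
  "evaluates T \<alpha> (Fun f ts) a \<longleftrightarrow> (\<exists>as. list_all2 (evaluates T \<alpha>) ts as \<and> ((f, as), a) \<in> set T)"
  by (auto elim: evaluates.cases intro: evaluates.Fun)

lemma evaluates_unique:
  assumes "functional T" "evaluates T \<alpha> t a" "evaluates T \<alpha> t b"
  shows "a = b"
  using assms(2,3)
proof (induction t arbitrary: a b)
  case (Fun f ts)
  then obtain as bs where as: "list_all2 (evaluates T \<alpha>) ts as" "((f, as), a) \<in> set T"
    and bs: "list_all2 (evaluates T \<alpha>) ts bs" "((f, bs), b) \<in> set T"
    unfolding evaluates_Fun_iff by blast
  have "as ! i = bs ! i" if "i < length ts" for i
    using that as(1) bs(1) Fun.IH[of "ts ! i"] by (simp add: list_all2_conv_all_nth)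
  then have "as = bs"
    using as(1) bs(1) by (simp add: list_all2_conv_all_nth list_eq_iff_nth_eq)
  then show ?case
    using assms(1) as(2) bs(2) unfolding functional_def by fastforce
qed (simp add: evaluates_Var_iff)

lemma evaluates_subst:
  assumes "evaluates T \<beta> t a" "\<And>x. x \<in> vars t \<Longrightarrow> x < length \<beta> \<Longrightarrow> evaluates T \<alpha> (\<sigma> x) (\<beta> ! x)"
  shows "evaluates T \<alpha> (subst \<sigma> t) a"
  using assms
proof (induction t arbitrary: a)
  case (Fun f ts)
  then obtain as where as: "list_all2 (evaluates T \<beta>) ts as" "((f, as), a) \<in> set T"
    unfolding evaluates_Fun_iff by blast
  have "list_all2 (evaluates T \<alpha>) (map (subst \<sigma>) ts) as"
    unfolding list_all2_conv_all_nth
  proof (intro conjI allI impI)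
    show "length (map (subst \<sigma>) ts) = length as"
      using as(1) by (simp add: list_all2_lengthD)
    fix i
    assume "i < length (map (subst \<sigma>) ts)"
    then have i: "i < length ts" "ts ! i \<in> set ts"
      by simp_all
    have "evaluates T \<alpha> (subst \<sigma> (ts ! i)) (as ! i)"
    proof (rule Fun.IH[OF i(2)])
      show "evaluates T \<beta> (ts ! i) (as ! i)"
        using as(1) i(1) by (rule list_all2_nthD)
    qed (use Fun.prems(2) i(2) in auto)
    then show "evaluates T \<alpha> (map (subst \<sigma>) ts ! i) (as ! i)"
      using i(1) by simp
  qed
  then show ?case
    using as(2) by (auto simp: evaluates_Fun_iff)
qed (simp add: evaluates_Var_iff)

lemma evaluates_substD:
  assumes "evaluates T \<alpha> (subst \<sigma> t) a" "x \<in> vars t"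
  shows "\<exists>b. evaluates T \<alpha> (\<sigma> x) b"
  using assms
proof (induction t arbitrary: a)
  case (Fun f ts)
  then obtain u where u: "u \<in> set ts" "x \<in> vars u"
    by auto
  moreover have "\<exists>b. evaluates T \<alpha> (subst \<sigma> u) b"
    using Fun.prems(1) u(1) unfolding subst.simps evaluates_Fun_iff
    by (auto simp: list_all2_map1 list_all2_conv_all_nth in_set_conv_nth)
  ultimately show ?case
    using Fun.IH by blast
qed auto

definition tuples :: "nat \<Rightarrow> nat \<Rightarrow> nat list list \<Rightarrow> bool" where
  "tuples n m B \<longleftrightarrow> (\<forall>\<beta>. length \<beta> = m \<and> (\<forall>b\<in>set \<beta>. b < n) \<longrightarrow> \<beta> \<in> set B)"

definition table_over :: "symb list \<Rightarrow> nat \<Rightarrow> table \<Rightarrow> bool" where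
  "table_over Sg n T \<longleftrightarrow> functional T \<and>
    (\<forall>e\<in>set T. fst (fst e) \<in> set Sg \<and> length (snd (fst e)) = rank (fst (fst e)) \<and> snd e < n)"

text \<open>\<open>Q\<close> over-approximates one rewrite step on values. This condition carries it
  through each argument position, matching \<open>rstep.arg\<close> as \<open>respects_rules\<close>
  matches \<open>rstep.root\<close>.\<close>

definition compatible :: "table \<Rightarrow> (nat \<times> nat) list \<Rightarrow> bool" where
  "compatible T Q \<longleftrightarrow> (\<forall>e\<in>set T. \<forall>q\<in>set Q. \<forall>us p vs. snd (fst e) = us @ p # vs \<longrightarrow>
    p \<noteq> fst q \<or> (\<exists>b. ((fst (fst e), us @ snd q # vs), b) \<in> set T \<and> (snd e, b) \<in> set Q))"

definition respects_rules :: "rule list \<Rightarrow> table \<Rightarrow> nat list list \<Rightarrow> (nat \<times> nat) list \<Rightarrow> bool" where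
  "respects_rules Rl T B Q \<longleftrightarrow> (\<forall>\<rho>\<in>set Rl. \<forall>\<beta>\<in>set B.
    \<exists>a b. evaluates T \<beta> (fst \<rho>) a \<and> evaluates T \<beta> (snd \<rho>) b \<and> (a, b) \<in> set Q)"

definition closed_under :: "nat list \<Rightarrow> (nat \<times> nat) list \<Rightarrow> bool" where
  "closed_under F Q \<longleftrightarrow> (\<forall>q\<in>set Q. (\<forall>a\<in>set F. a \<noteq> fst q) \<or> snd q \<in> set F)"

definition disjoint_lists :: "nat list \<Rightarrow> nat list \<Rightarrow> bool" where
  "disjoint_lists F G \<longleftrightarrow> (\<forall>a\<in>set F. \<forall>b\<in>set G. a \<noteq> b)"

definition separated_peak :: "symb list \<Rightarrow> rule list \<Rightarrow> bool" where
  "separated_peak Sg Rl \<longleftrightarrow> (\<exists>T n m B Q \<alpha> t a t1 a1 F1 t2 a2 F2.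
    table_over Sg n T \<and> tuples n m B \<and> compatible T Q \<and> respects_rules Rl T B Q \<and>
    (\<forall>b\<in>set \<alpha>. b < n) \<and> evaluates T \<alpha> t a \<and>
    (t, t1) \<in> rstep (set Rl) \<and> evaluates T \<alpha> t1 a1 \<and> a1 \<in> set F1 \<and> closed_under F1 Q \<and>
    (t, t2) \<in> rstep (set Rl) \<and> evaluates T \<alpha> t2 a2 \<and> a2 \<in> set F2 \<and> closed_under F2 Q \<and>
    disjoint_lists F1 F2)"

text \<open>The certificate does not state that the source of the peak is a term over the alphabet;
  this follows because the table only has entries for its symbols, with the correct arity.\<close>

lemma evaluates_in_terms:
  assumes "table_over Sg n T" "evaluates T \<alpha> t a"
  shows "t \<in> terms (set Sg)"
  using assms(2)
proof (induction t arbitrary: a)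
  case (Fun f ts)
  then obtain as where as: "list_all2 (evaluates T \<alpha>) ts as" "((f, as), a) \<in> set T"
    unfolding evaluates_Fun_iff by blast
  have "t \<in> terms (set Sg)" if "t \<in> set ts" for t
    using that as(1) Fun.IH[OF that] by (auto simp: list_all2_conv_all_nth in_set_conv_nth)
  then show ?case
    using as(2) assms(1) list_all2_lengthD[OF as(1)] by (fastforce simp: table_over_def)
qed simp

lemma evaluates_less:
  assumes "table_over Sg n T" "\<forall>b\<in>set \<alpha>. b < n" "evaluates T \<alpha> t a"
  shows "a < n"
proof (cases t)
  case (Fun f ts)
  then obtain as where "((f, as), a) \<in> set T"
    using assms(3) unfolding Fun evaluates_Fun_iff by blast
  then show ?thesis
    using assms(1) by (auto simp: table_over_def)
qed (use assms in \<open>simp add: evaluates_Var_iff\<close>)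

context
  fixes Sg Rl T n m B Q \<alpha>
  assumes T: "table_over Sg n T" and B: "tuples n m B" and Q: "compatible T Q"
    and Rl: "respects_rules Rl T B Q" and \<alpha>: "\<forall>b\<in>set \<alpha>. b < n"
    and vars_Rl: "\<forall>(l, r)\<in>set Rl. vars r \<subseteq> vars l"
begin

lemma evaluates_rstep:
  assumes "(s, t) \<in> rstep (set Rl)" "evaluates T \<alpha> s a"
  shows "\<exists>b. evaluates T \<alpha> t b \<and> (a, b) \<in> set Q"
  using assms
proof (induction arbitrary: a rule: rstep.induct)
  case (root l r \<sigma>)
  have "a < n"
    using evaluates_less[OF T \<alpha> root(2)] .
  obtain v where v: "\<And>x. x \<in> vars l \<Longrightarrow> evaluates T \<alpha> (\<sigma> x) (v x)"
    using evaluates_substD[OF root(2)] by metis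
  \<comment> \<open>Indices outside \<open>vars l\<close> get \<open>a\<close> merely as some number
    below \<open>n\<close>, which makes \<open>\<beta>\<close> a tuple occurring in
    \<open>B\<close>.\<close>
  define \<beta> where "\<beta> = map (\<lambda>x. if x \<in> vars l then v x else a) [0..<m]"
  have "length \<beta> = m" "\<forall>b\<in>set \<beta>. b < n"
    using \<open>a < n\<close> evaluates_less[OF T \<alpha> v] by (auto simp: \<beta>_def)
  then have "\<beta> \<in> set B"
    using B unfolding tuples_def by blast
  then obtain a' b where a': "evaluates T \<beta> l a'" and b: "evaluates T \<beta> r b" "(a', b) \<in> set Q"
    using Rl root(1) unfolding respects_rules_def by fastforce
  have v\<beta>: "evaluates T \<alpha> (\<sigma> x) (\<beta> ! x)" if "x \<in> vars l" "x < length \<beta>" for x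
    using that v by (simp add: \<beta>_def)
  have "evaluates T \<alpha> (subst \<sigma> l) a'"
    using evaluates_subst[OF a'] v\<beta> by blast
  \<comment> \<open>The rule check yields a value under \<open>\<beta>\<close>; uniqueness
    identifies it with the given value of the instance of \<open>l\<close>.\<close>
  then have "a' = a"
    using evaluates_unique T root(2) unfolding table_over_def by blast
  moreover have "evaluates T \<alpha> (subst \<sigma> r) b"
    using evaluates_subst[OF b(1)] v\<beta> vars_Rl root(1) by blast
  ultimately show ?case
    using b(2) by blast
next
  case (arg s t f us vs)
  then obtain as p bs where us: "list_all2 (evaluates T \<alpha>) us as" and p: "evaluates T \<alpha> s p"
    and vs: "list_all2 (evaluates T \<alpha>) vs bs" and a: "((f, as @ p # bs), a) \<in> set T"
    unfolding evaluates_Fun_iff by (auto simp: list_all2_append1 list_all2_Cons1)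
  obtain q where q: "evaluates T \<alpha> t q" "(p, q) \<in> set Q"
    using arg.IH[OF p] by blast
  obtain b where b: "((f, as @ q # bs), b) \<in> set T" "(a, b) \<in> set Q"
    using Q[unfolded compatible_def, rule_format, OF a q(2), of as p bs] by auto
  have "list_all2 (evaluates T \<alpha>) (us @ t # vs) (as @ q # bs)"
    using us vs q(1) by (simp add: list_all2_appendI)
  then show ?case
    using b evaluates.Fun by blast
qed

lemma evaluates_rsteps:
  assumes "(s, t) \<in> (rstep (set Rl))\<^sup>*" "evaluates T \<alpha> s a" "a \<in> set F" "closed_under F Q"
  shows "\<exists>b. evaluates T \<alpha> t b \<and> b \<in> set F"
  using assms(1)
proof (induction rule: rtrancl_induct)
  case base
  then show ?case
    using assms(2,3) by blast
next
  case (step t u)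
  then obtain b where b: "evaluates T \<alpha> t b" "b \<in> set F"
    by blast
  then obtain c where c: "evaluates T \<alpha> u c" "(b, c) \<in> set Q"
    using evaluates_rstep[OF step(2)] by blast
  then have "c \<in> set F"
    using b assms(4) unfolding closed_under_def by fastforce
  then show ?case
    using c by blast
qed

end

text \<open>A common reduct of \<open>t1\<close> and \<open>t2\<close> would have a single value,
  lying in both \<open>F1\<close> and \<open>F2\<close>.\<close>

lemma separated_peak_not_locally_confluent:
  assumes R: "trs (set Sg) (set Rl)" and sep: "separated_peak Sg Rl"
  shows "\<not> locally_confluent (set Sg) (set Rl)"
proof
  assume lc: "locally_confluent (set Sg) (set Rl)"
  obtain T n m B Q \<alpha> t a t1 a1 F1 t2 a2 F2 where T: "table_over Sg n T"
    and B: "tuples n m B" "compatible T Q" "respects_rules Rl T B Q" "\<forall>b\<in>set \<alpha>. b < n"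
    and t: "evaluates T \<alpha> t a"
    and 1: "(t, t1) \<in> rstep (set Rl)" "evaluates T \<alpha> t1 a1" "a1 \<in> set F1" "closed_under F1 Q"
    and 2: "(t, t2) \<in> rstep (set Rl)" "evaluates T \<alpha> t2 a2" "a2 \<in> set F2" "closed_under F2 Q"
    and F: "disjoint_lists F1 F2"
    using sep unfolding separated_peak_def by blast
  have "\<forall>(l, r)\<in>set Rl. vars r \<subseteq> vars l"
    using R by (auto simp: trs_def)
  note steps = evaluates_rsteps[OF T B this]
  obtain u where u: "(t1, u) \<in> (rstep (set Rl))\<^sup>*" "(t2, u) \<in> (rstep (set Rl))\<^sup>*"
    using lc evaluates_in_terms[OF T t] 1(1) 2(1)
    unfolding locally_confluent_iff_joinable[OF R] joinable_def by blast
  obtain b c where b: "evaluates T \<alpha> u b" "b \<in> set F1" and c: "evaluates T \<alpha> u c" "c \<in> set F2"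
    using steps[OF u(1) 1(2-4)] steps[OF u(2) 2(2-4)] by blast
  have "b = c"
    using evaluates_unique b(1) c(1) T unfolding table_over_def by blast
  then show False
    using b(2) c(2) F unfolding disjoint_lists_def by blast
qed


subsection \<open>Finite algebras from recognizable sets of descendants\<close>

text \<open>A big-step reading of the automaton. State constants have runs too, so that the mixed
  terms in the middle of a reduction are covered and runs can be pulled back along single
  steps.\<close>

inductive run :: "symb set \<Rightarrow> symb set \<Rightarrow> rule set \<Rightarrow> trm \<Rightarrow> symb \<Rightarrow> bool" for \<Sigma> A \<Delta> where
  state: "a \<in> A \<Longrightarrow> run \<Sigma> A \<Delta> (const a) a"
| rule: "f \<in> \<Sigma> \<Longrightarrow> list_all2 (run \<Sigma> A \<Delta>) ts as \<Longrightarrow> (Fun f (map const as), const a) \<in> \<Delta> \<Longrightarrow>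
    run \<Sigma> A \<Delta> (Fun f ts) a"
| eps: "run \<Sigma> A \<Delta> t b \<Longrightarrow> (const b, const a) \<in> \<Delta> \<Longrightarrow> run \<Sigma> A \<Delta> t a"

context
  fixes \<Sigma> A Af \<Delta>
  assumes bta: "is_bta \<Sigma> (A, Af, \<Delta>)"
begin

lemma bta_rule_cases:
  assumes "(l, r) \<in> \<Delta>"
  obtains (rule) f as a where "f \<in> \<Sigma>" "length as = rank f" "set as \<subseteq> A" "a \<in> A"
    "l = Fun f (map const as)" "r = const a"
  | (eps) a b where "a \<in> A" "b \<in> A" "l = const a" "r = const b"
proof -
  have "(\<exists>f as a. f \<in> \<Sigma> \<and> length as = rank f \<and> set as \<subseteq> A \<and> a \<in> A \<and>
          (l, r) = (Fun f (map const as), const a)) \<or>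
        (\<exists>a \<in> A. \<exists>a' \<in> A. (l, r) = (const a, const a'))"
    using bta assms unfolding is_bta.simps by blast
  then show thesis
    using that by blast
qed

lemma bta_rank: "a \<in> A \<Longrightarrow> rank a = 0" and bta_disjoint: "a \<in> A \<Longrightarrow> a \<notin> \<Sigma>"
  using bta by auto

lemma bta_rule_ground: "(l, r) \<in> \<Delta> \<Longrightarrow> vars l = {} \<and> vars r = {}"
  by (erule bta_rule_cases) auto

lemma bta_trs: "trs (\<Sigma> \<union> A) \<Delta>"
proof -
  have const: "const a \<in> terms (\<Sigma> \<union> A)" if "a \<in> A" for a
    using that bta_rank[OF that] by simp
  have "l \<in> terms (\<Sigma> \<union> A) \<and> r \<in> terms (\<Sigma> \<union> A) \<and> vars r \<subseteq> vars l" if "(l, r) \<in> \<Delta>" for l r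
    using that
  proof (cases rule: bta_rule_cases)
    case (rule f as a)
    then have "set (map const as) \<subseteq> terms (\<Sigma> \<union> A)"
      using const by auto
    then show ?thesis
      using rule const[of a] by simp
  qed (use const in simp)
  then show ?thesis
    using bta by (auto simp: trs_def)
qed

lemma bta_rule_target: "(l, const a) \<in> \<Delta> \<Longrightarrow> a \<in> A"
  by (erule bta_rule_cases) auto

lemma run_state: "run \<Sigma> A \<Delta> t a \<Longrightarrow> a \<in> A"
  by (induction rule: run.induct) (auto dest: bta_rule_target)

lemma run_rsteps: "run \<Sigma> A \<Delta> t a \<Longrightarrow> (t, const a) \<in> (rstep \<Delta>)\<^sup>*"
proof (induction rule: run.induct)
  case (rule f ts as a)
  have "list_all2 (\<lambda>s t. (s, t) \<in> (rstep \<Delta>)\<^sup>*) ts (map const as)"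
    using rule.IH unfolding list_all2_map2 by (rule list_all2_mono) blast
  from rsteps_args[OF this, of f "[]"]
  have "(Fun f ts, Fun f (map const as)) \<in> (rstep \<Delta>)\<^sup>*"
    by simp
  moreover have "(Fun f (map const as), const a) \<in> rstep \<Delta>"
    using rstep.root[OF rule.hyps(2), of Var] by (simp add: comp_def)
  ultimately show ?case
    by (rule rtrancl_into_rtrancl)
next
  case (eps t b a)
  then show ?case
    using rstep.root[of "const b" "const a" \<Delta> Var] by (auto intro: rtrancl_into_rtrancl)
qed simp

text \<open>States lie outside \<open>\<Sigma>\<close>, so a run on \<open>const b\<close> is
  \<open>state\<close> followed by \<open>eps\<close> rules, and these can be appended to a run on
  \<open>s\<close>.\<close>

lemma run_trans:
  assumes "run \<Sigma> A \<Delta> (const b) a" "run \<Sigma> A \<Delta> s b"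
  shows "run \<Sigma> A \<Delta> s a"
  using assms
proof (induction "const b" a rule: run.induct)
  case rule
  then show ?case
    using run_state bta_disjoint by blast
qed (auto intro: run.eps)

lemma run_rstep:
  assumes "(s, t) \<in> rstep \<Delta>" "run \<Sigma> A \<Delta> t a"
  shows "run \<Sigma> A \<Delta> s a"
  using assms
proof (induction arbitrary: a rule: rstep.induct)
  case (root l r \<sigma>)
  have "subst \<sigma> l = subst Var l" "subst \<sigma> r = subst Var r"
    using bta_rule_ground[OF root(1)] by (auto intro!: subst_cong simp del: subst_Var)
  then have eq: "subst \<sigma> l = l" "subst \<sigma> r = r"
    by simp_all
  from root(1) show ?case
  proof (cases rule: bta_rule_cases)
    case (rule f as b)
    have "list_all2 (run \<Sigma> A \<Delta>) (map const as) as"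
      using rule(3) by (auto simp: list_all2_conv_all_nth intro!: run.state)
    then have "run \<Sigma> A \<Delta> l b"
      using rule root(1) run.rule by simp
    then show ?thesis
      using root(2) rule run_trans unfolding eq by blast
  next
    case (eps b c)
    then have "run \<Sigma> A \<Delta> l c"
      using root(1) run.state run.eps by metis
    then show ?thesis
      using root(2) eps run_trans unfolding eq by blast
  qed
next
  case (arg s t f us vs)
  from arg.prems show ?case
  proof (induction "Fun f (us @ t # vs)" a rule: run.induct)
    case (rule as a)
    have "list_all2 (run \<Sigma> A \<Delta>) (us @ t # vs) as"
      using rule.hyps(2) by (rule list_all2_mono) blast
    then obtain as1 p as2 where "as = as1 @ p # as2" "list_all2 (run \<Sigma> A \<Delta>) us as1"
      "run \<Sigma> A \<Delta> t p" "list_all2 (run \<Sigma> A \<Delta>) vs as2"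
      by (auto simp: list_all2_append1 list_all2_Cons1)
    then have "list_all2 (run \<Sigma> A \<Delta>) (us @ s # vs) as"
      using arg.IH by (simp add: list_all2_appendI)
    then show ?case
      using rule run.rule by blast
  qed (auto intro: run.eps)
qed

lemma run_iff: "run \<Sigma> A \<Delta> t a \<longleftrightarrow> a \<in> A \<and> (t, const a) \<in> (rstep \<Delta>)\<^sup>*"
proof
  assume "a \<in> A \<and> (t, const a) \<in> (rstep \<Delta>)\<^sup>*"
  then have "(t, const a) \<in> (rstep \<Delta>)\<^sup>*" "run \<Sigma> A \<Delta> (const a) a"
    by (auto intro: run.state)
  then show "run \<Sigma> A \<Delta> t a"
    by (induction rule: converse_rtrancl_induct) (auto intro: run_rstep)
qed (auto intro: run_state run_rsteps)

lemma run_Fun_mono: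
  assumes "f \<in> \<Sigma>" "list_all2 (\<lambda>s t. Collect (run \<Sigma> A \<Delta> s) \<subseteq> Collect (run \<Sigma> A \<Delta> t)) ss ts"
    "run \<Sigma> A \<Delta> (Fun f ss) a"
  shows "run \<Sigma> A \<Delta> (Fun f ts) a"
  using assms(3)
proof (induction "Fun f ss" a rule: run.induct)
  case state
  then show ?case
    using assms(1) bta_disjoint by blast
next
  case (rule as a)
  have "list_all2 (run \<Sigma> A \<Delta>) ts as"
    using assms(2) rule.hyps(2) by (fastforce simp: list_all2_conv_all_nth)
  then show ?case
    using rule run.rule by blast
qed (auto intro: run.eps)

end

text \<open>\<open>h t\<close> is the set of states reachable from \<open>t\<close>, as in the
  subset construction: it decides acceptance, and its value on \<open>Fun f ts\<close> depends only
  on \<open>f\<close> and the sets for the arguments.\<close>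

lemma recognizable_finite_congruence:
  assumes "is_bta \<Sigma> C"
  obtains h :: "trm \<Rightarrow> symb set" where "finite (range h)"
    and "\<And>f ss ts. f \<in> \<Sigma> \<Longrightarrow> map h ss = map h ts \<Longrightarrow> h (Fun f ss) = h (Fun f ts)"
    and "\<And>s t. s \<in> gterms \<Sigma> \<Longrightarrow> t \<in> gterms \<Sigma> \<Longrightarrow> h s = h t \<Longrightarrow> s \<in> lang \<Sigma> C \<Longrightarrow> t \<in> lang \<Sigma> C"
proof -
  obtain A Af \<Delta> where C: "C = (A, Af, \<Delta>)"
    by (cases C)
  note bta = assms[unfolded C]
  let ?h = "\<lambda>t. Collect (run \<Sigma> A \<Delta> t)"
  show thesis
  proof (rule that[of ?h])
    have "range ?h \<subseteq> Pow A"
      using run_state[OF bta] by auto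
    moreover have "finite A"
      using bta by simp
    ultimately show "finite (range ?h)"
      using finite_subset by blast
    show "?h (Fun f ss) = ?h (Fun f ts)" if "f \<in> \<Sigma>" "map ?h ss = map ?h ts" for f ss ts
    proof -
      have "list_all2 (\<lambda>s t. ?h s \<subseteq> ?h t) ss ts" "list_all2 (\<lambda>s t. ?h s \<subseteq> ?h t) ts ss"
        using that(2) by (auto simp: list_all2_conv_all_nth list_eq_iff_nth_eq)
      then show ?thesis
        using run_Fun_mono[OF bta that(1)] by blast
    qed
    have "t \<in> lang \<Sigma> C \<longleftrightarrow> (\<exists>a\<in>Af. run \<Sigma> A \<Delta> t a)" if "t \<in> gterms \<Sigma>" for t
    proof -
      have "terms \<Sigma> \<subseteq> terms (\<Sigma> \<union> A)"
      proof
        show "t \<in> terms \<Sigma> \<Longrightarrow> t \<in> terms (\<Sigma> \<union> A)" for t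
          by (induction t) auto
      qed
      then have "t \<in> terms (\<Sigma> \<union> A)"
        using that by (auto simp: gterms_def)
      moreover have "Af \<subseteq> A"
        using bta by simp
      ultimately show ?thesis
        using that by (auto simp: C run_iff[OF bta] rewrite_rtrancl_iff[OF bta_trs[OF bta]])
    qed
    then show "t \<in> lang \<Sigma> C"
      if "s \<in> gterms \<Sigma>" "t \<in> gterms \<Sigma>" "?h s = ?h t" "s \<in> lang \<Sigma> C" for s t
      using that by blast
  qed
qed

section \<open>From a finite congruence to a certificate\<close>

lemma rstep_vars:
  assumes "trs \<Sigma> R" "(s, t) \<in> rstep R"
  shows "vars t \<subseteq> vars s"
  using assms(2)
proof (induction rule: rstep.induct)
  case (root l r \<sigma>)
  then have "vars r \<subseteq> vars l"
    using assms(1) by (auto simp: trs_def)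
  then show ?case
    by (auto simp: vars_subst)
qed auto

lemma Fun_in_gterms_iff:
  "Fun f ts \<in> gterms \<Sigma> \<longleftrightarrow> f \<in> \<Sigma> \<and> length ts = rank f \<and> set ts \<subseteq> gterms \<Sigma>"
  by (auto simp: gterms_def)

lemma subst_in_gterms:
  "t \<in> terms \<Sigma> \<Longrightarrow> (\<And>x. x \<in> vars t \<Longrightarrow> \<sigma> x \<in> gterms \<Sigma>) \<Longrightarrow> subst \<sigma> t \<in> gterms \<Sigma>"
  by (simp add: gterms_def subst_in_terms_iff vars_subst)

lemma terms_mono: "\<Sigma> \<subseteq> \<Sigma>' \<Longrightarrow> t \<in> terms \<Sigma> \<Longrightarrow> t \<in> terms \<Sigma>'"
  by (induction t) auto

lemma trs_mono: "\<Sigma> \<subseteq> \<Sigma>' \<Longrightarrow> trs \<Sigma> R \<Longrightarrow> trs \<Sigma>' R"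
  using terms_mono unfolding trs_def by blast

lemma rstep_in_gterms:
  "trs \<Sigma> R \<Longrightarrow> (s, t) \<in> rstep R \<Longrightarrow> s \<in> gterms \<Sigma> \<Longrightarrow> t \<in> gterms \<Sigma>"
  using rstep_in_terms rstep_vars unfolding gterms_def by blast

text \<open>Values are the classes of ground terms over \<open>\<Sigma>'\<close> as numbered by
  \<open>v\<close>, \<open>T\<close> is the graph of the operations of \<open>Sg\<close> on classes,
  and \<open>Q\<close> relates classes that have representatives joined by a step. Symbols of
  \<open>\<Sigma>'\<close> outside \<open>Sg\<close> stay out of the table; variables sent to them
  by \<open>\<phi>\<close> are valued through \<open>\<alpha>\<close>.\<close>

lemma separated_peakI:
  fixes v :: "trm \<Rightarrow> nat"
  assumes fin: "finite \<Sigma>'" and Sg: "set Sg \<subseteq> \<Sigma>'" and R: "trs (set Sg) (set Rl)"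
    and v: "v ` gterms \<Sigma>' = {..<n}"
    and cong: "\<And>f ss ts. f \<in> \<Sigma>' \<Longrightarrow> map v ss = map v ts \<Longrightarrow> v (Fun f ss) = v (Fun f ts)"
    and inv: "\<And>D s t. D \<in> {D1, D2} \<Longrightarrow> s \<in> gterms \<Sigma>' \<Longrightarrow> t \<in> gterms \<Sigma>' \<Longrightarrow> v s = v t \<Longrightarrow> s \<in> D \<Longrightarrow> t \<in> D"
    and closed: "\<And>D s t. D \<in> {D1, D2} \<Longrightarrow> s \<in> D \<Longrightarrow> (s, t) \<in> rstep (set Rl) \<Longrightarrow> t \<in> D"
    and disj: "D1 \<inter> D2 = {}" and sub: "D1 \<subseteq> gterms \<Sigma>'" "D2 \<subseteq> gterms \<Sigma>'"
    and \<phi>: "\<And>x. \<phi> x \<in> gterms \<Sigma>'" and t: "t \<in> terms (set Sg)"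
    and t1: "(t, t1) \<in> rstep (set Rl)" "subst \<phi> t1 \<in> D1"
    and t2: "(t, t2) \<in> rstep (set Rl)" "subst \<phi> t2 \<in> D2"
  shows "separated_peak Sg Rl"
proof -
  let ?G = "gterms \<Sigma>'"
  have R': "trs \<Sigma>' (set Rl)"
    using trs_mono[OF Sg R] .
  have v_less: "v s < n" if "s \<in> ?G" for s
    using v that by blast
  obtain m where m: "\<forall>(l, r)\<in>set Rl. vars l \<subseteq> {..<m}" "vars t \<subseteq> {..<m}"
  proof -
    have "finite (vars t \<union> (\<Union>(l, r)\<in>set Rl. vars l))"
      by auto
    then obtain m where "\<forall>x\<in>vars t \<union> (\<Union>(l, r)\<in>set Rl. vars l). x < m"
      using finite_nat_set_iff_bounded by meson
    then show thesis
      using that[of m] by fastforce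
  qed
  define TS where "TS = {((f, map v ss), v (Fun f ss)) | f ss. f \<in> set Sg \<and> length ss = rank f \<and> set ss \<subseteq> ?G}"
  have TS_in: "((f, map v ss), v (Fun f ss)) \<in> TS" if "f \<in> set Sg" "Fun f ss \<in> ?G" for f ss
    using that unfolding TS_def Fun_in_gterms_iff by blast
  have "TS \<subseteq> (\<Union>f\<in>set Sg. {f} \<times> {as. set as \<subseteq> {..<n} \<and> length as = rank f}) \<times> {..<n}"
    using v_less Sg unfolding TS_def by (auto simp: Fun_in_gterms_iff subset_iff)
  moreover have "finite ((\<Union>f\<in>set Sg. {f} \<times> {as. set as \<subseteq> {..<n} \<and> length as = rank f}) \<times> {..<n})"
    by (intro finite_cartesian_product finite_UN_I finite_lists_length_eq) auto
  ultimately have "finite TS"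
    by (rule finite_subset)
  then obtain T where T: "set T = TS"
    using finite_list by blast
  define QS where "QS = {(v s, v s') | s s'. s \<in> ?G \<and> (s, s') \<in> rstep (set Rl)}"
  have "QS \<subseteq> {..<n} \<times> {..<n}"
    using v_less rstep_in_gterms[OF R'] unfolding QS_def by blast
  then have "finite QS"
    by (rule finite_subset) simp
  then obtain Q where Q: "set Q = QS"
    using finite_list by blast
  obtain B where B: "set B = {\<beta>. set \<beta> \<subseteq> {..<n} \<and> length \<beta> = m}"
    using finite_list[OF finite_lists_length_eq[of "{..<n}" m]] by auto
  have "finite (v ` D1)" "finite (v ` D2)"
    by (rule finite_subset[OF _ finite_lessThan[of n]], use v sub in blast)+
  then obtain F1 F2 where F1: "set F1 = v ` D1" and F2: "set F2 = v ` D2"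
    using finite_list by metis
  have eval: "evaluates T (map (\<lambda>x. v (\<sigma> x)) [0..<m]) s (v (subst \<sigma> s))"
    if "s \<in> terms (set Sg)" "vars s \<subseteq> {..<m}" "\<And>x. \<sigma> x \<in> ?G" for s \<sigma>
    using that(1,2)
  proof (induction s rule: trm.induct)
    case (Var x)
    then show ?case
      using evaluates.Var[of x "map (\<lambda>x. v (\<sigma> x)) [0..<m]" T] by simp
  next
    case (Fun f ts)
    let ?ts = "map (subst \<sigma>) ts"
    have tm: "Fun f ts \<in> terms (set Sg)"
      using Fun.prems by blast
    have "Fun f ?ts \<in> ?G"
      using subst_in_gterms[of "Fun f ts" \<Sigma>' \<sigma>] that(3) terms_mono[OF Sg tm] by simp
    then have "((f, map v ?ts), v (Fun f ?ts)) \<in> set T"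
      using tm unfolding T by (intro TS_in) simp_all
    moreover have "evaluates T (map (\<lambda>x. v (\<sigma> x)) [0..<m]) u (v (subst \<sigma> u))" if "u \<in> set ts" for u
      using that Fun.prems by (intro Fun.IH) auto
    then have "list_all2 (evaluates T (map (\<lambda>x. v (\<sigma> x)) [0..<m])) ts (map v ?ts)"
      by (simp add: list_all2_conv_all_nth)
    ultimately show ?case
      by (auto intro: evaluates.Fun)
  qed
  let ?\<alpha> = "map (\<lambda>x. v (\<phi> x)) [0..<m]"
  have tab: "table_over Sg n T"
    unfolding table_over_def functional_def
  proof (intro conjI ballI)
    fix p q
    assume "p \<in> set T" "q \<in> set T"
    then obtain f ss g ts where p: "p = ((f, map v ss), v (Fun f ss))" "f \<in> set Sg"
      and q: "q = ((g, map v ts), v (Fun g ts))"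
      unfolding T TS_def by blast
    show "fst p \<noteq> fst q \<or> snd p = snd q"
      using cong[of f ss ts] p(2) Sg by (auto simp: p(1) q)
  next
    fix e
    assume "e \<in> set T"
    then obtain f ss where "e = ((f, map v ss), v (Fun f ss))" "f \<in> set Sg" "length ss = rank f" "set ss \<subseteq> ?G"
      unfolding T TS_def by blast
    then show "fst (fst e) \<in> set Sg" "length (snd (fst e)) = rank (fst (fst e))" "snd e < n"
      using v_less[of "Fun f ss"] Sg by (auto simp: Fun_in_gterms_iff)
  qed
  have comp: "compatible T Q"
    unfolding compatible_def
  proof (intro ballI allI impI)
    fix e q us p vs
    assume e: "e \<in> set T" and q: "q \<in> set Q" and eq: "snd (fst e) = us @ p # vs"
    obtain f ss where ss: "e = ((f, map v ss), v (Fun f ss))" "f \<in> set Sg" "length ss = rank f" "set ss \<subseteq> ?G"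
      using e unfolding T TS_def by blast
    obtain s s' where s: "q = (v s, v s')" "s \<in> ?G" "(s, s') \<in> rstep (set Rl)"
      using q unfolding Q QS_def by blast
    have "s' \<in> ?G"
      using rstep_in_gterms[OF R' s(3,2)] .
    obtain us0 s0 vs0 where ss0: "ss = us0 @ s0 # vs0" "us = map v us0" "p = v s0" "vs = map v vs0"
      using eq ss(1) by (auto simp: map_eq_append_conv map_eq_Cons_conv)
    show "p \<noteq> fst q \<or> (\<exists>b. ((fst (fst e), us @ snd q # vs), b) \<in> set T \<and> (snd e, b) \<in> set Q)"
    proof (cases "p = fst q")
      case True
      have G: "Fun f (us0 @ s # vs0) \<in> ?G" "Fun f (us0 @ s' # vs0) \<in> ?G"
        using ss ss0 s(2) \<open>s' \<in> ?G\<close> Sg by (auto simp: Fun_in_gterms_iff)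
      have "map v ss = map v (us0 @ s # vs0)"
        using True ss0 s(1) by simp
      then have "v (Fun f ss) = v (Fun f (us0 @ s # vs0))"
        using cong ss(2) Sg by blast
      then have "(snd e, v (Fun f (us0 @ s' # vs0))) \<in> set Q"
        using G(1) rstep.arg[OF s(3), of f us0 vs0] unfolding Q QS_def ss(1) by auto
      moreover have "((fst (fst e), us @ snd q # vs), v (Fun f (us0 @ s' # vs0))) \<in> set T"
        using TS_in[OF ss(2) G(2)] by (simp add: T ss(1) s(1) ss0)
      ultimately show ?thesis
        by blast
    qed simp
  qed
  have rules: "respects_rules Rl T B Q"
    unfolding respects_rules_def
  proof (intro ballI)
    fix \<rho> \<beta>
    assume \<rho>: "\<rho> \<in> set Rl" and \<beta>: "\<beta> \<in> set B"
    obtain l r where lr: "\<rho> = (l, r)"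
      by (cases \<rho>)
    have tm: "l \<in> terms (set Sg)" "r \<in> terms (set Sg)" "vars r \<subseteq> vars l"
      using R \<rho> lr by (auto simp: trs_def)
    have vars: "vars l \<subseteq> {..<m}"
      using m(1) \<rho> lr by auto
    \<comment> \<open>Each number below \<open>n\<close> is the class of a ground term, so a
      valuation in \<open>B\<close> comes from a ground substitution. From \<open>m\<close> on any
      ground term will do, and \<open>\<phi>\<close> supplies one.\<close>
    have "\<exists>s\<in>?G. x < m \<longrightarrow> v s = \<beta> ! x" for x
    proof (cases "x < m")
      case True
      then have "\<beta> ! x \<in> {..<n}"
        using \<beta> nth_mem[of x \<beta>] unfolding B by blast
      then show ?thesis
        using v by (metis imageE)
    qed (use \<phi> in blast)
    then obtain \<sigma> where \<sigma>: "\<And>x. \<sigma> x \<in> ?G" "\<And>x. x < m \<Longrightarrow> v (\<sigma> x) = \<beta> ! x"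
      by metis
    have "\<beta> = map (\<lambda>x. v (\<sigma> x)) [0..<m]"
      using \<sigma>(2) \<beta> by (auto simp: B intro!: nth_equalityI)
    moreover have "(v (subst \<sigma> l), v (subst \<sigma> r)) \<in> set Q"
      using subst_in_gterms[of l \<Sigma>' \<sigma>, OF terms_mono[OF Sg tm(1)] \<sigma>(1)] rstep.root[of l r "set Rl" \<sigma>] \<rho> lr
      unfolding Q QS_def by blast
    ultimately show "\<exists>a b. evaluates T \<beta> (fst \<rho>) a \<and> evaluates T \<beta> (snd \<rho>) b \<and> (a, b) \<in> set Q"
      using eval[of l \<sigma>, OF tm(1) vars \<sigma>(1)] lr
        eval[of r \<sigma>, OF tm(2) order_trans[OF tm(3) vars] \<sigma>(1)] by auto
  qed
  have cl: "closed_under F Q" if D: "D \<in> {D1, D2}" and F: "set F = v ` D" for F D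
    unfolding closed_under_def
  proof
    fix q
    assume "q \<in> set Q"
    then obtain s s' where s: "q = (v s, v s')" "s \<in> ?G" "(s, s') \<in> rstep (set Rl)"
      unfolding Q QS_def by blast
    have "v s' \<in> set F" if "v s \<in> set F"
    proof -
      obtain s0 where "s0 \<in> D" "v s0 = v s"
        using \<open>v s \<in> set F\<close> F by auto
      \<comment> \<open>The class of \<open>s\<close> meets \<open>D\<close>, which is saturated on
        ground terms; so \<open>s\<close> itself lies in \<open>D\<close> and closure under
        rewriting applies.\<close>
      then have "s \<in> D"
        using inv[OF D, of s0 s] s(2) sub D by auto
      then show ?thesis
        using closed[OF D _ s(3)] F by blast
    qed
    then show "(\<forall>a\<in>set F. a \<noteq> fst q) \<or> snd q \<in> set F"
      using s(1) by auto
  qed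
  have "disjoint_lists F1 F2"
    unfolding disjoint_lists_def
  proof (intro ballI notI)
    fix a b
    assume ab: "a \<in> set F1" "b \<in> set F2" "a = b"
    then obtain s1 s2 where "s1 \<in> D1" "s2 \<in> D2" "v s1 = v s2"
      unfolding F1 F2 by auto
    then have "s2 \<in> D1"
      using inv[of D1 s1 s2] sub by blast
    then show False
      using \<open>s2 \<in> D2\<close> disj by blast
  qed
  moreover have "tuples n m B"
    unfolding tuples_def B by auto
  moreover have "\<forall>b\<in>set ?\<alpha>. b < n"
    using v_less \<phi> by auto
  moreover have "vars t1 \<subseteq> {..<m}" "vars t2 \<subseteq> {..<m}"
    using rstep_vars[OF R] t1(1) t2(1) m(2) by blast+
  then have "evaluates T ?\<alpha> t (v (subst \<phi> t))" "evaluates T ?\<alpha> t1 (v (subst \<phi> t1))"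
    "evaluates T ?\<alpha> t2 (v (subst \<phi> t2))"
    using eval[of t \<phi>, OF t m(2) \<phi>]
      eval[of t1 \<phi>, OF rstep_in_terms[OF R t1(1) t] _ \<phi>]
      eval[of t2 \<phi>, OF rstep_in_terms[OF R t2(1) t] _ \<phi>] by blast+
  moreover have "v (subst \<phi> t1) \<in> set F1" "v (subst \<phi> t2) \<in> set F2"
    using t1(2) t2(2) F1 F2 by auto
  moreover have "closed_under F1 Q" "closed_under F2 Q"
    using cl F1 F2 by blast+
  ultimately show ?thesis
    using tab comp rules t1(1) t2(1) unfolding separated_peak_def by blast
qed


subsection \<open>Freezing variables\<close>

text \<open>The names from \<open>k\<close> on are reserved for constants that stand for variables.\<close>

primrec unfreeze :: "nat \<Rightarrow> trm \<Rightarrow> trm" where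
  "unfreeze k (Var x) = Var x"
| "unfreeze k (Fun f ts) = (if k \<le> fst f then Var (fst f - k) else Fun f (map (unfreeze k) ts))"

lemma unfreeze_subst:
  assumes "\<forall>f\<in>\<Sigma>. fst f < k" "t \<in> terms \<Sigma>"
  shows "unfreeze k (subst \<sigma> t) = subst (\<lambda>x. unfreeze k (\<sigma> x)) t"
  using assms(2) by (induction t) (use assms(1) in fastforce)+

text \<open>A step below a symbol with a reserved name disappears, as both sides become the same
  variable; hence possibly zero steps. Rules contain no reserved names, so their instances remain
  instances.\<close>

lemma unfreeze_rstep:
  assumes k: "\<forall>f\<in>\<Sigma>. fst f < k" and R: "trs \<Sigma> R" and "(s, t) \<in> rstep R"
  shows "(unfreeze k s, unfreeze k t) \<in> (rstep R)\<^sup>*"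
  using assms(3)
proof (induction rule: rstep.induct)
  case (root l r \<sigma>)
  then have "l \<in> terms \<Sigma>" "r \<in> terms \<Sigma>"
    using R by (auto simp: trs_def)
  then show ?case
    using rstep.root[OF root] unfreeze_subst[OF k] by auto
qed (auto intro: rsteps_arg)

lemma unfreeze_rsteps:
  assumes k: "\<forall>f\<in>\<Sigma>. fst f < k" and R: "trs \<Sigma> R" and "(s, t) \<in> (rstep R)\<^sup>*"
  shows "(unfreeze k s, unfreeze k t) \<in> (rstep R)\<^sup>*"
  using assms(3)
proof (induction rule: rtrancl_induct)
  case (step t u)
  then show ?case
    using unfreeze_rstep[OF k R step(2)] by (meson rtrancl_trans)
qed simp

lemma funs_terms: "t \<in> terms \<Sigma> \<Longrightarrow> funs t \<subseteq> \<Sigma>"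
  by (induction t) auto

text \<open>EPRF enters only here, for the existence of two automata. Its freedom in the choice of
  the alphabet is what admits the additional constants.\<close>

lemma eprf_separated_peak:
  assumes R: "trs (set Sg) (set Rl)" and eprf: "eprf (set Rl)"
    and nlc: "\<not> locally_confluent (set Sg) (set Rl)"
  shows "separated_peak Sg Rl"
proof -
  let ?R = "set Rl"
  obtain t t1 t2 where t: "t \<in> terms (set Sg)" "(t, t1) \<in> rstep ?R" "(t, t2) \<in> rstep ?R"
    and nj: "\<not> joinable ?R t1 t2"
    using nlc unfolding locally_confluent_iff_joinable[OF R] by blast
  obtain k where "\<forall>x\<in>fst ` set Sg. x < k"
    using finite_nat_set_iff_bounded[of "fst ` set Sg"] by auto
  then have k: "\<forall>f\<in>set Sg. fst f < k"
    by simp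
  obtain m where m: "\<forall>x\<in>vars t. x < m"
    using finite_nat_set_iff_bounded[of "vars t"] by auto
  \<comment> \<open>Capping at \<open>m\<close> keeps \<open>\<Sigma>'\<close> finite while
    \<open>\<phi>\<close> is total. The variables of \<open>t\<close> lie below \<open>m\<close> and
    get distinct constants; the constant for \<open>m\<close> serves all other variables.\<close>
  define \<phi> where "\<phi> x = const (k + min x m, 0)" for x
  define \<Sigma>' where "\<Sigma>' = set Sg \<union> (\<lambda>x. (k + min x m, 0)) ` {..m}"
  have Sg: "set Sg \<subseteq> \<Sigma>'" and fin: "finite \<Sigma>'"
    by (auto simp: \<Sigma>'_def)
  have R': "trs \<Sigma>' ?R"
    using trs_mono[OF Sg R] .
  have \<phi>: "\<phi> x \<in> gterms \<Sigma>'" for x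
    unfolding \<phi>_def Fun_in_gterms_iff \<Sigma>'_def
    by (auto intro!: image_eqI[of _ _ "min x m"] simp: min_def)
  have tm: "s \<in> terms (set Sg)" "unfreeze k (subst \<phi> s) = s" "subst \<phi> s \<in> gterms \<Sigma>'"
    if "(t, s) \<in> rstep ?R" for s
  proof -
    show s: "s \<in> terms (set Sg)"
      using rstep_in_terms[OF R that t(1)] .
    have "unfreeze k (subst \<phi> s) = subst Var s"
      unfolding unfreeze_subst[OF k s]
      using m rstep_vars[OF R that] by (intro subst_cong) (fastforce simp: \<phi>_def min_def)
    then show "unfreeze k (subst \<phi> s) = s"
      by simp
    show "subst \<phi> s \<in> gterms \<Sigma>'"
      using terms_mono[OF Sg s] \<phi> by (rule subst_in_gterms)
  qed
  define D where "D s = descendants \<Sigma>' ?R {subst \<phi> s}" for s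
  have D_iff: "u \<in> D s \<longleftrightarrow> (subst \<phi> s, u) \<in> (rstep ?R)\<^sup>*" if "(t, s) \<in> rstep ?R" for s u
    using tm(3)[OF that] by (simp add: D_def descendants_def gterms_def rewrite_rtrancl_iff[OF R'])
  have "sign ?R \<subseteq> \<Sigma>'"
    using R' funs_terms by (fastforce simp: sign_def trs_def)
  then have rec: "\<exists>C. is_bta \<Sigma>' C \<and> lang \<Sigma>' C = D s" if "(t, s) \<in> rstep ?R" for s
    using eprf fin tm(3)[OF that] unfolding eprf_def D_def by blast
  obtain C1 C2 where C1: "is_bta \<Sigma>' C1" "lang \<Sigma>' C1 = D t1" and C2: "is_bta \<Sigma>' C2" "lang \<Sigma>' C2 = D t2"
    using rec[OF t(2)] rec[OF t(3)] by (elim exE conjE) (rule that)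
  obtain h1 :: "trm \<Rightarrow> symb set" where h1: "finite (range h1)"
    "\<And>f ss ts. f \<in> \<Sigma>' \<Longrightarrow> map h1 ss = map h1 ts \<Longrightarrow> h1 (Fun f ss) = h1 (Fun f ts)"
    "\<And>s t. s \<in> gterms \<Sigma>' \<Longrightarrow> t \<in> gterms \<Sigma>' \<Longrightarrow> h1 s = h1 t \<Longrightarrow> s \<in> D t1 \<Longrightarrow> t \<in> D t1"
    using recognizable_finite_congruence[OF C1(1)] unfolding C1(2) by metis
  obtain h2 :: "trm \<Rightarrow> symb set" where h2: "finite (range h2)"
    "\<And>f ss ts. f \<in> \<Sigma>' \<Longrightarrow> map h2 ss = map h2 ts \<Longrightarrow> h2 (Fun f ss) = h2 (Fun f ts)"
    "\<And>s t. s \<in> gterms \<Sigma>' \<Longrightarrow> t \<in> gterms \<Sigma>' \<Longrightarrow> h2 s = h2 t \<Longrightarrow> s \<in> D t2 \<Longrightarrow> t \<in> D t2"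
    using recognizable_finite_congruence[OF C2(1)] unfolding C2(2) by metis
  \<comment> \<open>The certificate has one algebra for both sets, hence the product of the two
    congruences.\<close>
  define h where "h s = (h1 s, h2 s)" for s
  have "range h \<subseteq> range h1 \<times> range h2"
    by (auto simp: h_def)
  then have fin_h: "finite (range h)"
    using h1(1) h2(1) finite_subset by blast
  \<comment> \<open>Ground classes must be numbered exactly by the numbers below \<open>n\<close>,
    yet \<open>v\<close> has to separate classes on all terms to inherit the congruence property.
    Classes without ground terms are therefore numbered from \<open>n\<close> on.\<close>
  obtain v n where v: "v ` gterms \<Sigma>' = {..<n :: nat}" and v_eq: "\<And>s t. v s = v t \<longleftrightarrow> h s = h t"
  proof -
    have "finite (h ` gterms \<Sigma>')"
      using fin_h by (rule finite_subset[rotated]) auto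
    then obtain g0 where g0: "bij_betw g0 (h ` gterms \<Sigma>') {0..<card (h ` gterms \<Sigma>')}"
      using ex_bij_betw_finite_nat by blast
    have "finite (range h - h ` gterms \<Sigma>')"
      using fin_h by blast
    then obtain g1 :: "_ \<Rightarrow> nat" where g1: "inj_on g1 (range h - h ` gterms \<Sigma>')"
      using finite_imp_inj_to_nat_seg by blast
    define n where "n = card (h ` gterms \<Sigma>')"
    define v where "v s = (if h s \<in> h ` gterms \<Sigma>' then g0 (h s) else n + g1 (h s))" for s
    have g0_less: "g0 x < n" if "x \<in> h ` gterms \<Sigma>'" for x
      using g0 that unfolding n_def by (auto simp: bij_betw_def)
    have "v ` gterms \<Sigma>' = g0 ` (h ` gterms \<Sigma>')"
      by (auto simp: v_def image_iff)
    then have "v ` gterms \<Sigma>' = {..<n}"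
      using g0 by (auto simp: bij_betw_def n_def)
    moreover have "v s = v t \<longleftrightarrow> h s = h t" for s t
    proof
      assume eq: "v s = v t"
      show "h s = h t"
      proof (cases "h s \<in> h ` gterms \<Sigma>' \<longleftrightarrow> h t \<in> h ` gterms \<Sigma>'")
        case True
        then show ?thesis
          using eq g0 g1 unfolding v_def bij_betw_def by (auto split: if_splits dest: inj_onD)
      next
        case False
        then show ?thesis
          using eq g0_less[of "h s"] g0_less[of "h t"] unfolding v_def by (auto split: if_splits)
      qed
    qed (simp add: v_def)
    ultimately show thesis
      by (rule that)
  qed
  show ?thesis
  proof (rule separated_peakI[OF fin Sg R v])
    show "v (Fun f ss) = v (Fun f ts)" if "f \<in> \<Sigma>'" "map v ss = map v ts" for f ss ts
    proof -
      have "map h ss = map h ts"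
        using that(2) unfolding list_all2_eq list_all2_map1 list_all2_map2 v_eq .
      moreover have "map h1 us = map fst (map h us)" "map h2 us = map snd (map h us)" for us
        by (simp_all add: h_def)
      ultimately have "map h1 ss = map h1 ts" "map h2 ss = map h2 ts"
        by (simp_all only:)
      then show ?thesis
        unfolding v_eq h_def using h1(2) h2(2) that(1) by blast
    qed
    show "s' \<in> E" if "E \<in> {D t1, D t2}" "s \<in> gterms \<Sigma>'" "s' \<in> gterms \<Sigma>'" "v s = v s'" "s \<in> E" for E s s'
      using that h1(3) h2(3) unfolding v_eq h_def by blast
    show "s' \<in> E" if "E \<in> {D t1, D t2}" "s \<in> E" "(s, s') \<in> rstep ?R" for E s s'
      using that t D_iff by (auto intro: rtrancl_into_rtrancl)
    \<comment> \<open>Unfreezing a common descendant yields a common reduct of \<open>t1\<close> and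
      \<open>t2\<close> themselves.\<close>
    have "False" if "u \<in> D t1" "u \<in> D t2" for u
    proof -
      have "(unfreeze k (subst \<phi> s), unfreeze k u) \<in> (rstep ?R)\<^sup>*" if "u \<in> D s" "(t, s) \<in> rstep ?R" for s
        using unfreeze_rsteps[OF k R] that D_iff by blast
      then have "(t1, unfreeze k u) \<in> (rstep ?R)\<^sup>*" "(t2, unfreeze k u) \<in> (rstep ?R)\<^sup>*"
        using that t(2,3) tm(2)[OF t(2)] tm(2)[OF t(3)] by metis+
      then show False
        using nj unfolding joinable_def by blast
    qed
    then show "D t1 \<inter> D t2 = {}"
      by blast
    show "D t1 \<subseteq> gterms \<Sigma>'" "D t2 \<subseteq> gterms \<Sigma>'"
      using C1(2) C2(2) by (cases C1, cases C2, auto)+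
    show "subst \<phi> t1 \<in> D t1" "subst \<phi> t2 \<in> D t2"
      using D_iff t by blast+
  qed (use \<phi> t in auto)
qed


section \<open>Enumerability of the certificates\<close>

lemma re_compose3:
  assumes "re (\<lambda>p. P (fst p) (fst (snd p)) (snd (snd p)))" "cf f" "cf g" "cf h"
  shows "re (\<lambda>x. P (f x) (g x) (h x))"
  using re_compose[OF assms(1), of "\<lambda>x. (f x, g x, h x)"] by (simp add: cf_pair assms(2-))

lemma re_compose4:
  assumes "re (\<lambda>p. P (fst p) (fst (snd p)) (fst (snd (snd p))) (snd (snd (snd p))))"
    "cf f" "cf g" "cf h" "cf k"
  shows "re (\<lambda>x. P (f x) (g x) (h x) (k x))"
  using re_compose[OF assms(1), of "\<lambda>x. (f x, g x, h x, k x)"] by (simp add: cf_pair assms(2-))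

section \<open>Relations on numbers and lists\<close>

lemma re_less [re_intros]: "cf f \<Longrightarrow> cf g \<Longrightarrow> re (\<lambda>x. f x < (g x :: nat))"
proof -
  have e: "m < n \<longleftrightarrow> (\<exists>k. n = Suc (m + k))" for m n :: nat
    using less_iff_Suc_add by blast
  assume "cf f" "cf g"
  then show ?thesis
    unfolding e by (intro cf_compose[OF \<open>cf f\<close>] cf_compose[OF \<open>cf g\<close>] re_intros)
qed

text \<open>A named relation instead of an equation, because \<open>re_eq\<close> would ask for a
  program computing \<open>length\<close>. \<open>append_rel\<close>, \<open>subst_rel\<close>,
  \<open>plugs_to\<close> and \<open>power_rel\<close> exist for the same reason.\<close>

definition length_rel :: "'a list \<Rightarrow> nat \<Rightarrow> bool" where
  "length_rel xs n \<longleftrightarrow> length xs = n"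

lemma re_length_rel [re_intros]: "cf f \<Longrightarrow> cf g \<Longrightarrow> re (\<lambda>x. length_rel (f x) (g x))"
proof -
  have e: "length_rel xs n \<longleftrightarrow> drop n xs = [] \<and> (n = 0 \<or> (\<exists>m. n = Suc m \<and> drop m xs \<noteq> []))"
    for n and xs :: "'b list"
    by (cases n) (auto simp: length_rel_def)
  assume "cf f" "cf g"
  then show ?thesis
    unfolding e by (intro cf_compose[OF \<open>cf f\<close>] cf_compose[OF \<open>cf g\<close>] re_intros)
qed

definition append_rel :: "'a list \<Rightarrow> 'a list \<Rightarrow> 'a list \<Rightarrow> bool" where
  "append_rel xs ys zs \<longleftrightarrow> xs @ ys = zs"

lemma re_append_rel [re_intros]:
  assumes "cf f" "cf g" "cf h"
  shows "re (\<lambda>x. append_rel (f x) (g x) (h x))"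
proof (rule re_compose3[OF _ assms])
  let ?P = "\<lambda>p :: 'b list \<times> 'b list \<times> 'b list. append_rel (fst p) (fst (snd p)) (snd (snd p))"
  show "re ?P"
  proof (rule re_recursive[where m = "\<lambda>p. length (fst p)" and K = "\<lambda>p us. \<exists>xs ys zs. p = (xs, ys, zs) \<and>
      (xs = [] \<and> ys = zs \<or> (\<exists>x xs' zs'. xs = x # xs' \<and> zs = x # zs' \<and> us = [(xs', ys, zs')]))"])
    fix p :: "'b list \<times> 'b list \<times> 'b list"
    assume "?P p"
    then show "\<exists>us. (\<exists>xs ys zs. p = (xs, ys, zs) \<and> (xs = [] \<and> ys = zs \<or>
        (\<exists>x xs' zs'. xs = x # xs' \<and> zs = x # zs' \<and> us = [(xs', ys, zs')]))) \<and>
      (\<forall>y\<in>set us. ?P y \<and> length (fst y) < length (fst p))"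
    proof (cases "fst p")
      case Nil
      then show ?thesis
        using \<open>?P p\<close> by (intro exI[of _ "[]"]) (cases p, simp add: append_rel_def)
    next
      case (Cons x xs)
      then show ?thesis
        using \<open>?P p\<close> by (intro exI[of _ "[(xs, fst (snd p), xs @ fst (snd p))]"])
          (cases p, auto simp: append_rel_def)
    qed
  next
    show "?P p" if "\<exists>xs ys zs. p = (xs, ys, zs) \<and> (xs = [] \<and> ys = zs \<or>
        (\<exists>x xs' zs'. xs = x # xs' \<and> zs = x # zs' \<and> us = [(xs', ys, zs')]))" "\<forall>y\<in>set us. ?P y" for p us
      using that by (auto simp: append_rel_def)
  qed (intro re_intros)
qed

text \<open>The splits of a list are indexed by the position of \<open>p\<close>. As the suffix
  determines the prefix, the universal quantifier over \<open>us\<close> can be traded for an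
  existential one.\<close>

lemma re_splits [re_intros]:
  assumes P: "re (\<lambda>p. P (fst p) (fst (snd p)) (fst (snd (snd p))) (snd (snd (snd p))))" and "cf f"
  shows "re (\<lambda>x. \<forall>us p vs. f x = us @ p # vs \<longrightarrow> P x us p vs)"
proof -
  have "(\<forall>us p vs. xs = us @ p # vs \<longrightarrow> P x us p vs) \<longleftrightarrow>
      (\<forall>i<code xs. drop i xs = [] \<or> (\<exists>p vs us. drop i xs = p # vs \<and> append_rel us (p # vs) xs \<and> P x us p vs))"
    (is "?L \<longleftrightarrow> ?R") for x xs
  proof
    assume L: ?L
    have "drop i xs = [] \<or> (\<exists>p vs us. drop i xs = p # vs \<and> append_rel us (p # vs) xs \<and> P x us p vs)" for i
    proof (cases "drop i xs")
      case (Cons p vs)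
      then have "take i xs @ p # vs = xs"
        by (metis append_take_drop_id)
      then show ?thesis
        using L Cons unfolding append_rel_def by metis
    qed simp
    then show ?R
      by blast
  next
    assume R: ?R
    show ?L
    proof (intro allI impI)
      fix us p vs
      assume xs: "xs = us @ p # vs"
      then have "length us < code xs"
        using length_le_code[of xs] by simp
      moreover have "drop (length us) xs = p # vs"
        by (simp add: xs)
      ultimately have "\<exists>us'. us' @ p # vs = xs \<and> P x us' p vs"
        using R unfolding append_rel_def by fastforce
      then show "P x us p vs"
        by (auto simp: xs)
    qed
  qed
  note e = this
  show ?thesis
    unfolding e by (intro re_compose4[OF P] cf_compose[OF \<open>cf f\<close>] re_intros)
qed


subsection \<open>Terms and rewriting\<close>

lemma weight_arg_less: "u \<in> set ts \<Longrightarrow> weight u < weight (Fun f ts)"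
  by (auto simp: less_Suc_eq_le intro: member_le_sum_list)

definition subst_rel :: "(nat \<Rightarrow> trm) \<Rightarrow> trm \<Rightarrow> trm \<Rightarrow> bool" where
  "subst_rel \<sigma> s t \<longleftrightarrow> subst \<sigma> s = t"

text \<open>Substitutions are functions and have no codes; they enter as computable families
  \<open>\<rho> e\<close> indexed by an encodable parameter.\<close>

lemma re_subst_rel:
  fixes \<rho> :: "'b::enc \<Rightarrow> nat \<Rightarrow> trm"
  assumes \<rho>: "cf (\<lambda>p. \<rho> (fst p) (snd p))" and "cf e" "cf f" "cf g"
  shows "re (\<lambda>x. subst_rel (\<rho> (e x)) (f x) (g x))"
proof (rule re_compose3[OF _ assms(2-)])
  let ?P = "\<lambda>p. subst_rel (\<rho> (fst p)) (fst (snd p)) (snd (snd p))"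
  let ?K = "\<lambda>p ys. \<exists>e s t. p = (e, s, t) \<and> ((\<exists>x. s = Var x \<and> t = \<rho> e x) \<or>
    (\<exists>f ss ts. s = Fun f ss \<and> t = Fun f ts \<and> list_all2 (\<lambda>s t. (e, s, t) \<in> set ys) ss ts))"
  have \<rho>': "cf (\<lambda>x. \<rho> (a x) (b x))" if "cf a" "cf b" for a :: "'c::enc \<Rightarrow> 'b" and b
    using cf_compose[OF \<rho> cf_pair[OF that]] by simp
  show "re ?P"
  proof (rule re_recursive[where m = "\<lambda>p. weight (fst (snd p))" and K = ?K])
    show "re (\<lambda>p. ?K (fst p) (snd p))"
      by (intro \<rho>' re_intros)
    show "?P p" if "?K p ys" "\<forall>y\<in>set ys. ?P y" for p ys
      using that by (fastforce simp: subst_rel_def list_all2_conv_all_nth intro: nth_equalityI)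
    show "\<exists>ys. ?K p ys \<and> (\<forall>y\<in>set ys. ?P y \<and> weight (fst (snd y)) < weight (fst (snd p)))" if "?P p" for p
    proof -
      obtain e s t where p: "p = (e, s, t)"
        by (cases p)
      show ?thesis
      proof (cases s)
        case (Var x)
        then show ?thesis
          using that by (intro exI[of _ "[]"]) (auto simp: p subst_rel_def)
      next
        case (Fun f ss)
        then show ?thesis
          using that weight_arg_less[of _ ss f]
          by (intro exI[of _ "map (\<lambda>s. (e, s, subst (\<rho> e) s)) ss"])
            (auto simp: p subst_rel_def list_all2_conv_all_nth simp del: weight.simps)
      qed
    qed
  qed
qed

text \<open>A list standing for a substitution that is the identity past its end. It replaces the
  arbitrary \<open>\<sigma>\<close> of \<open>rstep.root\<close>, of which only the values on the
  variables of one rule matter.\<close>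

definition assign :: "trm list \<Rightarrow> nat \<Rightarrow> trm" where
  "assign ts i = (if drop i ts = [] then Var i else hd (drop i ts))"

lemma cf_if_Nil:
  fixes f :: "'a::enc \<Rightarrow> 'b::enc" and h :: "'a \<Rightarrow> 'c::enc list"
  assumes "cf f" "cf g" "cf h"
  shows "cf (\<lambda>x. if h x = [] then f x else g x)"
proof -
  have "code xs = 0 \<longleftrightarrow> xs = []" for xs :: "'c list"
    by (cases xs) (auto simp: code_list_def)
  then show ?thesis
    using rc_if[of 1 "\<lambda>xs. code (h (decode (xs ! 0)))" "\<lambda>xs. code (f (decode (xs ! 0)))"
        "\<lambda>xs. code (g (decode (xs ! 0)))"] assms unfolding cf_def
    by (simp add: if_distrib cong: if_cong)
qed

lemma cf_if_eq:
  fixes f :: "'a::enc \<Rightarrow> 'b::enc" and h k :: "'a \<Rightarrow> 'c::enc"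
  assumes "cf f" "cf g" "cf h" "cf k"
  shows "cf (\<lambda>x. if h x = k x then f x else g x)"
proof -
  have "rc 1 (\<lambda>xs. if h (decode (xs ! 0)) = k (decode (xs ! 0)) then 0 else 1)"
    using dec_eq[OF assms(3,4)] unfolding dec_def .
  from rc_if[OF this, of "\<lambda>xs. code (f (decode (xs ! 0)))" "\<lambda>xs. code (g (decode (xs ! 0)))"]
  show ?thesis
    using assms unfolding cf_def by (auto elim!: rc_cong)
qed

lemma cf_assign: "cf (\<lambda>p. assign (fst p) (snd p))"
proof -
  have hd: "hd xs = decode (fst (prod_decode (code xs - 1)))" if "xs \<noteq> []" for xs :: "trm list"
    using that by (cases xs) (auto simp: code_list_def)
  have e: "assign ts i = (if drop i ts = [] then Var i
      else decode (fst (prod_decode (code (drop i ts) - 1))))" for ts i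
    using hd by (simp add: assign_def)
  have pred: "cf (\<lambda>x. f x - 1 :: nat)" if "cf f" for f :: "'a::enc \<Rightarrow> nat"
    using that rc_diff[OF _ rc_const[of 1 1]] unfolding cf_def by simp
  show ?thesis
    unfolding e by (intro cf_if_Nil cf_decode cf_compose[OF cf_prod_decode] pred re_intros)
qed

lemma assign_map: "subst (assign (map \<sigma> [0..<m])) t = subst \<sigma> t" if "vars t \<subseteq> {..<m}"
proof (rule subst_cong)
  fix x
  assume "x \<in> vars t"
  then have "x < m"
    using that by auto
  then show "assign (map \<sigma> [0..<m]) x = \<sigma> x"
    by (simp add: assign_def hd_drop_conv_nth)
qed

lemmas re_assign [re_intros] = re_subst_rel[of assign, OF cf_assign]

lemma re_rstep:
  assumes "cf R" "cf f" "cf g"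
  shows "re (\<lambda>x. (f x, g x) \<in> rstep (set (R x)))"
proof (rule re_compose3[OF _ assms])
  let ?P = "\<lambda>p. (fst (snd p), snd (snd p)) \<in> rstep (set (fst p))"
  let ?K = "\<lambda>p ys. \<exists>R s t. p = (R, s, t) \<and>
    ((\<exists>l r \<tau>. (l, r) \<in> set R \<and> subst_rel (assign \<tau>) l s \<and> subst_rel (assign \<tau>) r t) \<or>
     (\<exists>f us s' t' vs ss ts. s = Fun f ss \<and> t = Fun f ts \<and> append_rel us (s' # vs) ss \<and>
        append_rel us (t' # vs) ts \<and> ys = [(R, s', t')]))"
  show "re ?P"
  proof (rule re_inductive[where K = ?K])
    show "re (\<lambda>p. ?K (fst p) (snd p))"
      by (intro re_intros)
    show "?P p" if "?K p ys" "\<forall>y\<in>set ys. ?P y" for p ys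
      using that by (auto simp: subst_rel_def append_rel_def intro: rstep.intros)
    have "(s, t) \<in> rstep (set R) \<Longrightarrow> derivable ?K (R, s, t)" for R s t
    proof (induction rule: rstep.induct)
      case (root l r \<sigma>)
      obtain m where m: "vars l \<union> vars r \<subseteq> {..<m}"
        using finite_nat_set_iff_bounded[of "vars l \<union> vars r"] by auto
      show ?case
        by (rule derivable.intros[of _ _ "[]"])
          (use root m assign_map[of _ m \<sigma>] in \<open>auto simp: subst_rel_def intro!: exI[of _ "map \<sigma> [0..<m]"]\<close>)
    next
      case (arg s t f us vs)
      show ?case
      proof (rule derivable_step[of ?K _ "(R, s, t)"])
        have "append_rel us (s # vs) (us @ s # vs)" "append_rel us (t # vs) (us @ t # vs)"
          by (simp_all add: append_rel_def)
        then show "?K (R, Fun f (us @ s # vs), Fun f (us @ t # vs)) [(R, s, t)]"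
          by (intro exI conjI disjI2) (rule refl | assumption)+
      qed (rule arg.IH)
    qed
    then show "derivable ?K p" if "?P p" for p
      using that by (cases p) auto
  qed
qed

lemmas re_rsteps = re_rtrancl[of "\<lambda>R. rstep (set R)", OF re_rstep[OF cf_fst[OF cf_id]
      cf_fst[OF cf_snd[OF cf_id]] cf_snd[OF cf_snd[OF cf_id]]]]

lemma re_joinable [re_intros]: "cf R \<Longrightarrow> cf f \<Longrightarrow> cf g \<Longrightarrow> re (\<lambda>x. joinable (set (R x)) (f x) (g x))"
proof -
  assume *: "cf R" "cf f" "cf g"
  show ?thesis
    unfolding joinable_def by (intro re_ex re_conj re_rsteps cf_compose[OF *(1)] cf_compose[OF *(2)]
        cf_compose[OF *(3)] cf_fst cf_snd cf_id)
qed

lemma re_in_vars [re_intros]: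
  assumes "cf f" "cf g"
  shows "re (\<lambda>x. f x \<in> vars (g x))"
proof (rule re_compose2[OF _ assms])
  let ?P = "\<lambda>p. fst p \<in> vars (snd p)"
  let ?K = "\<lambda>p ys. \<exists>x t. p = (x, t) \<and>
    (t = Var x \<or> (\<exists>f ts u. t = Fun f ts \<and> u \<in> set ts \<and> ys = [(x, u)]))"
  show "re ?P"
  proof (rule re_recursive[where K = ?K and m = "\<lambda>p. weight (snd p)"])
    show "re (\<lambda>p. ?K (fst p) (snd p))"
      by (intro re_intros)
    show "?P p" if "?K p ys" "\<forall>y\<in>set ys. ?P y" for p ys
      using that by auto
    show "\<exists>ys. ?K p ys \<and> (\<forall>y\<in>set ys. ?P y \<and> weight (snd y) < weight (snd p))" if "?P p" for p
    proof (cases "snd p")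
      case (Var y)
      then show ?thesis
        using that by (intro exI[of _ "[]"]) (cases p, auto)
    next
      case (Fun f ts)
      then obtain u where "u \<in> set ts" "fst p \<in> vars u"
        using \<open>?P p\<close> by auto
      then show ?thesis
        using Fun weight_arg_less[of u ts f]
        by (intro exI[of _ "[(fst p, u)]"]) (cases p, auto simp del: weight.simps)
    qed
  qed
qed

lemma cf_binding: "cf (\<lambda>p. (Var(fst (fst p) := snd (fst p))) (snd p))"
  unfolding fun_upd_apply by (intro cf_if_eq re_intros)

lemmas re_binding = re_subst_rel[of "\<lambda>b. Var(fst b := snd b)", OF cf_binding, of "\<lambda>x. (y x, t x)" for y t,
    unfolded fst_conv snd_conv, OF cf_pair]

text \<open>Expresses \<open>zip\<close> and the equality of lengths by two elementwise conditions
  on a guessed list \<open>D\<close>, as handled by \<open>re_list_all2\<close>.\<close>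

lemma zip_rel:
  "list_all2 (\<lambda>s d. s = fst d) ss D \<and> list_all2 (\<lambda>t d. t = snd d) ts D \<longleftrightarrow>
    length ss = length ts \<and> D = zip ss ts"
  by (auto simp: list_all2_conv_all_nth intro!: nth_equalityI prod_eqI)

text \<open>A positive form of the length condition in \<open>clash\<close>, enumerable by guessing
  a position.\<close>

lemma length_neq_iff:
  "length xs \<noteq> length ys \<longleftrightarrow> (\<exists>m. drop m xs = [] \<and> drop m ys \<noteq> [] \<or> drop m xs \<noteq> [] \<and> drop m ys = [])"
  by (auto simp: not_le) (metis leI le_refl linorder_neqE_nat not_le)

lemma map_prod_rel:
  "list_all2 (\<lambda>p q. subst_rel \<sigma> (fst p) (fst q) \<and> subst_rel \<sigma> (snd p) (snd q)) E E' \<longleftrightarrow>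
    E' = map (map_prod (subst \<sigma>) (subst \<sigma>)) E"
  by (auto simp: list_all2_conv_all_nth subst_rel_def intro!: nth_equalityI prod_eqI)

text \<open>\<open>K\<close> has one disjunct per introduction rule. No measure decreases along the
  rules, since \<open>swap\<close> can be repeated and \<open>elim\<close> may enlarge the
  equations, so derivations are matched by rule induction.\<close>

lemma re_covered:
  assumes "cf R" "cf E" "cf f" "cf g"
  shows "re (\<lambda>x. covered (set (R x)) (E x) (f x) (g x))"
proof (rule re_compose4[OF _ assms])
  let ?P = "\<lambda>p. covered (set (fst p)) (fst (snd p)) (fst (snd (snd p))) (snd (snd (snd p)))"
  let ?K = "\<lambda>p us. \<exists>R E a b. p = (R, E, a, b) \<and>
    ((E = [] \<and> joinable (set R) a b) \<or>
     (\<exists>t E'. E = (t, t) # E' \<and> us = [(R, E', a, b)]) \<or>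
     (\<exists>f ss g ts E' m. E = (Fun f ss, Fun g ts) # E' \<and>
       (f \<noteq> g \<or> drop m ss = [] \<and> drop m ts \<noteq> [] \<or> drop m ss \<noteq> [] \<and> drop m ts = [])) \<or>
     (\<exists>f ss ts E' D E''. E = (Fun f ss, Fun f ts) # E' \<and> list_all2 (\<lambda>s d. s = fst d) ss D \<and>
       list_all2 (\<lambda>t d. t = snd d) ts D \<and> append_rel D E' E'' \<and> us = [(R, E'', a, b)]) \<or>
     (\<exists>x t E' E'' a' b'. E = (Var x, t) # E' \<and>
       list_all2 (\<lambda>p q. subst_rel (Var(x := t)) (fst p) (fst q) \<and>
         subst_rel (Var(x := t)) (snd p) (snd q)) E' E'' \<and>
       subst_rel (Var(x := t)) a a' \<and> subst_rel (Var(x := t)) b b' \<and> us = [(R, E'', a', b')]) \<or>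
     (\<exists>x t E'. E = (Var x, t) # E' \<and> x \<in> vars t \<and> t \<noteq> Var x) \<or>
     (\<exists>s t E'. E = (s, t) # E' \<and> us = [(R, (t, s) # E', a, b)]))"
  show "re ?P"
  proof (rule re_inductive[where K = ?K])
    show "re (\<lambda>p. ?K (fst p) (snd p))"
      by (intro re_binding re_intros)
    show "?P p" if "?K p us" "\<forall>y\<in>set us. ?P y" for p us
      using that(1)
    proof (elim exE conjE disjE)
      fix R E a b f ss ts E' D E''
      assume "p = (R, E, a, b)" "E = (Fun f ss, Fun f ts) # E'" "list_all2 (\<lambda>s d. s = fst d) ss D"
        "list_all2 (\<lambda>t d. t = snd d) ts D" "append_rel D E' E''" "us = [(R, E'', a, b)]"
      then show "?P p"
        using that(2) zip_rel[of ss D ts] by (auto simp: append_rel_def intro: covered.decompose)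
    next
      fix R E a b x t E' E'' a' b'
      assume *: "p = (R, E, a, b)" "E = (Var x, t) # E'"
        "list_all2 (\<lambda>p q. subst_rel (Var(x := t)) (fst p) (fst q) \<and>
         subst_rel (Var(x := t)) (snd p) (snd q)) E' E''"
        "subst_rel (Var(x := t)) a a'" "subst_rel (Var(x := t)) b b'" "us = [(R, E'', a', b')]"
      have "E'' = map (map_prod (subst (Var(x := t))) (subst (Var(x := t)))) E'"
        using *(3) by (simp only: map_prod_rel)
      then show "?P p"
        using that(2) * covered.elim[of "set R" x t E' a b] by (simp add: subst_rel_def)
    next
      fix R E a b f ss g ts E' m
      assume "p = (R, E, a, b)" "E = (Fun f ss, Fun g ts) # E'" "f \<noteq> g"
      then show "?P p"
        by (auto intro: covered.clash)
    next
      fix R E a b f ss g ts E' m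
      assume *: "p = (R, E, a, b)" "E = (Fun f ss, Fun g ts) # E'" "drop m ss = []" "drop m ts \<noteq> []"
      then have "length ss \<noteq> length ts"
        by auto
      then show "?P p"
        using * by (auto intro: covered.clash)
    next
      fix R E a b f ss g ts E' m
      assume *: "p = (R, E, a, b)" "E = (Fun f ss, Fun g ts) # E'" "drop m ss \<noteq> []" "drop m ts = []"
      then have "length ss \<noteq> length ts"
        by auto
      then show "?P p"
        using * by (auto intro: covered.clash)
    qed (use that(2) in \<open>auto intro: covered.solved covered.trivial covered.occurs covered.swap\<close>)
    have "covered (set R) E a b \<Longrightarrow> derivable ?K (R, E, a, b)" for R E a b
    proof (induction rule: covered.induct)
      case (solved a b)
      show ?case
      proof (rule derivable_axiom[of ?K])
        show "?K (R, [], a, b) []"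
          by (rule exI, rule exI, rule exI, rule exI, rule conjI, rule refl, rule disjI1, intro conjI refl solved)
      qed
    next
      case (trivial E a b t)
      show ?case
      proof (rule derivable_step[of ?K _ "(R, E, a, b)"])
        show "?K (R, (t, t) # E, a, b) [(R, E, a, b)]"
          by (rule exI, rule exI, rule exI, rule exI, rule conjI, rule refl, rule disjI2, rule disjI1, intro exI conjI, (rule refl)+)
      qed (rule trivial.IH)
    next
      case (clash f g ss ts E a b)
      then obtain m where m: "f \<noteq> g \<or> drop m ss = [] \<and> drop m ts \<noteq> [] \<or> drop m ss \<noteq> [] \<and> drop m ts = []"
        unfolding length_neq_iff by blast
      show ?case
      proof (rule derivable_axiom[of ?K])
        show "?K (R, (Fun f ss, Fun g ts) # E, a, b) []"
          by (rule exI, rule exI, rule exI, rule exI, rule conjI, rule refl, rule disjI2, rule disjI2, rule disjI1, intro exI conjI, rule refl, rule m)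
      qed
    next
      case (decompose ss ts E a b f)
      show ?case
      proof (rule derivable_step[of ?K _ "(R, zip ss ts @ E, a, b)"])
        have *: "list_all2 (\<lambda>s d. s = fst d) ss (zip ss ts)" "list_all2 (\<lambda>t d. t = snd d) ts (zip ss ts)"
          "append_rel (zip ss ts) E (zip ss ts @ E)"
          using zip_rel[of ss "zip ss ts" ts] decompose by (simp_all add: append_rel_def)
        show "?K (R, (Fun f ss, Fun f ts) # E, a, b) [(R, zip ss ts @ E, a, b)]"
          by (rule exI, rule exI, rule exI, rule exI, rule conjI, rule refl, rule disjI2, rule disjI2, rule disjI2, rule disjI1, intro exI conjI, rule refl, rule *, rule *, rule *, rule refl)
      qed (rule decompose.IH)
    next
      case (elim x t E a b)
      let ?\<sigma> = "Var(x := t)"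
      let ?E = "map (map_prod (subst ?\<sigma>) (subst ?\<sigma>)) E"
      show ?case
      proof (rule derivable_step[of ?K _ "(R, ?E, subst ?\<sigma> a, subst ?\<sigma> b)"])
        have *: "list_all2 (\<lambda>p q. subst_rel ?\<sigma> (fst p) (fst q) \<and> subst_rel ?\<sigma> (snd p) (snd q)) E ?E"
          "subst_rel ?\<sigma> a (subst ?\<sigma> a)" "subst_rel ?\<sigma> b (subst ?\<sigma> b)"
          by (simp_all only: map_prod_rel) (simp_all add: subst_rel_def)
        show "?K (R, (Var x, t) # E, a, b) [(R, ?E, subst ?\<sigma> a, subst ?\<sigma> b)]"
          by (rule exI, rule exI, rule exI, rule exI, rule conjI, rule refl, rule disjI2, rule disjI2, rule disjI2, rule disjI2, rule disjI1, intro exI conjI, rule refl, rule *, rule *, rule *, rule refl)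
      qed (rule elim.IH)
    next
      case (occurs x t E a b)
      show ?case
      proof (rule derivable_axiom[of ?K])
        show "?K (R, (Var x, t) # E, a, b) []"
          by (rule exI, rule exI, rule exI, rule exI, rule conjI, rule refl, rule disjI2, rule disjI2, rule disjI2, rule disjI2, rule disjI2, rule disjI1, intro exI conjI, rule refl, rule occurs, rule occurs)
      qed
    next
      case (swap t s E a b)
      show ?case
      proof (rule derivable_step[of ?K _ "(R, (t, s) # E, a, b)"])
        show "?K (R, (s, t) # E, a, b) [(R, (t, s) # E, a, b)]"
          by (rule exI, rule exI, rule exI, rule exI, rule conjI, rule refl, rule disjI2, rule disjI2, rule disjI2, rule disjI2, rule disjI2, rule disjI2, intro exI conjI, (rule refl)+)
      qed (rule swap.IH)
    qed
    then show "derivable ?K p" if "?P p" for p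
      using that by (cases p) auto
  qed
qed

definition plugs_to :: "ctxt \<Rightarrow> trm \<Rightarrow> trm \<Rightarrow> bool" where
  "plugs_to C s t \<longleftrightarrow> plug C s = t"

lemma re_plugs_to [re_intros]:
  assumes "cf C" "cf f" "cf g"
  shows "re (\<lambda>x. plugs_to (C x) (f x) (g x))"
proof (rule re_compose3[OF _ assms])
  let ?P = "\<lambda>p. plugs_to (fst p) (fst (snd p)) (snd (snd p))"
  let ?K = "\<lambda>p ys. \<exists>C s t. p = (C, s, t) \<and> (C = [] \<and> s = t \<or>
    (\<exists>f us vs C' ss. C = (f, us, vs) # C' \<and> append_rel us (s # vs) ss \<and> ys = [(C', Fun f ss, t)]))"
  show "re ?P"
  proof (rule re_recursive[where K = ?K and m = "\<lambda>p. length (fst p)"])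
    show "re (\<lambda>p. ?K (fst p) (snd p))"
      by (intro re_intros)
    show "?P p" if "?K p ys" "\<forall>y\<in>set ys. ?P y" for p ys
      using that by (auto simp: plugs_to_def append_rel_def)
    show "\<exists>ys. ?K p ys \<and> (\<forall>y\<in>set ys. ?P y \<and> length (fst y) < length (fst p))" if "?P p" for p
    proof -
      obtain C s t where p: "p = (C, s, t)"
        by (cases p)
      show ?thesis
      proof (cases C)
        case Nil
        then show ?thesis
          using that by (intro exI[of _ "[]"]) (simp add: p plugs_to_def)
      next
        case (Cons c C')
        then obtain f us vs where "C = (f, us, vs) # C'"
          by (cases c) auto
        then show ?thesis
          using that by (intro exI[of _ "[(C', Fun f (us @ s # vs), t)]"])
            (simp add: p plugs_to_def append_rel_def)
      qed
    qed
  qed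
qed

lemma overlaps_covered_Var: "overlaps_covered R r l' r' C (Var x)"
proof -
  have "plug D (Fun f ts) \<noteq> Var x" for D f ts
    by (induction D "Fun f ts" arbitrary: f ts rule: plug.induct) auto
  then show ?thesis
    unfolding overlaps_covered_def by metis
qed

text \<open>An overlap is at the root or below one argument. In the second case the frame around
  that argument moves from the outer end of \<open>D\<close> to the inner end of
  \<open>C\<close>.\<close>

lemma overlaps_covered_Fun:
  "overlaps_covered R r l' r' C (Fun f ts) \<longleftrightarrow> covered R [(Fun f ts, l')] r (plug C r') \<and>
    (\<forall>us s vs. ts = us @ s # vs \<longrightarrow> overlaps_covered R r l' r' ((f, us, vs) # C) s)"
  (is "?L \<longleftrightarrow> ?R")
proof
  assume L: ?L
  have "covered R [(Fun f ts, l')] r (plug C r')"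
    using L[unfolded overlaps_covered_def, rule_format, of "[]"] by simp
  moreover have "overlaps_covered R r l' r' ((f, us, vs) # C) s" if "ts = us @ s # vs" for us s vs
    unfolding overlaps_covered_def
  proof (intro allI impI)
    fix D g ss
    assume "s = plug D (Fun g ss)"
    then show "covered R [(Fun g ss, l')] r (plug ((f, us, vs) # C) (plug D r'))"
      using L[unfolded overlaps_covered_def, rule_format, of "D @ [(f, us, vs)]"] that by simp
  qed
  ultimately show ?R
    by blast
next
  assume R: ?R
  show ?L
    unfolding overlaps_covered_def
  proof (intro allI impI)
    fix D g ss
    assume eq: "Fun f ts = plug D (Fun g ss)"
    show "covered R [(Fun g ss, l')] r (plug C (plug D r'))"
    proof (cases D rule: rev_cases)
      case Nil
      then show ?thesis
        using eq R by simp
    next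
      case (snoc D' c)
      obtain h us vs where c: "c = (h, us, vs)"
        by (cases c)
      then have h: "h = f" "ts = us @ plug D' (Fun g ss) # vs"
        using eq snoc by auto
      then have "overlaps_covered R r l' r' ((f, us, vs) # C) (plug D' (Fun g ss))"
        using R by blast
      from this[unfolded overlaps_covered_def, rule_format, OF refl] show ?thesis
        by (simp add: snoc c h)
    qed
  qed
qed

lemma re_overlaps_covered:
  assumes "cf R" "cf r" "cf l'" "cf r'" "cf C" "cf f"
  shows "re (\<lambda>x. overlaps_covered (set (R x)) (r x) (l' x) (r' x) (C x) (f x))"
proof -
  let ?P = "\<lambda>p. overlaps_covered (set (fst (fst p))) (fst (snd (fst p))) (fst (snd (snd (fst p))))
    (snd (snd (snd (fst p)))) (fst (snd p)) (snd (snd p))"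
  let ?K = "\<lambda>p ys. \<exists>R r l' r' C t. p = ((R, r, l', r'), C, t) \<and> ((\<exists>x. t = Var x) \<or>
    (\<exists>f ts u. t = Fun f ts \<and> plugs_to C r' u \<and> covered (set R) [(Fun f ts, l')] r u \<and>
      (\<forall>us s vs. ts = us @ s # vs \<longrightarrow> ((R, r, l', r'), (f, us, vs) # C, s) \<in> set ys)))"
  have "re ?P"
  proof (rule re_recursive[where K = ?K and m = "\<lambda>p. weight (snd (snd p))"])
    show "re (\<lambda>p. ?K (fst p) (snd p))"
      by (intro re_covered re_intros)
    show "?P p" if "?K p ys" "\<forall>y\<in>set ys. ?P y" for p ys
      using that(1)
    proof (elim exE conjE disjE)
      fix R r l' r' C t f ts u
      assume *: "p = ((R, r, l', r'), C, t)" "t = Fun f ts" "plugs_to C r' u"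
        "covered (set R) [(Fun f ts, l')] r u"
        "\<forall>us s vs. ts = us @ s # vs \<longrightarrow> ((R, r, l', r'), (f, us, vs) # C, s) \<in> set ys"
      have "overlaps_covered (set R) r l' r' ((f, us, vs) # C) s" if "ts = us @ s # vs" for us s vs
        using *(5)[rule_format, OF that] \<open>\<forall>y\<in>set ys. ?P y\<close> by fastforce
      then show "?P p"
        using * by (simp add: overlaps_covered_Fun plugs_to_def)
    qed (simp add: overlaps_covered_Var)
    show "\<exists>ys. ?K p ys \<and> (\<forall>y\<in>set ys. ?P y \<and> weight (snd (snd y)) < weight (snd (snd p)))"
      if "?P p" for p
    proof -
      obtain R r l' r' C t where p: "p = ((R, r, l', r'), C, t)"
        by (metis prod.collapse)
      show ?thesis
      proof (cases t)
        case (Var x)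
        then show ?thesis
          by (intro exI[of _ "[]"]) (simp add: p)
      next
        case (Fun f ts)
        let ?y = "\<lambda>i. ((R, r, l', r'), (f, take i ts, drop (Suc i) ts) # C, ts ! i)"
        let ?ys = "map ?y [0..<length ts]"
        have oc: "covered (set R) [(Fun f ts, l')] r (plug C r')"
          "\<And>us s vs. ts = us @ s # vs \<Longrightarrow> overlaps_covered (set R) r l' r' ((f, us, vs) # C) s"
          using that unfolding p Fun fst_conv snd_conv overlaps_covered_Fun by blast+
        have "((R, r, l', r'), (f, us, vs) # C, s) \<in> set ?ys" if "ts = us @ s # vs" for us s vs
          using that by (auto intro!: image_eqI[of _ _ "length us"])
        then have "?K p ?ys"
          using oc(1) unfolding p Fun plugs_to_def by blast
        moreover have "?P (?y i)" if "i < length ts" for i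
          using oc(2)[OF id_take_nth_drop[OF that]] by simp
        moreover have "weight (ts ! i) < weight t" if "i < length ts" for i
          using weight_arg_less[of "ts ! i" ts f] that Fun by simp
        ultimately show ?thesis
          by (intro exI[of _ ?ys]) (simp add: p)
      qed
    qed
  qed
  from re_compose[OF this, of "\<lambda>x. ((R x, r x, l' x, r' x), C x, f x)"] show ?thesis
    using assms by (simp add: cf_pair)
qed


subsection \<open>Finite algebras\<close>

lemma re_evaluates [re_intros]:
  assumes "cf T" "cf \<alpha>" "cf f" "cf g"
  shows "re (\<lambda>x. evaluates (T x) (\<alpha> x) (f x) (g x))"
proof (rule re_compose4[OF _ assms])
  let ?P = "\<lambda>p. evaluates (fst p) (fst (snd p)) (fst (snd (snd p))) (snd (snd (snd p)))"
  let ?K = "\<lambda>p ys. \<exists>T \<alpha> t a. p = (T, \<alpha>, t, a) \<and> ((\<exists>i r. t = Var i \<and> drop i \<alpha> = a # r) \<or>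
    (\<exists>f ts as. t = Fun f ts \<and> ((f, as), a) \<in> set T \<and> list_all2 (\<lambda>t a. (T, \<alpha>, t, a) \<in> set ys) ts as))"
  show "re ?P"
  proof (rule re_recursive[where K = ?K and m = "\<lambda>p. weight (fst (snd (snd p)))"])
    show "re (\<lambda>p. ?K (fst p) (snd p))"
      by (intro re_intros)
    show "?P p" if "?K p ys" "\<forall>y\<in>set ys. ?P y" for p ys
      using that(1)
    proof (elim exE conjE disjE)
      fix T \<alpha> t a f ts as
      assume *: "p = (T, \<alpha>, t, a)" "t = Fun f ts" "((f, as), a) \<in> set T"
        "list_all2 (\<lambda>t a. (T, \<alpha>, t, a) \<in> set ys) ts as"
      have "list_all2 (evaluates T \<alpha>) ts as"
        using *(4) by (rule list_all2_mono) (use that(2) in fastforce)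
      then show "?P p"
        using * by (simp add: evaluates.Fun)
    qed (auto simp: evaluates_Var_iff drop_eq_Cons_iff)
    show "\<exists>ys. ?K p ys \<and> (\<forall>y\<in>set ys. ?P y \<and> weight (fst (snd (snd y))) < weight (fst (snd (snd p))))"
      if "?P p" for p
    proof -
      obtain T \<alpha> t a where p: "p = (T, \<alpha>, t, a)"
        by (cases p)
      show ?thesis
      proof (cases t)
        case (Var i)
        then show ?thesis
          using that by (intro exI[of _ "[]"]) (simp add: p evaluates_Var_iff drop_eq_Cons_iff)
      next
        case (Fun f ts)
        then obtain as where as: "list_all2 (evaluates T \<alpha>) ts as" "((f, as), a) \<in> set T"
          using \<open>?P p\<close> by (auto simp: p evaluates_Fun_iff)
        let ?ys = "map (\<lambda>(t, a). (T, \<alpha>, t, a)) (zip ts as)"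
        have "list_all2 (\<lambda>t a. (T, \<alpha>, t, a) \<in> set ?ys) ts as"
          using as(1) by (force simp: list_all2_conv_all_nth set_zip)
        then have "?K p ?ys"
          using as(2) unfolding p Fun by blast
        moreover have "?P y \<and> weight (fst (snd (snd y))) < weight t" if "y \<in> set ?ys" for y
        proof -
          obtain u b where y: "y = (T, \<alpha>, u, b)" "(u, b) \<in> set (zip ts as)"
            using \<open>y \<in> set ?ys\<close> by auto
          have "u \<in> set ts"
            using y(2) by (rule set_zip_leftD)
          then show ?thesis
            using y as(1) weight_arg_less[of u ts f] Fun by (auto simp: list_all2_iff simp del: weight.simps)
        qed
        ultimately show ?thesis
          by (intro exI[of _ ?ys]) (simp add: p)
      qed
    qed
  qed
qed

text \<open>The quantifier over all tuples is not bounded by a given list. Recursion on the length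
  removes it: a guessed \<open>B'\<close> covers the shorter tuples, and all its extensions by some
  \<open>b < n\<close> must occur in \<open>B\<close>.\<close>

lemma re_tuples [re_intros]:
  assumes "cf f" "cf g" "cf h"
  shows "re (\<lambda>x. tuples (f x) (g x) (h x))"
proof (rule re_compose3[OF _ assms])
  let ?P = "\<lambda>p. tuples (fst p) (fst (snd p)) (snd (snd p))"
  let ?K = "\<lambda>(p :: nat \<times> nat \<times> nat list list) ys. \<exists>n m B. p = (n, m, B) \<and> (m = 0 \<and> [] \<in> set B \<or>
    (\<exists>m' B'. m = Suc m' \<and> ys = [(n, m', B')] \<and> (\<forall>\<beta>\<in>set B'. \<forall>b<n. b # \<beta> \<in> set B)))"
  show "re ?P"
  proof (rule re_recursive[where K = ?K and m = "\<lambda>p. fst (snd p)"])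
    show "re (\<lambda>p. ?K (fst p) (snd p))"
      by (intro re_intros)
    show "?P p" if "?K p ys" "\<forall>y\<in>set ys. ?P y" for p ys
      using that by (auto simp: tuples_def length_Suc_conv)
    show "\<exists>ys. ?K p ys \<and> (\<forall>y\<in>set ys. ?P y \<and> fst (snd y) < fst (snd p))" if "?P p" for p
    proof -
      obtain n m B where p: "p = (n, m, B)"
        by (cases p)
      show ?thesis
      proof (cases m)
        case 0
        then show ?thesis
          using that by (intro exI[of _ "[]"]) (simp add: p tuples_def)
      next
        case (Suc m')
        obtain B' where B': "set B' = {\<beta>. set \<beta> \<subseteq> {..<n} \<and> length \<beta> = m'}"
          using finite_list[OF finite_lists_length_eq[of "{..<n}" m']] by auto
        have "tuples n m' B'"
          by (auto simp: tuples_def B')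
        moreover have "b # \<beta> \<in> set B" if "\<beta> \<in> set B'" "b < n" for \<beta> b
          using \<open>?P p\<close> that by (auto simp: p tuples_def B' Suc subset_iff)
        ultimately show ?thesis
          using Suc by (intro exI[of _ "[(n, m', B')]"]) (auto simp: p)
      qed
    qed
  qed
qed

lemma table_over_iff: "table_over Sg n T \<longleftrightarrow>
    (\<forall>p\<in>set T. \<forall>q\<in>set T. fst p \<noteq> fst q \<or> snd p = snd q) \<and>
    (\<forall>e\<in>set T. fst (fst e) \<in> set Sg \<and> length_rel (snd (fst e)) (rank (fst (fst e))) \<and> snd e < n)"
  by (simp add: table_over_def functional_def length_rel_def)

lemma compatible_iff: "compatible T Q \<longleftrightarrow>
    (\<forall>e\<in>set T. \<forall>q\<in>set Q. \<forall>us p vs. snd (fst e) = us @ p # vs \<longrightarrow>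
      p \<noteq> fst q \<or> (\<exists>b as. append_rel us (snd q # vs) as \<and> ((fst (fst e), as), b) \<in> set T \<and> (snd e, b) \<in> set Q))"
  by (simp add: compatible_def append_rel_def)

lemma re_separated_peak [re_intros]: "cf f \<Longrightarrow> cf g \<Longrightarrow> re (\<lambda>x. separated_peak (f x) (g x))"
proof (rule re_compose2)
  show "re (\<lambda>p. separated_peak (fst p) (snd p))"
    unfolding separated_peak_def table_over_iff compatible_iff respects_rules_def closed_under_def
      disjoint_lists_def
    by (intro re_rstep re_intros)
qed


subsection \<open>Codes of finite sets\<close>

definition power_rel :: "nat \<Rightarrow> nat \<Rightarrow> bool" where
  "power_rel i k \<longleftrightarrow> k = 2 ^ i"

lemma re_power_rel [re_intros]:
  assumes "cf f" "cf g"
  shows "re (\<lambda>x. power_rel (f x) (g x))"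
proof (rule re_compose2[OF _ assms])
  let ?P = "\<lambda>p. power_rel (fst p) (snd p)"
  let ?K = "\<lambda>(p :: nat \<times> nat) ys. \<exists>i k. p = (i, k) \<and> (i = 0 \<and> k = 1 \<or> (\<exists>j m. i = Suc j \<and> k = m + m \<and> ys = [(j, m)]))"
  show "re ?P"
  proof (rule re_recursive[where K = ?K and m = fst])
    show "re (\<lambda>p. ?K (fst p) (snd p))"
      by (intro re_intros)
    show "?P p" if "?K p ys" "\<forall>y\<in>set ys. ?P y" for p ys
      using that by (auto simp: power_rel_def)
    show "\<exists>ys. ?K p ys \<and> (\<forall>y\<in>set ys. ?P y \<and> fst y < fst p)" if "?P p" for p
    proof (cases "fst p")
      case 0
      then show ?thesis
        using that by (intro exI[of _ "[]"]) (cases p, simp add: power_rel_def)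
    next
      case (Suc j)
      then show ?thesis
        using that by (intro exI[of _ "[(j, 2 ^ j)]"]) (cases p, simp add: power_rel_def)
    qed
  qed
qed

text \<open>Coded sets are never decoded: a list is guessed and its code compared with the given
  number. Distinctness makes that code the sum of \<open>2 ^ code x\<close> over the
  entries.\<close>

definition set_code :: "'a::enc list \<Rightarrow> nat \<Rightarrow> bool" where
  "set_code xs n \<longleftrightarrow> distinct xs \<and> n = set_encode (code ` set xs)"

lemma set_code_Nil: "set_code [] n \<longleftrightarrow> n = 0"
  by (simp add: set_code_def)

lemma set_code_Cons:
  "set_code (x # xs) n \<longleftrightarrow> (\<forall>y\<in>set xs. x \<noteq> y) \<and> (\<exists>m. set_code xs m \<and> n = m + 2 ^ code x)"
proof -
  have "set_encode (insert (code x) (code ` set xs)) = set_encode (code ` set xs) + 2 ^ code x"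
    if "x \<notin> set xs"
    using that by (subst set_encode_insert) auto
  then show ?thesis
    by (auto simp: set_code_def)
qed

lemma re_set_code [re_intros]:
  assumes "cf f" "cf g"
  shows "re (\<lambda>x. set_code (f x) (g x))"
proof (rule re_compose2[OF _ assms])
  let ?P = "\<lambda>p :: 'b list \<times> nat. set_code (fst p) (snd p)"
  let ?K = "\<lambda>p ys. \<exists>xs n. p = (xs, n) \<and> (xs = [] \<and> n = 0 \<or>
    (\<exists>x xs' m k. xs = x # xs' \<and> (\<forall>y\<in>set xs'. x \<noteq> y) \<and> power_rel (code x) k \<and> n = m + k \<and> ys = [(xs', m)]))"
  show "re ?P"
  proof (rule re_recursive[where K = ?K and m = "\<lambda>p. length (fst p)"])
    show "re (\<lambda>p. ?K (fst p) (snd p))"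
      by (intro re_intros)
    show "?P p" if "?K p ys" "\<forall>y\<in>set ys. ?P y" for p ys
      using that by (auto simp: power_rel_def set_code_Nil set_code_Cons)
    show "\<exists>ys. ?K p ys \<and> (\<forall>y\<in>set ys. ?P y \<and> length (fst y) < length (fst p))" if "?P p" for p
    proof (cases "fst p")
      case Nil
      then show ?thesis
        using that by (intro exI[of _ "[]"]) (cases p, simp add: set_code_Nil)
    next
      case (Cons x xs)
      then obtain m where "set_code xs m" "snd p = m + 2 ^ code x" "\<forall>y\<in>set xs. x \<noteq> y"
        using \<open>?P p\<close> by (auto simp: set_code_Cons)
      then show ?thesis
        using Cons by (intro exI[of _ "[(xs, m)]"]) (cases p, auto simp: power_rel_def)
    qed
  qed
qed

lemma set_code_set_encode_iff:
  fixes A :: "'a::enc set"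
  assumes "finite A"
  shows "set_code xs (set_encode (code ` A)) \<longleftrightarrow> distinct xs \<and> set xs = A"
proof -
  have "inj (code :: 'a \<Rightarrow> nat)"
    by (auto intro: injI)
  then show ?thesis
    using assms by (auto simp: set_code_def set_encode_eq inj_image_eq_iff)
qed

lemma code_alphabet_eq: "code_alphabet \<Sigma> = set_encode (code ` \<Sigma>)"
proof -
  have "code f = prod_encode f" for f :: symb
    by (cases f) (simp add: code_prod_def)
  then show ?thesis
    by (simp add: code_alphabet_def)
qed

lemma code_trs_eq: "code_trs R = set_encode (code ` R)"
proof -
  have "code \<rho> = (\<lambda>(l, r). prod_encode (code_trm l, code_trm r)) \<rho>" for \<rho> :: rule
    by (cases \<rho>) (simp add: code_prod_def code_trm_def)
  then show ?thesis
    by (simp add: code_trs_def)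
qed


section \<open>Decidability of local confluence\<close>

lemma cf_double: "cf (\<lambda>p. Var (snd p + snd p))" and cf_Suc_double: "cf (\<lambda>p. Var (Suc (snd p + snd p)))"
  by (intro re_intros)+

text \<open>The renamed sides of the rules become guessed results of \<open>subst_rel\<close>, which
  brings the condition within reach of the rules for \<open>re\<close>.\<close>

lemma critical_overlaps_covered_iff:
  "critical_overlaps_covered (set Rl) \<longleftrightarrow> (\<forall>\<rho>\<in>set Rl. \<forall>\<rho>'\<in>set Rl. \<exists>l r l' r'.
    subst_rel (\<lambda>x. Var (x + x)) (fst \<rho>) l \<and> subst_rel (\<lambda>x. Var (x + x)) (snd \<rho>) r \<and>
    subst_rel (\<lambda>x. Var (Suc (x + x))) (fst \<rho>') l' \<and> subst_rel (\<lambda>x. Var (Suc (x + x))) (snd \<rho>') r' \<and>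
    overlaps_covered (set Rl) r l' r' [] l)"
  by (simp add: critical_overlaps_covered_def subst_rel_def case_prod_beta)

lemma re_critical_overlaps_covered: "re (\<lambda>Rl. critical_overlaps_covered (set Rl))"
  unfolding critical_overlaps_covered_iff
  by (intro re_subst_rel[where \<rho> = "\<lambda>(e::nat) x. Var (x + x)", OF cf_double cf_const[of 0]]
      re_subst_rel[where \<rho> = "\<lambda>(e::nat) x. Var (Suc (x + x))", OF cf_Suc_double cf_const[of 0]]
      re_overlaps_covered re_intros)

theorem mainTheorem4:
  "\<exists>d. \<forall>\<Sigma> R. finite \<Sigma> \<and> trs \<Sigma> R \<and> eprf R \<longrightarrow>
     rec_eval d [code_alphabet \<Sigma>, code_trs R] = Some (if locally_confluent \<Sigma> R then 1 else 0)"
proof -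
  \<comment> \<open>Both predicates start from bare numbers and guess lists for the coded sets. They
    are complementary on codes of systems satisfying the hypotheses, as \<open>decider_of_re\<close>
    requires; elsewhere the outcome of the search is left open.\<close>
  let ?P = "\<lambda>p. \<exists>Rl. set_code Rl (snd p) \<and> critical_overlaps_covered (set Rl)"
  let ?N = "\<lambda>p. \<exists>Sg Rl. set_code Sg (fst p) \<and> set_code Rl (snd p) \<and> separated_peak Sg Rl"
  have "re ?P" "re ?N"
    by (intro re_compose[OF re_critical_overlaps_covered] re_intros)+
  then obtain d where d: "\<And>m n. ?P (m, n) \<noteq> ?N (m, n) \<Longrightarrow>
      rec_eval d [m, n] = Some (if ?P (m, n) then 1 else 0)"
    using decider_of_re[of ?P ?N] by blast
  have "rec_eval d [code_alphabet \<Sigma>, code_trs R] = Some (if locally_confluent \<Sigma> R then 1 else 0)"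
    if "finite \<Sigma>" and R: "trs \<Sigma> R" and "eprf R" for \<Sigma> R
  proof -
    have "finite R"
      using R by (simp add: trs_def)
    obtain Sg Rl where Sg: "distinct Sg" "set Sg = \<Sigma>" and Rl: "distinct Rl" "set Rl = R"
      using finite_distinct_list[OF \<open>finite \<Sigma>\<close>] finite_distinct_list[OF \<open>finite R\<close>] by blast
    have P: "?P (code_alphabet \<Sigma>, code_trs R) \<longleftrightarrow> locally_confluent \<Sigma> R"
      unfolding snd_conv code_trs_eq set_code_set_encode_iff[OF \<open>finite R\<close>]
        locally_confluent_iff_critical_overlaps_covered[OF R] using Rl by blast
    have "separated_peak Sg' Rl' \<longleftrightarrow> \<not> locally_confluent \<Sigma> R" if "set Sg' = \<Sigma>" "set Rl' = R" for Sg' Rl'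
      using separated_peak_not_locally_confluent[of Sg' Rl'] eprf_separated_peak[of Sg' Rl'] R \<open>eprf R\<close> that
      by blast
    then have N: "?N (code_alphabet \<Sigma>, code_trs R) \<longleftrightarrow> \<not> locally_confluent \<Sigma> R"
      unfolding fst_conv snd_conv code_trs_eq code_alphabet_eq
        set_code_set_encode_iff[OF \<open>finite R\<close>] set_code_set_encode_iff[OF \<open>finite \<Sigma>\<close>]
      using Sg Rl by blast
    show ?thesis
      using d[of "code_alphabet \<Sigma>" "code_trs R"] unfolding P N by simp
  qed
  then show ?thesis
    by blast
qed

end
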